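(* There exist countably infinitely many distinct $e$-positive (and hence Schur-positive) bases of the algebra of symmetric functions $\Lambda$ whose generators are chromatic symmetric functions of connected graphs. In particular, for every choice of lollipop graphs $\mathcal{L}_1,\mathcal{L}_2,\dots$ with $\mathcal{L}_i=L_{m_i,n_i}$ for some integers $m_i,n_i\geq 0$ with $m_i+n_i=i$, one has $$\Lambda=\mathbb{Q}[X_{\mathcal{L}_1},X_{\mathcal{L}_2},\dots],$$ for each $N$ the set $\{X_{\mathcal{L}_{\lambda_1}}X_{\mathcal{L}_{\lambda_2}}\cdots X_{\mathcal{L}_{\lambda_\ell}} : (\lambda_1,\dots,\lambda_\ell)\vdash N\}$ is a $\mathbb{Q}$-basis of $\Lambda^N$ consisting of $e$-positive (hence Schur-positive) symmetric functions, and distinct sets of lollipop graphs $\{\mathcal{L}_1,\mathcal{L}_2,\dots\}$ give rise to distinct sets of generators $\{X_{\mathcal{L}_1},X_{\mathcal{L}_2},\dots\}$.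
   Context: All graphs are finite and simple. For a graph $G$ with vertex set $\{v_1,\dots,v_N\}$, the chromatic symmetric function is $X_G=\sum_\kappa x_{\kappa(v_1)}\cdots x_{\kappa(v_N)}$, summed over all proper colourings $\kappa:V\to\{1,2,\dots\}$. $K_m$ is the complete graph on $m$ vertices, $P_n$ the path on $n$ vertices. For $m,n\geq1$ the lollipop graph $L_{m,n}$ is obtained from the disjoint union of $K_m$ and $P_n$ by adding an edge joining a vertex of $K_m$ to an end vertex of $P_n$; conventions $L_{m,0}=K_m$, $L_{0,n}=P_n$ (so e.g. $L_{2,n}=L_{1,n+1}=L_{0,n+2}=P_{n+2}$). $\Lambda=\bigoplus_{N\geq0}\Lambda^N$ is the algebra of symmetric functions over $\mathbb{Q}$, where $\Lambda^N$ is spanned by $e_\lambda=e_{\lambda_1}\cdots e_{\lambda_\ell}$ for $\lambda\vdash N$, $e_i$ being the $i$-th elementary symmetric function. A symmetric function is $e$-positive if it is a nonnegative linear combination of the $e_\lambda$, and Schur-positive if it is a nonnegative linear combination of Schur functions. *)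

theory Defs
  imports Complex_Main "HOL-Library.Multiset" "HOL-Library.FuncSet" "HOL-Library.Countable_Set"
begin

section \<open>Formal power series in countably many commuting variables\<close>

text \<open>
  The variables are indexed by \<^typ>\<open>nat\<close>, so that the colours \<open>1, 2, \<dots>\<close> become \<open>0, 1, \<dots>\<close>.
  A monomial is the finite multiset of the indices of its variables, and a series is an arbitrary
  assignment of rational coefficients to monomials.
\<close>

typedef mseries = "UNIV :: (nat multiset \<Rightarrow> rat) set"
  morphisms coeff MSeries ..

lemma coeff_MSeries [simp]: "coeff (MSeries f) = f"
  by (simp add: MSeries_inverse)

lemma mseries_eqI: "(\<And>M. coeff f M = coeff g M) \<Longrightarrow> f = g"
  by (metis coeff_inject ext)

lemma finite_mset_splits: "finite {(A, B). A + B = (M :: 'a multiset)}"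
proof (induction M)
  case empty
  have "{(A, B). A + B = ({#} :: 'a multiset)} = {({#}, {#})}" by auto
  then show ?case by simp
next
  case (add x M)
  let ?P = "{(A, B). A + B = M}"
  have "{(A, B). A + B = add_mset x M}
      \<subseteq> (\<lambda>(A, B). (add_mset x A, B)) ` ?P \<union> (\<lambda>(A, B). (A, add_mset x B)) ` ?P"
  proof (clarify)
    fix A B
    assume eq: "A + B = add_mset x M"
      and nin: "(A, B) \<notin> (\<lambda>(A, B). (A, add_mset x B)) ` ?P"
    show "(A, B) \<in> (\<lambda>(A, B). (add_mset x A, B)) ` ?P"
    proof (cases "x \<in># A")
      case True
      then obtain A' where "A = add_mset x A'" by (metis mset_add)
      with eq show ?thesis by (auto simp: image_iff)
    next
      case False
      with eq have "x \<in># B" by (metis union_iff union_single_eq_member add_mset_add_single)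
      then obtain B' where "B = add_mset x B'" by (metis mset_add)
      with eq nin show ?thesis by (auto simp: image_iff)
    qed
  qed
  with add.IH show ?case by (meson finite_UnI finite_imageI finite_subset)
qed

instantiation mseries :: comm_ring_1
begin

definition "0 = MSeries (\<lambda>M. 0)"
definition "1 = MSeries (\<lambda>M. if M = {#} then 1 else 0)"
definition "f + g = MSeries (\<lambda>M. coeff f M + coeff g M)"
definition "f - g = MSeries (\<lambda>M. coeff f M - coeff g M)"
definition "- f = MSeries (\<lambda>M. - coeff f M)"
definition "f * g = MSeries (\<lambda>M. \<Sum>(A, B) | A + B = M. coeff f A * coeff g B)"

instance
proof
  fix f g h :: mseries
  show "f + g + h = f + (g + h)" "f + g = g + f" "0 + f = f" "- f + f = 0" "f - g = f + - g"
    by (auto intro!: mseries_eqI simp: plus_mseries_def zero_mseries_def uminus_mseries_def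
        minus_mseries_def)
  show "(0 :: mseries) \<noteq> 1"
    unfolding zero_mseries_def one_mseries_def
    by (metis (mono_tags) coeff_MSeries zero_neq_one)
  show "(f + g) * h = f * h + g * h"
    by (intro mseries_eqI)
      (simp add: plus_mseries_def times_mseries_def case_prod_unfold distrib_right sum.distrib)
  show "f * g = g * f"
    by (intro mseries_eqI)
      (auto simp: times_mseries_def
        intro!: sum.reindex_bij_witness[where i = prod.swap and j = prod.swap])
  show "1 * f = f"
  proof (intro mseries_eqI)
    fix M
    let ?g = "\<lambda>(A :: nat multiset, B). (if A = {#} then 1 else 0) * coeff f B"
    have "coeff (1 * f) M = sum ?g {(A, B). A + B = M}"
      by (simp add: one_mseries_def times_mseries_def)
    also have "\<dots> = sum ?g {({#}, M)}"
      by (rule sum.mono_neutral_right[OF finite_mset_splits]) (auto split: if_splits)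
    finally show "coeff (1 * f) M = coeff f M" by simp
  qed
  show "f * g * h = f * (g * h)"
  proof (intro mseries_eqI)
    fix M
    let ?S = "\<lambda>M :: nat multiset. {p. fst p + snd p = M}"
    have fin: "finite (?S M)" for M
      using finite_mset_splits[of M] by (simp add: case_prod_unfold)
    have "coeff (f * g * h) M
        = (\<Sum>p\<in>?S M. \<Sum>q\<in>?S (fst p). coeff f (fst q) * coeff g (snd q) * coeff h (snd p))"
      by (simp add: times_mseries_def case_prod_unfold sum_distrib_right)
    also have "\<dots> = (\<Sum>(p, q)\<in>Sigma (?S M) (\<lambda>p. ?S (fst p)).
        coeff f (fst q) * coeff g (snd q) * coeff h (snd p))"
      by (rule sum.Sigma) (use fin in auto)
    also have "\<dots> = (\<Sum>(p, q)\<in>Sigma (?S M) (\<lambda>p. ?S (snd p)).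
        coeff f (fst p) * (coeff g (fst q) * coeff h (snd q)))"
      by (rule sum.reindex_bij_witness[where
            i = "\<lambda>(p, q). ((fst p + fst q, snd q), (fst p, fst q))" and
            j = "\<lambda>(p, q). ((fst q, snd q + snd p), (snd q, snd p))"])
        (auto simp: add.assoc mult.assoc)
    also have "\<dots> = (\<Sum>p\<in>?S M. \<Sum>q\<in>?S (snd p).
        coeff f (fst p) * (coeff g (fst q) * coeff h (snd q)))"
      by (rule sum.Sigma[symmetric]) (use fin in auto)
    also have "\<dots> = coeff (f * (g * h)) M"
      by (simp add: times_mseries_def case_prod_unfold sum_distrib_left)
    finally show "coeff (f * g * h) M = coeff (f * (g * h)) M" .
  qed
qed

end

definition scaleQ :: "rat \<Rightarrow> mseries \<Rightarrow> mseries" (infixr "*\<^sub>Q" 75)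
  where "c *\<^sub>Q f = MSeries (\<lambda>M. c * coeff f M)"

interpretation mseries: vector_space scaleQ
  by unfold_locales
    (auto intro!: mseries_eqI simp: scaleQ_def plus_mseries_def algebra_simps)

text \<open>\<open>Q_adjoin S\<close> is the rational subalgebra \<open>\<rat>[S]\<close> generated by \<open>S\<close>.\<close>

inductive_set Q_adjoin :: "mseries set \<Rightarrow> mseries set" for S where
  const: "c *\<^sub>Q 1 \<in> Q_adjoin S"
| gen: "f \<in> S \<Longrightarrow> f \<in> Q_adjoin S"
| add: "f \<in> Q_adjoin S \<Longrightarrow> g \<in> Q_adjoin S \<Longrightarrow> f + g \<in> Q_adjoin S"
| mult: "f \<in> Q_adjoin S \<Longrightarrow> g \<in> Q_adjoin S \<Longrightarrow> f * g \<in> Q_adjoin S"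

text \<open>
  A multiset \<open>M\<close> over the index set \<open>I\<close> stands for the monomial \<open>\<Prod>i\<in>#M. y\<^sub>i\<close> of a polynomial ring
  with variables \<open>y\<^sub>i\<close>; no nonzero polynomial vanishes under \<open>y\<^sub>i \<mapsto> X i\<close>.
\<close>

definition alg_independent :: "'i set \<Rightarrow> ('i \<Rightarrow> mseries) \<Rightarrow> bool" where
  "alg_independent I X \<longleftrightarrow>
    (\<forall>A c. finite A \<and> A \<subseteq> {M. set_mset M \<subseteq> I} \<and> (\<Sum>M\<in>A. c M *\<^sub>Q (\<Prod>i\<in>#M. X i)) = 0
      \<longrightarrow> (\<forall>M\<in>A. c M = 0))"

text \<open>\<open>W = \<rat>[X\<^sub>i : i \<in> I]\<close>, a polynomial ring in the \<open>X\<^sub>i\<close>.\<close>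

definition is_polynomial_ring :: "mseries set \<Rightarrow> 'i set \<Rightarrow> ('i \<Rightarrow> mseries) \<Rightarrow> bool" where
  "is_polynomial_ring W I X \<longleftrightarrow> W = Q_adjoin (X ` I) \<and> alg_independent I X"

definition is_basis :: "mseries set \<Rightarrow> mseries set \<Rightarrow> bool" where
  "is_basis W B \<longleftrightarrow> \<not> mseries.dependent B \<and> mseries.span B = W"


section \<open>Symmetric functions\<close>

definition partitions :: "nat list set" where
  "partitions = {\<mu>. sorted_wrt (\<ge>) \<mu> \<and> (\<forall>k\<in>set \<mu>. 0 < k)}"

definition partitions_of :: "nat \<Rightarrow> nat list set" where
  "partitions_of N = {\<mu> \<in> partitions. sum_list \<mu> = N}"

definition prod_of_parts :: "(nat \<Rightarrow> mseries) \<Rightarrow> nat list \<Rightarrow> mseries" where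
  "prod_of_parts b \<mu> = prod_list (map b \<mu>)"

definition elementary :: "nat \<Rightarrow> mseries" where
  "elementary k = MSeries (\<lambda>M. if size M = k \<and> (\<forall>i. count M i \<le> 1) then 1 else 0)"

definition Sym_degree :: "nat \<Rightarrow> mseries set" where
  "Sym_degree N = mseries.span (prod_of_parts elementary ` partitions_of N)"

definition Sym :: "mseries set" where
  "Sym = mseries.span (\<Union>N. Sym_degree N)"

definition cells :: "nat list \<Rightarrow> (nat \<times> nat) set" where
  "cells \<mu> = {(i, j). i < length \<mu> \<and> j < \<mu> ! i}"

definition semistandard_tableaux :: "nat list \<Rightarrow> (nat \<times> nat \<Rightarrow> nat) set" where
  "semistandard_tableaux \<mu> = {T \<in> extensional (cells \<mu>).
     (\<forall>i j. (i, Suc j) \<in> cells \<mu> \<longrightarrow> T (i, j) \<le> T (i, Suc j)) \<and>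
     (\<forall>i j. (Suc i, j) \<in> cells \<mu> \<longrightarrow> T (i, j) < T (Suc i, j))}"

definition schur :: "nat list \<Rightarrow> mseries" where
  "schur \<mu> = MSeries (\<lambda>M. of_nat (card
     {T \<in> semistandard_tableaux \<mu>. image_mset T (mset_set (cells \<mu>)) = M}))"

definition positive_wrt :: "(nat list \<Rightarrow> mseries) \<Rightarrow> mseries \<Rightarrow> bool" where
  "positive_wrt b f \<longleftrightarrow>
    (\<exists>A c. finite A \<and> A \<subseteq> partitions \<and> (\<forall>\<mu>\<in>A. 0 \<le> c \<mu>) \<and> f = (\<Sum>\<mu>\<in>A. c \<mu> *\<^sub>Q b \<mu>))"

definition e_positive :: "mseries \<Rightarrow> bool" where
  "e_positive = positive_wrt (prod_of_parts elementary)"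

definition schur_positive :: "mseries \<Rightarrow> bool" where
  "schur_positive = positive_wrt schur"


section \<open>Graphs and chromatic symmetric functions\<close>

record 'a sgraph =
  verts :: "'a set"
  edges :: "'a set set"

definition simple_graph :: "'a sgraph \<Rightarrow> bool" where
  "simple_graph G \<longleftrightarrow> finite (verts G) \<and> (\<forall>e\<in>edges G. e \<subseteq> verts G \<and> card e = 2)"

definition connected_graph :: "'a sgraph \<Rightarrow> bool" where
  "connected_graph G \<longleftrightarrow> verts G \<noteq> {} \<and>
    (\<forall>u\<in>verts G. \<forall>v\<in>verts G. (u, v) \<in> {(a, b). {a, b} \<in> edges G}\<^sup>*)"

definition proper_colourings :: "'a sgraph \<Rightarrow> ('a \<Rightarrow> nat) set" where
  "proper_colourings G =
    {\<kappa> \<in> extensional (verts G). \<forall>u v. u \<noteq> v \<and> {u, v} \<in> edges G \<longrightarrow> \<kappa> u \<noteq> \<kappa> v}"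

definition chromatic_sf :: "'a sgraph \<Rightarrow> mseries" where
  "chromatic_sf G = MSeries (\<lambda>M. of_nat (card
     {\<kappa> \<in> proper_colourings G. image_mset \<kappa> (mset_set (verts G)) = M}))"

text \<open>
  \<open>K\<^sub>m\<close> lives on \<open>{0..<m}\<close> and \<open>P\<^sub>n\<close> on \<open>{m..<m + n}\<close>; the joining edge is \<open>{m - 1, m}\<close>, present
  only when \<open>m\<close> and \<open>n\<close> are both positive. With this labelling, two lollipop graphs on the same
  number of vertices are isomorphic only if they are equal, so inequality of lollipop graphs is
  inequality of isomorphism types.
\<close>

definition lollipop :: "nat \<Rightarrow> nat \<Rightarrow> nat sgraph" where
  "lollipop m n = \<lparr>verts = {0..<m + n},
     edges = {{i, j} | i j. i < j \<and> j < m}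
           \<union> {{i, Suc i} | i. m \<le> i \<and> Suc i < m + n}
           \<union> (if 0 < m \<and> 0 < n then {{m - 1, m}} else {})\<rparr>"

end

theory Submission
  imports Defs
begin

text \<open>
  The products of the \<open>e\<^sub>k\<close> are independent because their leading monomials in dominance order are
  distinct. A family \<open>X\<^sub>i = c\<^sub>i e\<^sub>i + (polynomial in e\<^sub>1, \<dots>, e\<^bsub>i-1\<^esub>)\<close> with \<open>c\<^sub>i \<noteq> 0\<close> spans the same space in each
  degree with equally many products, so it generates the same polynomial ring. For lollipop graphs,
  comparing the number of edges between clique and path gives
  \<open>m X(L\<^bsub>m,n\<^esub>) = X(L\<^bsub>m+1,n-1\<^esub>) + (m - 1) X(K\<^sub>m) X(P\<^sub>n)\<close>, and starting from \<open>X(K\<^sub>N) = N! e\<^sub>N\<close> this yields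
  \<open>e\<close>-positivity together with \<open>c\<^sub>N > 0\<close>. Schur-positivity follows from the Pieri rule for \<open>e\<^sub>k s\<^sub>\<mu>\<close>, proved
  by induction on the number of variables: adding a vertical strip and removing a horizontal strip
  commute up to the factor \<open>1 + x y\<close>. Finally, \<open>X(L\<^bsub>m,n\<^esub>)\<close> determines the number of vertices and, for
  \<open>m \<ge> 2\<close>, the chromatic number \<open>m\<close>.
\<close>

section \<open>Arithmetic of coefficients\<close>

text \<open>Series have infinitely many variables, but a single coefficient involves only finitely
  many. This allows Schur functions to be replaced, coefficient by coefficient, by polynomials
  obeying the branching rule, for which induction on the variables is available. One invariant
  serves both positivity and triangularity: in degree N the coefficient of e_N is strictly positive.
  It survives the recurrence because X(K_m) X(P_n) contributes only products of e_k with k < N. A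
  set of products cannot show repetitions, so independence is handled for families indexed by
  multisets, and injectivity of the indexing is derived from it. The bases for the first claim
  differ from the all-path basis in one generator each; varying arbitrarily many generators at once
  would give uncountably many bases.\<close>

lemma coeff_0 [simp]: "coeff 0 M = 0"
  by (simp add: zero_mseries_def)

lemma coeff_1: "coeff 1 M = (if M = {#} then 1 else 0)"
  by (simp add: one_mseries_def)

lemma coeff_add [simp]: "coeff (f + g) M = coeff f M + coeff g M"
  by (simp add: plus_mseries_def)

lemma coeff_scaleQ [simp]: "coeff (c *\<^sub>Q f) M = c * coeff f M"
  by (simp add: scaleQ_def)

lemma coeff_sum [simp]: "coeff (sum f A) M = (\<Sum>a\<in>A. coeff (f a) M)"
  by (induction A rule: infinite_finite_induct) auto

lemma coeff_mult: "coeff (f * g) M = (\<Sum>(A, B) | A + B = M. coeff f A * coeff g B)"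
  by (simp add: times_mseries_def)

lemma mult_scaleQ_left [simp]: "(c *\<^sub>Q f) * g = c *\<^sub>Q (f * g)"
  by (intro mseries_eqI) (simp add: coeff_mult sum_distrib_left case_prod_unfold mult.assoc)

lemma mult_scaleQ_right [simp]: "f * (c *\<^sub>Q g) = c *\<^sub>Q (f * g)"
  using mult_scaleQ_left[of c g f] by (simp only: mult.commute)

lemma coeff_mult_nonzeroE:
  assumes "coeff (f * g) M \<noteq> 0"
  obtains A B where "A + B = M" "coeff f A \<noteq> 0" "coeff g B \<noteq> 0"
proof -
  from assms obtain p where "p \<in> {(A, B). A + B = M}" "(case p of (A, B) \<Rightarrow> coeff f A * coeff g B) \<noteq> 0"
    unfolding coeff_mult by (rule sum.not_neutral_contains_not_neutral)
  then show thesis using that by auto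
qed

text \<open>The convolution collapses when a single splitting of M can contribute, as happens for
  leading monomials and for multiplication by one variable.\<close>

lemma coeff_mult_eqI:
  assumes "\<And>A B. A + B = M \<Longrightarrow> coeff f A \<noteq> 0 \<Longrightarrow> coeff g B \<noteq> 0 \<Longrightarrow> A = A0 \<and> B = B0"
    and "A0 + B0 = M"
  shows "coeff (f * g) M = coeff f A0 * coeff g B0"
proof -
  have "coeff (f * g) M = (\<Sum>(A, B)\<in>{(A0, B0)}. coeff f A * coeff g B)"
    unfolding coeff_mult
  proof (rule sum.mono_neutral_right[OF finite_mset_splits])
    show "\<forall>p\<in>{(A, B). A + B = M} - {(A0, B0)}. (case p of (A, B) \<Rightarrow> coeff f A * coeff g B) = 0"
    proof
      fix p assume "p \<in> {(A, B). A + B = M} - {(A0, B0)}"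
      then show "(case p of (A, B) \<Rightarrow> coeff f A * coeff g B) = 0"
        using assms(1)[of "fst p" "snd p"] by (cases p) fastforce
    qed
  qed (simp add: assms(2))
  then show ?thesis by simp
qed

definition homogeneous :: "nat \<Rightarrow> mseries \<Rightarrow> bool" where
  "homogeneous N f \<longleftrightarrow> (\<forall>M. coeff f M \<noteq> 0 \<longrightarrow> size M = N)"

lemma homogeneous_mult: "homogeneous a f \<Longrightarrow> homogeneous b g \<Longrightarrow> homogeneous (a + b) (f * g)"
  unfolding homogeneous_def by (auto elim!: coeff_mult_nonzeroE)

section \<open>Monomials in a family of generators\<close>

text \<open>\<open>monom b M\<close> is the product indexed by a multiset; it replaces \<^const>\<open>prod_of_parts\<close>, whose
  index lists have to be kept sorted.\<close>

definition monom :: "('i \<Rightarrow> mseries) \<Rightarrow> 'i multiset \<Rightarrow> mseries" where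
  "monom b M = (\<Prod>i\<in>#M. b i)"

lemma monom_empty [simp]: "monom b {#} = 1"
  by (simp add: monom_def)

lemma monom_add_mset [simp]: "monom b (add_mset k M) = b k * monom b M"
  by (simp add: monom_def)

lemma monom_union: "monom b (M + K) = monom b M * monom b K"
  by (simp add: monom_def)

lemma monom_cong: "(\<And>i. i \<in># M \<Longrightarrow> b i = b' i) \<Longrightarrow> monom b M = monom b' M"
  by (induction M) auto

lemma prod_of_parts_eq_monom: "prod_of_parts b \<mu> = monom b (mset \<mu>)"
  by (induction \<mu>) (auto simp: prod_of_parts_def)

definition pos_msets :: "nat multiset set" where
  "pos_msets = {M. set_mset M \<subseteq> {1..}}"

definition pos_msets_of :: "nat \<Rightarrow> nat multiset set" where
  "pos_msets_of N = {M \<in> pos_msets. sum_mset M = N}"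

lemma pos_msets_Union: "pos_msets = (\<Union>N. pos_msets_of N)"
  by (auto simp: pos_msets_of_def)

lemma pos_msets_of_add: "A \<in> pos_msets_of a \<Longrightarrow> B \<in> pos_msets_of b \<Longrightarrow> A + B \<in> pos_msets_of (a + b)"
  by (auto simp: pos_msets_of_def pos_msets_def)

lemma pos_msets_of_single: "1 \<le> i \<Longrightarrow> {#i#} \<in> pos_msets_of i"
  by (auto simp: pos_msets_of_def pos_msets_def)

lemma mem_le_sum_mset: "(i :: nat) \<in># M \<Longrightarrow> i \<le> sum_mset M"
  by (auto dest!: multi_member_split)

lemma size_le_sum_mset: "M \<in> pos_msets \<Longrightarrow> size M \<le> sum_mset M"
  by (induction M) (auto simp: pos_msets_def)

lemma finite_pos_msets_of [simp]: "finite (pos_msets_of N)"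
proof (rule finite_subset)
  show "pos_msets_of N \<subseteq> mset ` {xs. set xs \<subseteq> {..N} \<and> length xs \<le> N}"
  proof
    fix M assume M: "M \<in> pos_msets_of N"
    obtain xs where xs: "mset xs = M" using ex_mset by blast
    have "set_mset M \<subseteq> {..N}" "size M \<le> N"
      using M size_le_sum_mset[of M] by (auto simp: pos_msets_of_def dest: mem_le_sum_mset)
    then have "set xs \<subseteq> {..N}" "length xs \<le> N" by (simp_all flip: xs)
    with xs show "M \<in> mset ` {xs. set xs \<subseteq> {..N} \<and> length xs \<le> N}" by blast
  qed
  show "finite (mset ` {xs. set xs \<subseteq> {..N} \<and> length xs \<le> N})"
    by (intro finite_imageI finite_lists_length_le) auto
qed

lemma sorted_wrt_ge_mset_eq:
  assumes "sorted_wrt (\<ge>) xs" "sorted_wrt (\<ge>) ys" "mset xs = mset (ys :: nat list)"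
  shows "xs = ys"
proof -
  have "sort xs = rev xs" "sort xs = rev ys"
    by (rule properties_for_sort; use assms in \<open>simp add: sorted_wrt_rev\<close>)+
  then show ?thesis by simp
qed

lemma mset_partitions: "mset ` partitions = pos_msets"
proof
  show "mset ` partitions \<subseteq> pos_msets"
    by (auto simp: partitions_def pos_msets_def Suc_le_eq)
  show "pos_msets \<subseteq> mset ` partitions"
  proof
    fix M :: "nat multiset" assume M: "M \<in> pos_msets"
    have "sorted_wrt (\<ge>) (rev (sorted_list_of_multiset M))"
      by (simp add: sorted_wrt_rev)
    with M have "rev (sorted_list_of_multiset M) \<in> partitions"
      by (auto simp: partitions_def pos_msets_def Suc_le_eq)
    moreover have "mset (rev (sorted_list_of_multiset M)) = M" by simp
    ultimately show "M \<in> mset ` partitions" by (metis imageI)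
  qed
qed

lemma mset_partitions_of: "mset ` partitions_of N = pos_msets_of N"
proof -
  have "partitions_of N = {\<mu> \<in> partitions. sum_mset (mset \<mu>) = N}"
    by (simp add: partitions_of_def sum_mset_sum_list)
  then show ?thesis
    unfolding pos_msets_of_def mset_partitions[symmetric] by auto
qed

lemma inj_on_mset_partitions: "inj_on mset partitions"
  by (rule inj_onI) (auto simp: partitions_def intro: sorted_wrt_ge_mset_eq)

lemma prod_of_parts_image_partitions: "prod_of_parts b ` partitions = monom b ` pos_msets"
  by (simp add: mset_partitions[symmetric] image_image prod_of_parts_eq_monom)

lemma prod_of_parts_image_partitions_of: "prod_of_parts b ` partitions_of N = monom b ` pos_msets_of N"
  by (simp add: mset_partitions_of[symmetric] image_image prod_of_parts_eq_monom)

lemma Sym_degree_eq: "Sym_degree N = mseries.span (monom elementary ` pos_msets_of N)"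
  by (simp add: Sym_degree_def prod_of_parts_image_partitions_of)

lemma span_mult_induct:
  assumes f: "f \<in> mseries.span S" and g: "g \<in> mseries.span T"
    and ST: "\<And>s t. s \<in> S \<Longrightarrow> t \<in> T \<Longrightarrow> s * t \<in> mseries.span U"
  shows "f * g \<in> mseries.span U"
  using f
proof (induction rule: mseries.span_induct_alt)
  case base
  show ?case by (simp add: mseries.span_zero)
next
  case (step c s f)
  have "s * g \<in> mseries.span U"
    using g
  proof (induction rule: mseries.span_induct_alt)
    case base
    show ?case by (simp add: mseries.span_zero)
  next
    case (step c t g)
    then show ?case
      using ST[OF \<open>s \<in> S\<close> \<open>t \<in> T\<close>] by (simp add: distrib_left mseries.span_add mseries.span_scale)
  qed
  with step show ?case by (simp add: distrib_right mseries.span_add mseries.span_scale)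
qed

lemma span_monom_mult:
  assumes "f \<in> mseries.span (monom b ` pos_msets_of a)" "g \<in> mseries.span (monom b ` pos_msets_of a')"
  shows "f * g \<in> mseries.span (monom b ` pos_msets_of (a + a'))"
  using assms
proof (rule span_mult_induct)
  fix s t assume "s \<in> monom b ` pos_msets_of a" "t \<in> monom b ` pos_msets_of a'"
  then have "s * t \<in> monom b ` pos_msets_of (a + a')"
    by (auto simp: monom_union[symmetric] intro: pos_msets_of_add)
  then show "s * t \<in> mseries.span (monom b ` pos_msets_of (a + a'))" by (rule mseries.span_base)
qed

lemma monom_in_span_monom:
  assumes "\<And>i. i \<in># M \<Longrightarrow> b i \<in> mseries.span (monom b' ` pos_msets_of i)"
  shows "monom b M \<in> mseries.span (monom b' ` pos_msets_of (sum_mset M))"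
  using assms
proof (induction M)
  case empty
  have "{#} \<in> pos_msets_of 0" by (simp add: pos_msets_of_def pos_msets_def)
  then have "monom b' {#} \<in> mseries.span (monom b' ` pos_msets_of 0)"
    by (intro mseries.span_base imageI)
  then show ?case by simp
next
  case (add k M)
  then show ?case using span_monom_mult[of "b k" b' k "monom b M" "sum_mset M"] by simp
qed

text \<open>Monomials are closed under multiplication, so their linear span is already a subalgebra.
  Generation thereby becomes a question of linear algebra.\<close>

lemma Q_adjoin_eq_span: "Q_adjoin (b ` I) = mseries.span (monom b ` {M. set_mset M \<subseteq> I})"
  (is "_ = mseries.span ?B")
proof
  have 1: "monom b {#} \<in> ?B" by (intro imageI) simp
  show "Q_adjoin (b ` I) \<subseteq> mseries.span ?B"
  proof
    fix f assume "f \<in> Q_adjoin (b ` I)"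
    then show "f \<in> mseries.span ?B"
    proof induction
      case (const c)
      show ?case using mseries.span_scale[OF mseries.span_base[OF 1]] by simp
    next
      case (gen f)
      then obtain i where "i \<in> I" "f = monom b {#i#}" by auto
      then have "f \<in> ?B" by (intro image_eqI[of _ _ "{#i#}"]) auto
      then show ?case by (rule mseries.span_base)
    next
      case (add f g)
      then show ?case by (intro mseries.span_add)
    next
      case (mult f g)
      show ?case
      proof (rule span_mult_induct[OF mult.IH])
        fix s t assume "s \<in> ?B" "t \<in> ?B"
        then obtain M K where "s = monom b M" "t = monom b K" "set_mset M \<subseteq> I" "set_mset K \<subseteq> I" by auto
        then have "s * t \<in> ?B" by (intro image_eqI[of _ _ "M + K"]) (auto simp: monom_union)
        then show "s * t \<in> mseries.span ?B" by (rule mseries.span_base)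
      qed
    qed
  qed
  have scale: "c *\<^sub>Q f \<in> Q_adjoin (b ` I)" if "f \<in> Q_adjoin (b ` I)" for c f
    using Q_adjoin.mult[OF Q_adjoin.const[of c] that] by simp
  have gens: "monom b M \<in> Q_adjoin (b ` I)" if "set_mset M \<subseteq> I" for M
    using that
  proof (induction M)
    case empty
    show ?case using Q_adjoin.const[of 1] by simp
  next
    case (add i M)
    then have "b i \<in> Q_adjoin (b ` I)" "monom b M \<in> Q_adjoin (b ` I)"
      by (simp_all add: Q_adjoin.gen)
    then show ?case by (simp add: Q_adjoin.mult)
  qed
  have "0 \<in> Q_adjoin (b ` I)" using Q_adjoin.const[of 0] by simp
  then have "mseries.subspace (Q_adjoin (b ` I))"
    unfolding mseries.subspace_def by (blast intro: Q_adjoin.add scale)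
  moreover have "?B \<subseteq> Q_adjoin (b ` I)" using gens by blast
  ultimately show "mseries.span ?B \<subseteq> Q_adjoin (b ` I)" by (intro mseries.span_minimal)
qed

section \<open>Algebraic independence\<close>

lemma alg_independentD:
  assumes "alg_independent I X" "finite A" "A \<subseteq> {M. set_mset M \<subseteq> I}" "(\<Sum>M\<in>A. c M *\<^sub>Q monom X M) = 0" "M \<in> A"
  shows "c M = 0"
  using assms unfolding alg_independent_def monom_def by blast

text \<open>The difference of two equal monomials would be a nontrivial relation. This is what makes
  the set of products a faithful copy of its index set.\<close>

lemma alg_independent_inj_on:
  assumes "alg_independent I X"
  shows "inj_on (monom X) {M. set_mset M \<subseteq> I}"
proof (rule inj_onI, rule ccontr)
  fix M K assume MK: "M \<in> {M. set_mset M \<subseteq> I}" "K \<in> {M. set_mset M \<subseteq> I}" "monom X M = monom X K" "M \<noteq> K"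
  let ?c = "\<lambda>L. if L = M then 1 else - 1 :: rat"
  have "(\<Sum>L\<in>{M, K}. ?c L *\<^sub>Q monom X L) = 0" using MK by (simp add: mseries.scale_minus_left)
  from alg_independentD[OF assms _ _ this, of M] MK show False by simp
qed

lemma alg_independent_independent:
  assumes "alg_independent I X"
  shows "\<not> mseries.dependent (monom X ` {M. set_mset M \<subseteq> I})"
  unfolding mseries.independent_explicit_finite_subsets
proof clarify
  fix S u f
  assume S: "S \<subseteq> monom X ` {M. set_mset M \<subseteq> I}" "finite S" "(\<Sum>v\<in>S. u v *\<^sub>Q v) = 0" "f \<in> S"
  from S(1,2) obtain A where A: "A \<subseteq> {M. set_mset M \<subseteq> I}" "finite A" "S = monom X ` A"
    by (meson finite_subset_image)
  have "inj_on (monom X) A" using A(1) alg_independent_inj_on[OF assms] by (rule inj_on_subset[rotated])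
  then have "(\<Sum>M\<in>A. u (monom X M) *\<^sub>Q monom X M) = 0"
    using S(3) by (simp add: A(3) sum.reindex)
  from alg_independentD[OF assms A(2,1) this] S(4) show "u f = 0" by (auto simp: A(3))
qed

text \<open>If a spanning family of the same size as a basis had repetitions or were dependent, a proper
  subset of it would still span, against the exchange lemma.\<close>

lemma spanning_family_independent:
  assumes S: "finite S" and v: "inj_on v S" "\<not> mseries.dependent (v ` S)"
    and span: "mseries.span (v ` S) \<subseteq> mseries.span (w ` S)"
  shows "inj_on w S \<and> \<not> mseries.dependent (w ` S)"
proof -
  have *: "card S \<le> card T" if "finite T" "mseries.span (w ` S) \<subseteq> mseries.span T" for T
  proof -
    have "v ` S \<subseteq> mseries.span T" using that(2) span mseries.span_superset by blast
    from mseries.independent_span_bound[OF that(1) v(2) this] show ?thesis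
      using card_image[OF v(1)] by simp
  qed
  have "card (w ` S) = card S"
    using *[of "w ` S"] card_image_le[OF S, of w] S by simp
  then have inj: "inj_on w S" using S by (simp add: eq_card_imp_inj_on)
  have "\<not> mseries.dependent (w ` S)"
  proof
    assume "mseries.dependent (w ` S)"
    then obtain a where a: "a \<in> w ` S" "a \<in> mseries.span (w ` S - {a})"
      unfolding mseries.dependent_def by blast
    have "mseries.span (w ` S) \<subseteq> mseries.span (w ` S - {a})"
      using a mseries.span_redundant[of a "w ` S - {a}"] by (simp add: insert_absorb)
    from *[OF _ this] have "card S \<le> card (w ` S - {a})" using S by simp
    also have "\<dots> < card (w ` S)" using a S by (intro psubset_card_mono) auto
    finally show False using card_image_le[OF S, of w] by simp
  qed
  with inj show ?thesis by blast
qed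

lemma mset_eqI_prefix_count:
  assumes "\<And>j :: nat. size {#i \<in># A. i < j#} = size {#i \<in># B. i < j#}"
  shows "A = B"
proof (rule multiset_eqI)
  fix j
  have "size {#i \<in># C. i < Suc j#} = count C j + size {#i \<in># C. i < j#}" for C :: "nat multiset"
    by (induction C) (auto simp: less_Suc_eq)
  then show "count A j = count B j" using assms[of j] assms[of "Suc j"] by simp
qed

definition prefix_count :: "nat multiset \<Rightarrow> nat \<Rightarrow> nat" where
  "prefix_count M j = size {#i \<in># M. i < j#}"

lemma prefix_count_union [simp]: "prefix_count (A + B) j = prefix_count A j + prefix_count B j"
  by (simp add: prefix_count_def)

lemma prefix_count_inject: "prefix_count A = prefix_count B \<longleftrightarrow> A = B"
  by (metis mset_eqI_prefix_count prefix_count_def)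

text \<open>\<open>lead_mset M\<close> is the leading monomial of \<open>\<Prod>k\<in>#M. e\<^sub>k\<close> for the dominance order, i.e. for the
  pointwise order of \<^const>\<open>prefix_count\<close>; as a partition it is the conjugate of \<open>M\<close>.\<close>

definition lead_mset :: "nat multiset \<Rightarrow> nat multiset" where
  "lead_mset M = (\<Sum>k\<in>#M. mset_set {..<k})"

lemma lead_mset_simps [simp]:
  "lead_mset {#} = {#}" "lead_mset (add_mset k M) = mset_set {..<k} + lead_mset M"
  by (simp_all add: lead_mset_def)

lemma coeff_elementary: "coeff (elementary k) M = (if size M = k \<and> (\<forall>i. count M i \<le> 1) then 1 else 0)"
  by (simp add: elementary_def)

lemma prefix_count_mset_set: "prefix_count (mset_set {..<k}) j = min j k"
proof -
  have "{#i \<in># mset_set {..<k}. i < j#} = mset_set {i \<in> {..<k}. i < j}"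
    by (rule filter_mset_mset_set) auto
  also have "{i \<in> {..<k}. i < j} = {..<min j k}" by auto
  finally show ?thesis by (simp add: prefix_count_def)
qed

text \<open>A monomial of e_k is squarefree of degree k, so at most min j k of its variables have
  index below j. The product of the first k variables attains this bound for all j at once.\<close>

lemma prefix_count_elementary:
  assumes "coeff (elementary k) A \<noteq> 0"
  shows "prefix_count A j \<le> prefix_count (mset_set {..<k}) j"
proof -
  from assms have A: "size A = k" "\<And>i. count A i \<le> 1" by (auto simp: coeff_elementary split: if_splits)
  let ?F = "{#i \<in># A. i < j#}"
  have "size ?F \<le> k" using A(1) size_filter_mset_lesseq by metis
  moreover have "(\<Sum>i\<in>set_mset ?F. count ?F i) \<le> (\<Sum>i\<in>set_mset ?F. 1)"
    using A(2) by (intro sum_mono) simp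
  then have "size ?F \<le> card (set_mset ?F)" by (simp add: size_multiset_overloaded_eq)
  moreover have "card (set_mset ?F) \<le> card {..<j}" by (intro card_mono) auto
  ultimately show ?thesis by (simp add: prefix_count_mset_set) (simp add: prefix_count_def)
qed

text \<open>Prefix counts are additive, so the bounds for the single factors add up.\<close>

lemma prefix_count_monom_elementary:
  "coeff (monom elementary M) B \<noteq> 0 \<Longrightarrow> prefix_count B j \<le> prefix_count (lead_mset M) j"
proof (induction M arbitrary: B)
  case empty
  then show ?case by (simp add: coeff_1 split: if_splits)
next
  case (add k M)
  from add.prems obtain A C where AC: "A + C = B" "coeff (elementary k) A \<noteq> 0" "coeff (monom elementary M) C \<noteq> 0"
    by (auto elim: coeff_mult_nonzeroE)
  from prefix_count_elementary[OF AC(2), of j] add.IH[OF AC(3)] show ?case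
    by (simp add: AC(1)[symmetric])
qed

text \<open>If a sum of two quantities reaches the sum of their upper bounds, each reaches its own
  bound. So the leading monomial of a product arises only from the leading monomials of the
  factors.\<close>

lemma coeff_monom_elementary_lead: "coeff (monom elementary M) (lead_mset M) = 1"
proof (induction M)
  case empty
  then show ?case by (simp add: coeff_1)
next
  case (add k M)
  have "coeff (elementary k * monom elementary M) (mset_set {..<k} + lead_mset M)
      = coeff (elementary k) (mset_set {..<k}) * coeff (monom elementary M) (lead_mset M)"
  proof (rule coeff_mult_eqI)
    fix A B assume AB: "A + B = mset_set {..<k} + lead_mset M" "coeff (elementary k) A \<noteq> 0" "coeff (monom elementary M) B \<noteq> 0"
    have "prefix_count A j = prefix_count (mset_set {..<k}) j \<and> prefix_count B j = prefix_count (lead_mset M) j" for j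
      using prefix_count_elementary[OF AB(2), of j] prefix_count_monom_elementary[OF AB(3), of j]
        arg_cong[OF AB(1), of "\<lambda>M. prefix_count M j"] by simp
    then show "A = mset_set {..<k} \<and> B = lead_mset M" by (simp add: prefix_count_inject[symmetric] fun_eq_iff)
  qed simp
  also have "coeff (elementary k) (mset_set {..<k}) = 1"
    by (auto simp: coeff_elementary count_mset_set')
  finally show ?case using add.IH by simp
qed

text \<open>Variable i has as exponent the number of parts exceeding i, so consecutive exponents
  differ by the multiplicity of the part i + 1. A part 0 leaves no trace, hence the restriction to
  positive parts.\<close>

lemma inj_on_lead_mset: "inj_on lead_mset pos_msets"
proof (rule inj_onI)
  fix M K assume MK: "M \<in> pos_msets" "K \<in> pos_msets" "lead_mset M = lead_mset K"
  have count_lead: "count (lead_mset L) i = size {#k \<in># L. i < k#}" for L i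
    by (induction L) (auto simp: count_mset_set')
  have step: "size {#k \<in># L. i < k#} = count L (Suc i) + size {#k \<in># L. Suc i < k#}" for L i
    by (induction L) auto
  show "M = K"
  proof (rule multiset_eqI)
    fix i
    show "count M i = count K i"
    proof (cases i)
      case 0
      have "0 \<notin># M" "0 \<notin># K" using MK by (auto simp: pos_msets_def)
      then show ?thesis by (simp add: 0 not_in_iff)
    next
      case (Suc j)
      show ?thesis
        using step[of j M] step[of j K] arg_cong[OF MK(3), of "\<lambda>L. count L j"]
          arg_cong[OF MK(3), of "\<lambda>L. count L (Suc j)"]
        by (simp add: count_lead Suc)
    qed
  qed
qed

lemma alg_independent_elementary: "alg_independent {1..} elementary"
  unfolding alg_independent_def
proof (intro allI impI ballI, rule ccontr)
  fix A c M
  assume A: "finite A \<and> A \<subseteq> {M. set_mset M \<subseteq> {1..}} \<and> (\<Sum>M\<in>A. c M *\<^sub>Q (\<Prod>i\<in>#M. elementary i)) = 0"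
    and M: "M \<in> A" "c M \<noteq> 0"
  \<comment> \<open>Dominance is only a partial order, so a maximal leading monomial is taken. Any
    other term containing that monomial would have a larger or equal leading monomial, so nothing
    can cancel it.\<close>
  let ?P = "(\<lambda>M. prefix_count (lead_mset M)) ` {M \<in> A. c M \<noteq> 0}"
  have "finite ?P" "?P \<noteq> {}" using A M by auto
  from finite_has_maximal[OF this] obtain K where
    K: "K \<in> A" "c K \<noteq> 0" "\<forall>p\<in>?P. prefix_count (lead_mset K) \<le> p \<longrightarrow> prefix_count (lead_mset K) = p"
    by auto
  have zero: "c L * coeff (monom elementary L) (lead_mset K) = 0" if L: "L \<in> A" "L \<noteq> K" for L
  proof (rule ccontr)
    assume "\<not> ?thesis"
    then have cL: "c L \<noteq> 0" and co: "coeff (monom elementary L) (lead_mset K) \<noteq> 0" by auto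
    have "prefix_count (lead_mset K) \<le> prefix_count (lead_mset L)"
      using prefix_count_monom_elementary[OF co] by (simp add: le_fun_def)
    then have "lead_mset K = lead_mset L" using K(3) L cL by (auto simp: prefix_count_inject)
    then show False using inj_on_lead_mset L K(1) A by (auto simp: inj_on_def pos_msets_def)
  qed
  have "0 = coeff (\<Sum>M\<in>A. c M *\<^sub>Q monom elementary M) (lead_mset K)" using A by (simp add: monom_def)
  also have "\<dots> = (\<Sum>L\<in>A. c L * coeff (monom elementary L) (lead_mset K))" by simp
  also have "\<dots> = (\<Sum>L\<in>{K}. c L * coeff (monom elementary L) (lead_mset K))"
    by (rule sum.mono_neutral_right) (use A K zero in auto)
  also have "\<dots> = c K" by (simp add: coeff_monom_elementary_lead)
  finally show False using K by simp
qed

section \<open>Triangular changes of generators\<close>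

text \<open>In degree i the condition on \<open>g\<close> excludes just one product, namely e_i
  itself; \<open>c\<close> is thus the coefficient of the only indecomposable term.\<close>

locale triangular_generators =
  fixes X :: "nat \<Rightarrow> mseries"
  assumes triangular: "\<And>i. 1 \<le> i \<Longrightarrow> \<exists>c g. c \<noteq> 0 \<and>
    g \<in> mseries.span (monom elementary ` {M \<in> pos_msets_of i. \<forall>k\<in>#M. k < i}) \<and>
    X i = c *\<^sub>Q elementary i + g"
begin

lemma X_in_span_elementary:
  assumes "1 \<le> i"
  shows "X i \<in> mseries.span (monom elementary ` pos_msets_of i)"
proof -
  from triangular[OF assms] obtain c g where
    g: "g \<in> mseries.span (monom elementary ` {M \<in> pos_msets_of i. \<forall>k\<in>#M. k < i})"
    and X: "X i = c *\<^sub>Q elementary i + g" by blast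
  have "g \<in> mseries.span (monom elementary ` pos_msets_of i)"
    using g mseries.span_mono[of "monom elementary ` {M \<in> pos_msets_of i. \<forall>k\<in>#M. k < i}"] by blast
  moreover have "monom elementary {#i#} \<in> mseries.span (monom elementary ` pos_msets_of i)"
    by (intro mseries.span_base imageI pos_msets_of_single assms)
  ultimately show ?thesis by (simp add: X mseries.span_add mseries.span_scale)
qed

text \<open>Division by \<open>c\<close> solves the triangular system for e_i: the products in
  \<open>g\<close> have parts below i only, and these are covered by the induction
  hypothesis.\<close>

lemma elementary_in_span_X:
  "1 \<le> i \<Longrightarrow> elementary i \<in> mseries.span (monom X ` pos_msets_of i)"
proof (induction i rule: less_induct)
  case (less i)
  from triangular[OF less.prems] obtain c g where c: "c \<noteq> 0"
    and g: "g \<in> mseries.span (monom elementary ` {M \<in> pos_msets_of i. \<forall>k\<in>#M. k < i})"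
    and X: "X i = c *\<^sub>Q elementary i + g" by blast
  have "monom elementary ` {M \<in> pos_msets_of i. \<forall>k\<in>#M. k < i} \<subseteq> mseries.span (monom X ` pos_msets_of i)"
  proof clarify
    fix M assume M: "M \<in> pos_msets_of i" "\<forall>k\<in>#M. k < i"
    have "elementary k \<in> mseries.span (monom X ` pos_msets_of k)" if "k \<in># M" for k
      using M that by (intro less.IH) (auto simp: pos_msets_of_def pos_msets_def)
    then have "monom elementary M \<in> mseries.span (monom X ` pos_msets_of (sum_mset M))"
      by (rule monom_in_span_monom)
    with M show "monom elementary M \<in> mseries.span (monom X ` pos_msets_of i)"
      by (simp add: pos_msets_of_def)
  qed
  then have g': "g \<in> mseries.span (monom X ` pos_msets_of i)"
    using g mseries.span_minimal[OF _ mseries.subspace_span] by blast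
  have "monom X {#i#} \<in> mseries.span (monom X ` pos_msets_of i)"
    by (intro mseries.span_base imageI pos_msets_of_single less.prems)
  then have "(1 / c) *\<^sub>Q (X i - g) \<in> mseries.span (monom X ` pos_msets_of i)"
    using g' by (simp add: mseries.span_diff mseries.span_scale)
  then show ?case using c by (simp add: X)
qed

lemma span_monom_X: "mseries.span (monom X ` pos_msets_of N) = Sym_degree N"
proof -
  have "monom X ` pos_msets_of N \<subseteq> mseries.span (monom elementary ` pos_msets_of N)"
  proof clarify
    fix M assume M: "M \<in> pos_msets_of N"
    then have "X i \<in> mseries.span (monom elementary ` pos_msets_of i)" if "i \<in># M" for i
      using that by (intro X_in_span_elementary) (auto simp: pos_msets_of_def pos_msets_def)
    then have "monom X M \<in> mseries.span (monom elementary ` pos_msets_of (sum_mset M))"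
      by (rule monom_in_span_monom)
    with M show "monom X M \<in> mseries.span (monom elementary ` pos_msets_of N)"
      by (simp add: pos_msets_of_def)
  qed
  moreover have "monom elementary ` pos_msets_of N \<subseteq> mseries.span (monom X ` pos_msets_of N)"
  proof clarify
    fix M assume M: "M \<in> pos_msets_of N"
    then have "elementary i \<in> mseries.span (monom X ` pos_msets_of i)" if "i \<in># M" for i
      using that by (intro elementary_in_span_X) (auto simp: pos_msets_of_def pos_msets_def)
    then have "monom elementary M \<in> mseries.span (monom X ` pos_msets_of (sum_mset M))"
      by (rule monom_in_span_monom)
    with M show "monom elementary M \<in> mseries.span (monom X ` pos_msets_of N)"
      by (simp add: pos_msets_of_def)
  qed
  ultimately show ?thesis
    unfolding Sym_degree_eq by (simp add: mseries.span_eq)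
qed

text \<open>The set J of degrees is left open for two uses: \<open>{..n}\<close> gives the finite
  families of the counting argument, \<open>UNIV\<close> gives all of \<open>Sym\<close>.\<close>

lemma span_monom_X_Union:
  "mseries.span (monom X ` (\<Union>N\<in>J. pos_msets_of N)) = mseries.span (\<Union>N\<in>J. Sym_degree N)"
proof -
  have "Sym_degree N \<subseteq> mseries.span (monom X ` (\<Union>N\<in>J. pos_msets_of N))" if "N \<in> J" for N
    unfolding span_monom_X[symmetric] using that by (intro mseries.span_mono) auto
  moreover have "monom X ` pos_msets_of N \<subseteq> mseries.span (\<Union>N\<in>J. Sym_degree N)" if "N \<in> J" for N
  proof -
    have "monom X ` pos_msets_of N \<subseteq> Sym_degree N"
      unfolding span_monom_X[symmetric] by (rule mseries.span_superset)
    also have "\<dots> \<subseteq> (\<Union>N\<in>J. Sym_degree N)" using that by blast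
    also have "\<dots> \<subseteq> mseries.span \<dots>" by (rule mseries.span_superset)
    finally show ?thesis .
  qed
  ultimately show ?thesis
    unfolding mseries.span_eq by (simp add: image_UN UN_subset_iff)
qed

lemma span_monom_X_all: "mseries.span (monom X ` pos_msets) = Sym"
  using span_monom_X_Union[of UNIV] by (simp add: pos_msets_Union Sym_def)

end

lemma triangular_generators_elementary: "triangular_generators elementary"
proof
  fix i :: nat
  show "\<exists>c g. c \<noteq> 0 \<and> g \<in> mseries.span (monom elementary ` {M \<in> pos_msets_of i. \<forall>k\<in>#M. k < i}) \<and>
      elementary i = c *\<^sub>Q elementary i + g"
    by (rule exI[of _ 1], rule exI[of _ 0]) (simp add: mseries.span_zero)
qed

context triangular_generators
begin

text \<open>A relation involves finitely many products, hence bounded degrees. There the products of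
  the X_i and of the e_i have the same finite index set and the same span, so independence passes
  from one family to the other by counting.\<close>

lemma alg_independent_X: "alg_independent {1..} X"
  unfolding alg_independent_def
proof (intro allI impI ballI)
  fix A c M
  assume A: "finite A \<and> A \<subseteq> {M. set_mset M \<subseteq> {1..}} \<and> (\<Sum>M\<in>A. c M *\<^sub>Q (\<Prod>i\<in>#M. X i)) = 0"
    and M: "M \<in> A"
  interpret E: triangular_generators elementary by (rule triangular_generators_elementary)
  define n where "n = Max (sum_mset ` A)"
  let ?S = "\<Union>N\<in>{..n}. pos_msets_of N"
  have AS: "A \<subseteq> ?S" using A by (auto simp: n_def pos_msets_of_def pos_msets_def)
  have fin: "finite ?S" by simp
  have S: "?S \<subseteq> {M. set_mset M \<subseteq> {1..}}" by (auto simp: pos_msets_of_def pos_msets_def)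
  have "inj_on (monom X) ?S \<and> \<not> mseries.dependent (monom X ` ?S)"
  proof (rule spanning_family_independent[OF fin])
    show "inj_on (monom elementary) ?S"
      using alg_independent_inj_on[OF alg_independent_elementary] S by (rule inj_on_subset)
    show "\<not> mseries.dependent (monom elementary ` ?S)"
      using alg_independent_independent[OF alg_independent_elementary] image_mono[OF S]
      by (rule mseries.independent_mono)
    show "mseries.span (monom elementary ` ?S) \<subseteq> mseries.span (monom X ` ?S)"
      by (simp only: span_monom_X_Union E.span_monom_X_Union order.refl)
  qed
  then have inj: "inj_on (monom X) A" and ind: "\<not> mseries.dependent (monom X ` A)"
    using inj_on_subset[OF _ AS] mseries.independent_mono[OF _ image_mono[OF AS]] by blast+
  have "(\<Sum>v\<in>monom X ` A. c (the_inv_into A (monom X) v) *\<^sub>Q v)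
      = (\<Sum>M\<in>A. c (the_inv_into A (monom X) (monom X M)) *\<^sub>Q monom X M)"
    by (simp add: sum.reindex[OF inj])
  also have "\<dots> = (\<Sum>M\<in>A. c M *\<^sub>Q monom X M)"
    by (intro sum.cong refl) (simp add: the_inv_into_f_f[OF inj])
  also have "\<dots> = 0" using A by (simp add: monom_def)
  finally have "c (the_inv_into A (monom X) (monom X M)) = 0"
    using mseries.independentD[OF ind, of "monom X ` A"
        "\<lambda>v. c (the_inv_into A (monom X) v)" "monom X M"] A M by simp
  then show "c M = 0" using inj M by (simp add: the_inv_into_f_f)
qed

lemma inj_on_monom_X: "inj_on (monom X) pos_msets"
  using alg_independent_inj_on[OF alg_independent_X] unfolding pos_msets_def .

lemma independent_monom_X: "\<not> mseries.dependent (monom X ` pos_msets)"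
  using alg_independent_independent[OF alg_independent_X] unfolding pos_msets_def .

lemma is_polynomial_ring_X: "is_polynomial_ring Sym {1..} X"
  unfolding is_polynomial_ring_def Q_adjoin_eq_span pos_msets_def[symmetric]
  by (rule conjI[OF span_monom_X_all[symmetric] alg_independent_X])

lemma is_basis_Sym: "is_basis Sym (prod_of_parts X ` partitions)"
  unfolding is_basis_def prod_of_parts_image_partitions
  by (rule conjI[OF independent_monom_X span_monom_X_all])

lemma is_basis_Sym_degree: "is_basis (Sym_degree N) (prod_of_parts X ` partitions_of N)"
proof -
  have "monom X ` pos_msets_of N \<subseteq> monom X ` pos_msets"
    by (auto simp: pos_msets_of_def)
  then show ?thesis
    unfolding is_basis_def prod_of_parts_image_partitions_of
    using mseries.independent_mono[OF independent_monom_X] span_monom_X by blast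
qed

end

section \<open>Convex cones\<close>

text \<open>Nonnegative combinations are built one term at a time, so that closure properties follow
  by induction instead of by merging finite index sets.\<close>

inductive_set cone :: "mseries set \<Rightarrow> mseries set" for S where
  zero: "0 \<in> cone S"
| step: "f \<in> cone S \<Longrightarrow> s \<in> S \<Longrightarrow> 0 \<le> c \<Longrightarrow> f + c *\<^sub>Q s \<in> cone S"

lemma cone_base: "s \<in> S \<Longrightarrow> s \<in> cone S"
  using cone.step[OF cone.zero, of s S 1] by simp

lemma cone_add: "g \<in> cone S \<Longrightarrow> f \<in> cone S \<Longrightarrow> f + g \<in> cone S"
proof (induction rule: cone.induct)
  case zero
  then show ?case by simp
next
  case (step g s c)
  then show ?case using cone.step[of "f + g" S s c] by (simp add: add.assoc)
qed

lemma cone_scale: "f \<in> cone S \<Longrightarrow> 0 \<le> c \<Longrightarrow> c *\<^sub>Q f \<in> cone S"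
proof (induction rule: cone.induct)
  case zero
  then show ?case by (simp add: cone.zero)
next
  case (step f s d)
  then show ?case using cone.step[of "c *\<^sub>Q f" S s "c * d"]
    by (simp add: mseries.scale_right_distrib)
qed

lemma cone_sum: "(\<And>a. a \<in> A \<Longrightarrow> f a \<in> cone S) \<Longrightarrow> sum f A \<in> cone S"
  by (induction A rule: infinite_finite_induct) (auto intro: cone.zero cone_add)

lemma cone_minimal:
  assumes "S \<subseteq> cone T"
  shows "cone S \<subseteq> cone T"
proof
  fix f assume "f \<in> cone S"
  then show "f \<in> cone T"
    by induction (use assms in \<open>auto intro!: cone.zero cone_add cone_scale\<close>)
qed

lemma cone_mono: "S \<subseteq> T \<Longrightarrow> cone S \<subseteq> cone T"
  using cone_minimal[of S T] cone_base by blast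

lemma cone_mult:
  assumes f: "f \<in> cone S" and g: "g \<in> cone T"
    and ST: "\<And>s t. s \<in> S \<Longrightarrow> t \<in> T \<Longrightarrow> s * t \<in> cone U"
  shows "f * g \<in> cone U"
  using f
proof (induction rule: cone.induct)
  case zero
  then show ?case by (simp add: cone.zero)
next
  case (step f s c)
  have "s * g \<in> cone U"
    using g
  proof (induction rule: cone.induct)
    case zero
    then show ?case by (simp add: cone.zero)
  next
    case (step g t d)
    then show ?case
      using ST[OF \<open>s \<in> S\<close> \<open>t \<in> T\<close>] by (simp add: distrib_left cone_add cone_scale)
  qed
  with step show ?case by (simp add: distrib_right cone_add cone_scale)
qed

lemma cone_subset_span: "cone S \<subseteq> mseries.span S"
proof
  fix f assume "f \<in> cone S"
  then show "f \<in> mseries.span S"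
    by induction (auto intro: mseries.span_zero mseries.span_add mseries.span_scale mseries.span_base)
qed

lemma positive_wrt_iff_cone: "positive_wrt b f \<longleftrightarrow> f \<in> cone (b ` partitions)"
proof
  assume "positive_wrt b f"
  then show "f \<in> cone (b ` partitions)"
    unfolding positive_wrt_def by (elim exE conjE, simp only:, intro cone_sum cone_scale cone_base) auto
next
  assume "f \<in> cone (b ` partitions)"
  then show "positive_wrt b f"
  proof induction
    case zero
    show ?case unfolding positive_wrt_def
      by (rule exI[of _ "{}"], rule exI[of _ "\<lambda>_. 0"]) simp
  next
    case (step f s c)
    from step obtain A d where A: "finite A" "A \<subseteq> partitions" "\<forall>\<mu>\<in>A. 0 \<le> d \<mu>" "f = (\<Sum>\<mu>\<in>A. d \<mu> *\<^sub>Q b \<mu>)"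
      unfolding positive_wrt_def by blast
    from step obtain \<nu> where \<nu>: "\<nu> \<in> partitions" "s = b \<nu>" by blast
    \<comment> \<open>The new partition \<nu> may already occur in A, so coefficients are added;
      outside A nothing is known about the sign of \<open>d\<close>, so it is replaced by 0
      there.\<close>
    define d' where "d' \<mu> = (if \<mu> \<in> A then d \<mu> else 0) + (if \<mu> = \<nu> then c else 0)" for \<mu>
    have "f = (\<Sum>\<mu>\<in>insert \<nu> A. (if \<mu> \<in> A then d \<mu> else 0) *\<^sub>Q b \<mu>)"
      unfolding A(4) using A(1) by (intro sum.mono_neutral_cong_left) auto
    moreover have "c *\<^sub>Q s = (\<Sum>\<mu>\<in>{\<nu>}. (if \<mu> = \<nu> then c else 0) *\<^sub>Q b \<mu>)"
      by (simp add: \<nu>)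
    then have "c *\<^sub>Q s = (\<Sum>\<mu>\<in>insert \<nu> A. (if \<mu> = \<nu> then c else 0) *\<^sub>Q b \<mu>)"
      using A(1) by (subst (asm) sum.mono_neutral_left[of "insert \<nu> A"]) auto
    ultimately have "f + c *\<^sub>Q s = (\<Sum>\<mu>\<in>insert \<nu> A. d' \<mu> *\<^sub>Q b \<mu>)"
      by (simp add: d'_def mseries.scale_left_distrib sum.distrib)
    moreover have "\<forall>\<mu>\<in>insert \<nu> A. 0 \<le> d' \<mu>" using A(3) step.hyps by (simp add: d'_def)
    ultimately show ?case
      unfolding positive_wrt_def using A \<nu>
      by (intro exI[of _ "insert \<nu> A"] exI[of _ d']) simp
  qed
qed

lemma e_positive_iff: "e_positive f \<longleftrightarrow> f \<in> cone (monom elementary ` pos_msets)"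
  by (simp add: e_positive_def positive_wrt_iff_cone prod_of_parts_image_partitions)

section \<open>The Pieri rule\<close>

text \<open>Partitions with at most L rows, padded with zeros so that comparisons of adjacent rows
  need no conditions on lengths.\<close>

definition shapes :: "nat \<Rightarrow> (nat \<Rightarrow> nat) set" where
  "shapes L = {f. (\<forall>i. f (Suc i) \<le> f i) \<and> (\<forall>i\<ge>L. f i = 0)}"

text \<open>Interlacing of rows: no two cells of \<mu>/\<nu> share a column. Both strip predicates
  take the smaller shape first.\<close>

definition hstrip :: "(nat \<Rightarrow> nat) \<Rightarrow> (nat \<Rightarrow> nat) \<Rightarrow> bool" where
  "hstrip \<nu> \<mu> \<longleftrightarrow> (\<forall>i. \<nu> i \<le> \<mu> i \<and> \<mu> (Suc i) \<le> \<nu> i)"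

definition vstrip :: "(nat \<Rightarrow> nat) \<Rightarrow> (nat \<Rightarrow> nat) \<Rightarrow> bool" where
  "vstrip \<mu> \<kappa> \<longleftrightarrow> (\<forall>i. \<mu> i \<le> \<kappa> i \<and> \<kappa> i \<le> Suc (\<mu> i))"

lemma shapes_antimono:
  assumes "f \<in> shapes L" "i \<le> j"
  shows "f j \<le> f i"
  using assms(2) by (induction rule: dec_induct) (use assms(1) in \<open>auto simp: shapes_def intro: le_trans\<close>)

lemma finite_zero_beyond:
  assumes "\<And>i. i < L \<Longrightarrow> finite (C i)"
  shows "finite {f :: nat \<Rightarrow> nat. (\<forall>i\<ge>L. f i = 0) \<and> (\<forall>i<L. f i \<in> C i)}" (is "finite ?F")
proof (rule finite_imageD)
  have "(\<lambda>f. restrict f {..<L}) ` ?F \<subseteq> PiE {..<L} C" by (auto split: if_splits)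
  then show "finite ((\<lambda>f. restrict f {..<L}) ` ?F)"
    using finite_PiE[of "{..<L}" C] assms finite_subset by auto
  show "inj_on (\<lambda>f. restrict f {..<L}) ?F"
  proof (rule inj_onI, rule ext)
    fix f g i assume fg: "f \<in> ?F" "g \<in> ?F" "restrict f {..<L} = restrict g {..<L}"
    show "f i = g i"
      using fun_cong[OF fg(3), of i] fg(1,2) by (cases "i < L") auto
  qed
qed

lemma finite_shapes_bounded: "finite {f \<in> shapes L. \<forall>i. f i \<le> m}"
  by (rule finite_subset[OF _ finite_zero_beyond[of L "\<lambda>_. {..m}"]]) (auto simp: shapes_def)

text \<open>When rows range independently over sets C i, a sum of products over shapes factors into
  one sum per row.\<close>

lemma sum_prod_zero_beyond:
  fixes h :: "nat \<Rightarrow> nat \<Rightarrow> 'a :: comm_ring_1"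
  assumes "\<And>i. i < L \<Longrightarrow> finite (C i)"
  shows "(\<Sum>f | (\<forall>i\<ge>L. f i = 0) \<and> (\<forall>i<L. f i \<in> C i). \<Prod>i<L. h i (f i)) = (\<Prod>i<L. \<Sum>c\<in>C i. h i c)"
proof -
  have "(\<Prod>i<L. \<Sum>c\<in>C i. h i c) = (\<Sum>f\<in>PiE {..<L} C. \<Prod>i<L. h i (f i))"
    using assms by (intro prod_sum_PiE) auto
  also have "\<dots> = (\<Sum>f | (\<forall>i\<ge>L. f i = 0) \<and> (\<forall>i<L. f i \<in> C i). \<Prod>i<L. h i (f i))"
    by (rule sum.reindex_bij_witness[where j = "\<lambda>f i. if i < L then f i else 0"
          and i = "\<lambda>f. restrict f {..<L}"])
      (auto simp: fun_eq_iff PiE_def extensional_def)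
  finally show ?thesis ..
qed

text \<open>The one-variable commutation relation between adding a vertical strip and removing a
  horizontal strip. Both sides are products over rows, and the row factors \<open>a i\<close>, \<open>b i\<close> satisfy
  \<open>a i * Q (i + 1) = Q i * b i\<close> for factors \<open>Q i \<in> {1, 1 + x y}\<close>, so that the products telescope.\<close>

lemma strips_commute:
  fixes x y :: "'a :: comm_ring_1"
  assumes \<mu>: "\<mu> \<in> shapes L" and \<rho>: "\<rho> \<in> shapes L" and L: "0 < L" "\<rho> (L - 1) = 0"
  shows "(\<Sum>\<kappa> | \<kappa> \<in> shapes L \<and> vstrip \<mu> \<kappa> \<and> hstrip \<rho> \<kappa>. \<Prod>i<L. y ^ (\<kappa> i - \<mu> i) * x ^ (\<kappa> i - \<rho> i))
    = (1 + x * y) * (\<Sum>\<nu> | \<nu> \<in> shapes L \<and> hstrip \<nu> \<mu> \<and> vstrip \<nu> \<rho>. \<Prod>i<L. x ^ (\<mu> i - \<nu> i) * y ^ (\<rho> i - \<nu> i))"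
proof -
  \<comment> \<open>With \<mu> and \<rho> fixed, all conditions on \<kappa> or \<nu> decouple into a
    range for each row. Only row 0 of \<kappa> lacks the bound by the row of \<rho> above
    it.\<close>
  define C where "C i = {c. \<mu> i \<le> c \<and> c \<le> Suc (\<mu> i) \<and> \<rho> i \<le> c \<and> (0 < i \<longrightarrow> c \<le> \<rho> (i - 1))}" for i
  define D where "D i = {c. c \<le> \<mu> i \<and> \<mu> (Suc i) \<le> c \<and> c \<le> \<rho> i \<and> \<rho> i \<le> Suc c}" for i
  define a where "a i = (\<Sum>c\<in>C i. y ^ (c - \<mu> i) * x ^ (c - \<rho> i))" for i
  define b where "b i = (\<Sum>c\<in>D i. x ^ (\<mu> i - c) * y ^ (\<rho> i - c))" for i
  have finC: "finite (C i)" for i by (rule finite_subset[of _ "{..Suc (\<mu> i)}"]) (auto simp: C_def)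
  have finD: "finite (D i)" for i by (rule finite_subset[of _ "{..\<mu> i}"]) (auto simp: D_def)
  have \<mu>0: "\<mu> i = 0" and \<rho>0: "\<rho> i = 0" if "L \<le> i" for i
    using \<mu> \<rho> that by (auto simp: shapes_def)
  have \<mu>S: "\<mu> (Suc i) \<le> \<mu> i" and \<rho>S: "\<rho> (Suc i) \<le> \<rho> i" for i
    using \<mu> \<rho> by (auto simp: shapes_def)
  have "{\<kappa>. \<kappa> \<in> shapes L \<and> vstrip \<mu> \<kappa> \<and> hstrip \<rho> \<kappa>} = {f. (\<forall>i\<ge>L. f i = 0) \<and> (\<forall>i<L. f i \<in> C i)}"
  proof (intro set_eqI iffI)
    fix f assume "f \<in> {\<kappa>. \<kappa> \<in> shapes L \<and> vstrip \<mu> \<kappa> \<and> hstrip \<rho> \<kappa>}"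
    then have f: "\<forall>i\<ge>L. f i = 0" "\<And>i. \<mu> i \<le> f i" "\<And>i. f i \<le> Suc (\<mu> i)" "\<And>i. \<rho> i \<le> f i" "\<And>i. f (Suc i) \<le> \<rho> i"
      by (auto simp: shapes_def vstrip_def hstrip_def)
    have "f i \<le> \<rho> (i - 1)" if "0 < i" for i using f(5)[of "i - 1"] that by simp
    with f show "f \<in> {f. (\<forall>i\<ge>L. f i = 0) \<and> (\<forall>i<L. f i \<in> C i)}" by (simp add: C_def)
  next
    fix f assume "f \<in> {f. (\<forall>i\<ge>L. f i = 0) \<and> (\<forall>i<L. f i \<in> C i)}"
    then have f: "\<And>i. L \<le> i \<Longrightarrow> f i = 0" "\<And>i. i < L \<Longrightarrow> f i \<in> C i" by auto
    have 1: "\<mu> i \<le> f i \<and> f i \<le> Suc (\<mu> i) \<and> \<rho> i \<le> f i" for i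
      using f[of i] \<mu>0[of i] \<rho>0[of i] by (cases "i < L") (auto simp: C_def)
    have 2: "f (Suc i) \<le> \<rho> i" for i
      using f[of "Suc i"] by (cases "Suc i < L") (auto simp: C_def)
    have 3: "f (Suc i) \<le> f i" for i using 1[of i] 2[of i] by simp
    show "f \<in> {\<kappa>. \<kappa> \<in> shapes L \<and> vstrip \<mu> \<kappa> \<and> hstrip \<rho> \<kappa>}"
      using 1 2 3 f(1) by (simp add: shapes_def vstrip_def hstrip_def)
  qed
  then have lhs: "(\<Sum>\<kappa> | \<kappa> \<in> shapes L \<and> vstrip \<mu> \<kappa> \<and> hstrip \<rho> \<kappa>. \<Prod>i<L. y ^ (\<kappa> i - \<mu> i) * x ^ (\<kappa> i - \<rho> i)) = (\<Prod>i<L. a i)"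
    using sum_prod_zero_beyond[of L C "\<lambda>i c. y ^ (c - \<mu> i) * x ^ (c - \<rho> i)", OF finC] by (simp add: a_def)
  have "{\<nu>. \<nu> \<in> shapes L \<and> hstrip \<nu> \<mu> \<and> vstrip \<nu> \<rho>} = {f. (\<forall>i\<ge>L. f i = 0) \<and> (\<forall>i<L. f i \<in> D i)}"
  proof (intro set_eqI iffI)
    fix f assume "f \<in> {\<nu>. \<nu> \<in> shapes L \<and> hstrip \<nu> \<mu> \<and> vstrip \<nu> \<rho>}"
    then show "f \<in> {f. (\<forall>i\<ge>L. f i = 0) \<and> (\<forall>i<L. f i \<in> D i)}"
      by (auto simp: shapes_def vstrip_def hstrip_def D_def)
  next
    fix f assume "f \<in> {f. (\<forall>i\<ge>L. f i = 0) \<and> (\<forall>i<L. f i \<in> D i)}"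
    then have f: "\<And>i. L \<le> i \<Longrightarrow> f i = 0" "\<And>i. i < L \<Longrightarrow> f i \<in> D i" by auto
    have 1: "f i \<le> \<mu> i \<and> \<mu> (Suc i) \<le> f i \<and> f i \<le> \<rho> i \<and> \<rho> i \<le> Suc (f i)" for i
      using f[of i] \<mu>0[of i] \<mu>0[of "Suc i"] \<rho>0[of i] by (cases "i < L") (auto simp: D_def)
    have 3: "f (Suc i) \<le> f i" for i using 1[of i] 1[of "Suc i"] by simp
    show "f \<in> {\<nu>. \<nu> \<in> shapes L \<and> hstrip \<nu> \<mu> \<and> vstrip \<nu> \<rho>}"
      using 1 3 f(1) by (simp add: shapes_def vstrip_def hstrip_def)
  qed
  then have rhs: "(\<Sum>\<nu> | \<nu> \<in> shapes L \<and> hstrip \<nu> \<mu> \<and> vstrip \<nu> \<rho>. \<Prod>i<L. x ^ (\<mu> i - \<nu> i) * y ^ (\<rho> i - \<nu> i)) = (\<Prod>i<L. b i)"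
    using sum_prod_zero_beyond[of L D "\<lambda>i c. x ^ (\<mu> i - c) * y ^ (\<rho> i - c)", OF finD] by (simp add: b_def)
  have "(\<Prod>i<L. a i) = (1 + x * y) * (\<Prod>i<L. b i)"
  proof (cases "\<forall>i<L. \<rho> i \<le> Suc (\<mu> i) \<and> \<mu> (Suc i) \<le> \<rho> i")
    \<comment> \<open>If \<mu> and \<rho> are too far apart in some row, both products contain an
      empty sum; on the side of \<kappa> it may sit one row lower.\<close>
    case False
    then obtain i where i: "i < L" "\<not> (\<rho> i \<le> Suc (\<mu> i) \<and> \<mu> (Suc i) \<le> \<rho> i)" by blast
    then have "D i = {}" by (auto simp: D_def)
    then have "b i = 0" by (simp add: b_def)
    then have b0: "(\<Prod>i<L. b i) = 0" using i(1) by (intro prod_zero) auto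
    have "\<exists>j<L. C j = {}"
    proof (cases "\<rho> i \<le> Suc (\<mu> i)")
      case True
      then have lt: "\<rho> i < \<mu> (Suc i)" using i by simp
      then have "Suc i < L" using \<mu>0[of "Suc i"] by (cases "Suc i < L") auto
      moreover have "C (Suc i) = {}" using lt by (auto simp: C_def)
      ultimately show ?thesis by blast
    next
      case False
      then have "C i = {}" by (auto simp: C_def)
      then show ?thesis using i(1) by blast
    qed
    then have "(\<Prod>i<L. a i) = 0" by (intro prod_zero) (auto simp: a_def intro!: bexI)
    with b0 show ?thesis by simp
  next
    case True
    \<comment> \<open>\<open>Q k\<close> is the factor gained when row k of \<kappa> may be longer
      than \<mu> by one cell. The same condition says that row k - 1 of \<nu> may be shorter than
      \<rho>, which accounts for the shift by one row between \<open>a\<close> and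
      \<open>b\<close>.\<close>
    define Q where "Q k = (if k = 0 \<or> \<mu> k < \<rho> (k - 1) then 1 + x * y else 1)" for k
    have step: "a k * Q (Suc k) = Q k * b k" if "k < L" for k
    proof -
      from True that have le: "\<rho> k \<le> Suc (\<mu> k)" "\<mu> (Suc k) \<le> \<rho> k" by auto
      have prev: "\<mu> k \<le> \<rho> (k - 1)" "\<rho> k \<le> \<rho> (k - 1)" if "0 < k"
        using True[rule_format, of "k - 1"] that \<open>k < L\<close> \<rho>S[of "k - 1"] by auto
      show ?thesis
      proof (cases "\<rho> k \<le> \<mu> k")
        case p: True
        have "C k = (if k = 0 \<or> \<mu> k < \<rho> (k - 1) then {\<mu> k, Suc (\<mu> k)} else {\<mu> k})"
          using p prev by (auto simp: C_def)
        then have "a k = x ^ (\<mu> k - \<rho> k) * Q k"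
          using p by (auto simp: a_def Q_def Suc_diff_le algebra_simps)
        moreover have "D k = (if \<mu> (Suc k) < \<rho> k then {\<rho> k, \<rho> k - 1} else {\<rho> k})"
          using p le by (auto simp: D_def)
        then have "b k = x ^ (\<mu> k - \<rho> k) * Q (Suc k)"
          using p by (auto simp: b_def Q_def algebra_simps Suc_diff_le diff_Suc_eq_diff_pred[symmetric])
        ultimately show ?thesis by (simp add: algebra_simps)
      next
        case p: False
        then have \<rho>k: "\<rho> k = Suc (\<mu> k)" using le by simp
        have "C k = {Suc (\<mu> k)}" using prev \<rho>k by (auto simp: C_def)
        then have "a k = y" by (simp add: a_def \<rho>k)
        moreover have "D k = {\<mu> k}" using \<rho>k \<mu>S[of k] by (auto simp: D_def)
        then have "b k = y" by (simp add: b_def \<rho>k)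
        moreover have "Q k = 1 + x * y" "Q (Suc k) = 1 + x * y"
          using prev \<rho>k \<mu>S[of k] by (auto simp: Q_def)
        ultimately show ?thesis by (simp add: mult.commute)
      qed
    qed
    have "(\<Prod>i<k. a i) * Q k = (1 + x * y) * (\<Prod>i<k. b i)" if "k \<le> L" for k
      using that
    proof (induction k)
      case 0
      show ?case by (simp add: Q_def)
    next
      case (Suc k)
      have "(\<Prod>i<Suc k. a i) * Q (Suc k) = (\<Prod>i<k. a i) * (a k * Q (Suc k))" by (simp add: mult.assoc)
      also have "\<dots> = ((\<Prod>i<k. a i) * Q k) * b k" using Suc.prems by (simp add: step mult.assoc)
      also have "\<dots> = (1 + x * y) * (\<Prod>i<Suc k. b i)" using Suc by (simp add: mult.assoc)
      finally show ?case .
    qed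
    \<comment> \<open>\<open>Q L = 1\<close> because row L - 1 of \<rho> is empty: no cell of
      \<kappa> is lost by cutting off at L rows. The factor 1 + x y that remains is
      \<open>Q 0\<close>.\<close>
    from this[of L] show ?thesis using L by (simp add: Q_def)
  qed
  then show ?thesis by (simp add: lhs rhs)
qed

text \<open>For \<open>x i\<close> the variables this is the Schur polynomial in \<open>x 0, \<dots>, x (n - 1)\<close> of a shape with
  at most \<open>L\<close> rows, by the branching rule.\<close>

fun branching_sum :: "(nat \<Rightarrow> 'a :: comm_ring_1) \<Rightarrow> nat \<Rightarrow> nat \<Rightarrow> (nat \<Rightarrow> nat) \<Rightarrow> 'a" where
  "branching_sum x L 0 \<mu> = (if \<mu> = (\<lambda>_. 0) then 1 else 0)"
| "branching_sum x L (Suc n) \<mu> =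
    (\<Sum>\<nu> | \<nu> \<in> shapes L \<and> hstrip \<nu> \<mu>. (\<Prod>i<L. x n ^ (\<mu> i - \<nu> i)) * branching_sum x L n \<nu>)"

text \<open>A nonzero value of \<open>\<mu> n\<close> means more than n rows, and removing a
  horizontal strip eliminates at most one row per variable.\<close>

lemma branching_sum_eq_0: "\<mu> n \<noteq> 0 \<Longrightarrow> branching_sum x L n \<mu> = 0"
proof (induction n arbitrary: \<mu>)
  case 0
  then show ?case by auto
next
  case (Suc n)
  have "branching_sum x L n \<nu> = 0" if "hstrip \<nu> \<mu>" for \<nu>
  proof (rule Suc.IH)
    have "\<mu> (Suc n) \<le> \<nu> n" using that by (simp add: hstrip_def)
    with Suc.prems show "\<nu> n \<noteq> 0" by simp
  qed
  then show ?case by (auto intro!: sum.neutral)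
qed

text \<open>The product on the left generates the elementary polynomials by powers of y, so all k
  are treated at once; on the right y counts the added cells.\<close>

lemma branching_sum_pieri:
  fixes x :: "nat \<Rightarrow> 'a :: comm_ring_1"
  assumes "n \<le> L" "\<mu> \<in> shapes L"
  shows "(\<Prod>i<n. 1 + x i * y) * branching_sum x L n \<mu>
    = (\<Sum>\<kappa> | \<kappa> \<in> shapes L \<and> vstrip \<mu> \<kappa>. (\<Prod>i<L. y ^ (\<kappa> i - \<mu> i)) * branching_sum x L n \<kappa>)"
  using assms
proof (induction n arbitrary: \<mu>)
  case 0
  have fin: "finite {\<kappa>. \<kappa> \<in> shapes L \<and> vstrip \<mu> \<kappa>}"
    by (rule finite_subset[OF _ finite_shapes_bounded[of L "Suc (\<mu> 0)"]])
      (use shapes_antimono[of _ L 0] in \<open>auto simp: vstrip_def intro: le_trans\<close>)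
  show ?case
  proof (cases "\<mu> = (\<lambda>_. 0)")
    case True
    have "(\<Sum>\<kappa> | \<kappa> \<in> shapes L \<and> vstrip \<mu> \<kappa>. (\<Prod>i<L. y ^ (\<kappa> i - \<mu> i)) * branching_sum x L 0 \<kappa>)
        = (\<Sum>\<kappa>\<in>{\<lambda>_. 0}. (\<Prod>i<L. y ^ (\<kappa> i - \<mu> i)) * branching_sum x L 0 \<kappa>)"
      by (rule sum.mono_neutral_right[OF fin]) (auto simp: True shapes_def vstrip_def)
    then show ?thesis by (simp add: True)
  next
    case False
    have "(\<Sum>\<kappa> | \<kappa> \<in> shapes L \<and> vstrip \<mu> \<kappa>. (\<Prod>i<L. y ^ (\<kappa> i - \<mu> i)) * branching_sum x L 0 \<kappa>) = 0"
    proof (rule sum.neutral, clarify)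
      fix \<kappa> assume "vstrip \<mu> \<kappa>"
      moreover from False obtain i where "\<mu> i \<noteq> 0" by auto
      ultimately have "\<kappa> i \<noteq> 0" by (metis le_zero_eq vstrip_def)
      then have "\<kappa> \<noteq> (\<lambda>_. 0)" by auto
      then show "(\<Prod>i<L. y ^ (\<kappa> i - \<mu> i)) * branching_sum x L 0 \<kappa> = 0" by simp
    qed
    then show ?thesis using False by simp
  qed
next
  case (Suc n)
  let ?S = "branching_sum x L n"
  \<comment> \<open>A finite box containing every shape that occurs, needed to exchange the double
    sums; a vertical strip lengthens a row by at most one, hence the successor.\<close>
  define W where "W = {f \<in> shapes L. \<forall>i. f i \<le> Suc (\<mu> 0)}"
  have finW: "finite W" unfolding W_def by (rule finite_shapes_bounded)
  have \<mu>le: "\<mu> i \<le> \<mu> 0" for i using shapes_antimono[OF Suc.prems(2)] by simp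
  have hW: "\<nu> \<in> W" if "\<nu> \<in> shapes L" "hstrip \<nu> \<mu>" for \<nu>
  proof -
    have "\<nu> i \<le> Suc (\<mu> 0)" for i using that(2) \<mu>le[of i] unfolding hstrip_def by (meson le_SucI le_trans)
    with that show ?thesis by (simp add: W_def)
  qed
  have vW: "\<kappa> \<in> W" if "\<kappa> \<in> shapes L" "vstrip \<mu> \<kappa>" for \<kappa>
  proof -
    have "\<kappa> i \<le> Suc (\<mu> 0)" for i using that(2) \<mu>le[of i] unfolding vstrip_def by (meson Suc_le_mono le_trans)
    with that show ?thesis by (simp add: W_def)
  qed
  have vhW: "\<rho> \<in> W" if "\<rho> \<in> shapes L" "vstrip \<nu> \<rho>" "hstrip \<nu> \<mu>" for \<nu> \<rho>
  proof -
    have "\<rho> i \<le> Suc (\<mu> 0)" for i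
      using that(2,3) \<mu>le[of i] unfolding vstrip_def hstrip_def by (meson Suc_le_mono le_trans)
    with that show ?thesis by (simp add: W_def)
  qed
  have hvW: "\<rho> \<in> W" if "\<rho> \<in> shapes L" "hstrip \<rho> \<kappa>" "vstrip \<mu> \<kappa>" for \<kappa> \<rho>
  proof -
    have "\<rho> i \<le> Suc (\<mu> 0)" for i
      using that(2,3) \<mu>le[of i] unfolding vstrip_def hstrip_def by (meson Suc_le_mono le_trans)
    with that show ?thesis by (simp add: W_def)
  qed
  have Wsh: "f \<in> shapes L" if "f \<in> W" for f using that by (simp add: W_def)
  have sum_W: "sum g {f. f \<in> shapes L \<and> P f} = sum g {f. f \<in> W \<and> P f}"
    if "\<And>f. f \<in> shapes L \<Longrightarrow> P f \<Longrightarrow> f \<in> W" for g :: "(nat \<Rightarrow> nat) \<Rightarrow> 'a" and P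
    by (rule sum.cong) (use that Wsh in auto)
  let ?X = "\<lambda>\<mu> \<nu>. \<Prod>i<L. x n ^ (\<mu> i - \<nu> i)" and ?Y = "\<lambda>\<mu> \<kappa>. \<Prod>i<L. y ^ (\<kappa> i - \<mu> i)"
  let ?A = "{\<nu>. \<nu> \<in> W \<and> hstrip \<nu> \<mu>}" and ?B = "{\<kappa>. \<kappa> \<in> W \<and> vstrip \<mu> \<kappa>}"
  have "(\<Prod>i<Suc n. 1 + x i * y) * branching_sum x L (Suc n) \<mu>
      = (1 + x n * y) * (\<Sum>\<nu>\<in>?A. ?X \<mu> \<nu> * ((\<Prod>i<n. 1 + x i * y) * ?S \<nu>))"
    by (simp add: sum_W[OF hW] sum_distrib_left algebra_simps)
  also have "(\<Sum>\<nu>\<in>?A. ?X \<mu> \<nu> * ((\<Prod>i<n. 1 + x i * y) * ?S \<nu>))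
      = (\<Sum>\<nu>\<in>?A. \<Sum>\<rho> | \<rho> \<in> W \<and> vstrip \<nu> \<rho>. ?X \<mu> \<nu> * ?Y \<nu> \<rho> * ?S \<rho>)"
  proof (rule sum.cong[OF refl])
    fix \<nu> assume \<nu>: "\<nu> \<in> ?A"
    then show "?X \<mu> \<nu> * ((\<Prod>i<n. 1 + x i * y) * ?S \<nu>) = (\<Sum>\<rho> | \<rho> \<in> W \<and> vstrip \<nu> \<rho>. ?X \<mu> \<nu> * ?Y \<nu> \<rho> * ?S \<rho>)"
      using Suc.prems Wsh
      by (subst Suc.IH, simp, simp, subst sum_W) (auto intro: vhW simp: sum_distrib_left mult.assoc)
  qed
  \<comment> \<open>The commutation relation holds for fixed initial shape \<mu> and final shape
    \<rho>, so \<rho> is moved to the outer sum and the intermediate shapes inside.\<close>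
  also have "\<dots> = (\<Sum>\<rho>\<in>W. \<Sum>\<nu> | \<nu> \<in> ?A \<and> vstrip \<nu> \<rho>. ?X \<mu> \<nu> * ?Y \<nu> \<rho> * ?S \<rho>)"
    by (rule sum.swap_restrict) (use finW in auto)
  also have "(1 + x n * y) * \<dots> = (\<Sum>\<rho>\<in>W. \<Sum>\<kappa> | \<kappa> \<in> ?B \<and> hstrip \<rho> \<kappa>. ?Y \<mu> \<kappa> * ?X \<kappa> \<rho> * ?S \<rho>)"
  proof (subst sum_distrib_left, rule sum.cong[OF refl])
    fix \<rho> assume \<rho>: "\<rho> \<in> W"
    show "(1 + x n * y) * (\<Sum>\<nu> | \<nu> \<in> ?A \<and> vstrip \<nu> \<rho>. ?X \<mu> \<nu> * ?Y \<nu> \<rho> * ?S \<rho>)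
        = (\<Sum>\<kappa> | \<kappa> \<in> ?B \<and> hstrip \<rho> \<kappa>. ?Y \<mu> \<kappa> * ?X \<kappa> \<rho> * ?S \<rho>)"
    proof (cases "\<rho> (L - 1) = 0")
      case True
      have A: "{\<nu>. \<nu> \<in> ?A \<and> vstrip \<nu> \<rho>} = {\<nu>. \<nu> \<in> shapes L \<and> hstrip \<nu> \<mu> \<and> vstrip \<nu> \<rho>}"
        using hW Wsh by blast
      have B: "{\<kappa>. \<kappa> \<in> ?B \<and> hstrip \<rho> \<kappa>} = {\<kappa>. \<kappa> \<in> shapes L \<and> vstrip \<mu> \<kappa> \<and> hstrip \<rho> \<kappa>}"
        using vW Wsh by blast
      have "0 < L" using Suc.prems by simp
      from strips_commute[OF Suc.prems(2) Wsh[OF \<rho>] this True, of y "x n"]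
      show ?thesis
        unfolding A B by (simp add: prod.distrib sum_distrib_right[symmetric] mult.assoc[symmetric])
    next
      \<comment> \<open>Here \<rho> has more than n rows, so its polynomial in n variables vanishes;
        truncation at L rows is harmless in all remaining cases.\<close>
      case False
      have "\<rho> (L - 1) \<le> \<rho> n" using Suc.prems by (intro shapes_antimono[OF Wsh[OF \<rho>]]) simp
      with False have "?S \<rho> = 0" by (intro branching_sum_eq_0) simp
      then show ?thesis by simp
    qed
  qed
  also have "\<dots> = (\<Sum>\<kappa>\<in>?B. \<Sum>\<rho> | \<rho> \<in> W \<and> hstrip \<rho> \<kappa>. ?Y \<mu> \<kappa> * ?X \<kappa> \<rho> * ?S \<rho>)"
    by (rule sum.swap_restrict[symmetric]) (use finW in auto)
  also have "\<dots> = (\<Sum>\<kappa>\<in>?B. ?Y \<mu> \<kappa> * branching_sum x L (Suc n) \<kappa>)"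
  proof (rule sum.cong[OF refl])
    fix \<kappa> assume \<kappa>: "\<kappa> \<in> ?B"
    then show "(\<Sum>\<rho> | \<rho> \<in> W \<and> hstrip \<rho> \<kappa>. ?Y \<mu> \<kappa> * ?X \<kappa> \<rho> * ?S \<rho>) = ?Y \<mu> \<kappa> * branching_sum x L (Suc n) \<kappa>"
      by (simp, subst sum_W) (auto intro: hvW simp: sum_distrib_left mult.assoc)
  qed
  also have "\<dots> = (\<Sum>\<kappa> | \<kappa> \<in> shapes L \<and> vstrip \<mu> \<kappa>. ?Y \<mu> \<kappa> * branching_sum x L (Suc n) \<kappa>)"
    by (rule sum_W[symmetric]) (rule vW)
  finally show ?case .
qed

section \<open>Multiplication by variables in the ring of series\<close>

definition var :: "nat \<Rightarrow> mseries" where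
  "var n = MSeries (\<lambda>M. if M = {#n#} then 1 else 0)"

lemma coeff_var: "coeff (var n) M = (if M = {#n#} then 1 else 0)"
  by (simp add: var_def)

lemma coeff_var_mult: "coeff (var n * f) M = (if n \<in># M then coeff f (M - {#n#}) else 0)"
proof (cases "n \<in># M")
  case True
  have "coeff (var n * f) M = coeff (var n) {#n#} * coeff f (M - {#n#})"
    by (rule coeff_mult_eqI) (use True in \<open>auto simp: coeff_var split: if_splits\<close>)
  then show ?thesis using True by (simp add: coeff_var)
next
  case False
  have "coeff (var n * f) M = 0"
    by (rule ccontr, erule coeff_mult_nonzeroE) (use False in \<open>auto simp: coeff_var split: if_splits\<close>)
  then show ?thesis using False by simp
qed

lemma coeff_var_power_mult:
  "coeff (var n ^ d * f) M = (if d \<le> count M n then coeff f (M - replicate_mset d n) else 0)"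
proof (induction d arbitrary: M)
  case 0
  then show ?case by simp
next
  case (Suc d)
  have "coeff (var n ^ Suc d * f) M = coeff (var n * (var n ^ d * f)) M"
    by (simp add: mult.assoc)
  also have "\<dots> = (if n \<in># M \<and> d \<le> count M n - 1 then coeff f (M - {#n#} - replicate_mset d n) else 0)"
    by (simp add: coeff_var_mult Suc.IH)
  also have "M - {#n#} - replicate_mset d n = M - replicate_mset (Suc d) n" by simp
  also have "(n \<in># M \<and> d \<le> count M n - 1) = (Suc d \<le> count M n)"
    unfolding count_greater_zero_iff[symmetric] by linarith
  finally show ?case .
qed

text \<open>A term arises by selecting a subset of the factors: it is squarefree in the first n
  variables, and the exponent of the separate variable m counts the selected factors.\<close>

lemma coeff_prod_one_plus_var:
  assumes "n \<le> m"
  shows "coeff (\<Prod>i<n. 1 + var i * var m) A =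
    (if set_mset A \<subseteq> insert m {..<n} \<and> (\<forall>i<n. count A i \<le> 1) \<and> count A m = size {#i \<in># A. i < n#} then 1 else 0)"
  using assms
proof (induction n arbitrary: A)
  case 0
  have "A = {#}" if "set_mset A \<subseteq> {m}" "m \<notin># A"
  proof -
    have "set_mset A = {}" using that by blast
    then show ?thesis by simp
  qed
  then show ?case by (auto simp: coeff_1 count_eq_zero_iff)
next
  case (Suc n)
  let ?P = "\<lambda>n A. set_mset A \<subseteq> insert m {..<n} \<and> (\<forall>i<n. count A i \<le> 1) \<and> count A m = size {#i \<in># A. i < n#}"
  let ?F = "\<Prod>i<n. 1 + var i * var m"
  have IH: "coeff ?F A = (if ?P n A then 1 else 0)" for A using Suc by simp
  have "(\<Prod>i<Suc n. 1 + var i * var m) = ?F + var n * (var m * ?F)"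
    by (simp add: algebra_simps)
  then have eq: "coeff (\<Prod>i<Suc n. 1 + var i * var m) A = coeff ?F A +
      (if n \<in># A \<and> m \<in># A - {#n#} then coeff ?F (A - {#n#} - {#m#}) else 0)"
    by (simp add: coeff_var_mult)
  have nm: "n \<noteq> m" "n < m" using Suc.prems by auto
  show ?case
  proof (cases "n \<in># A")
    case False
    then have "{#i \<in># A. i < Suc n#} = {#i \<in># A. i < n#}"
      by (intro filter_mset_cong refl) (auto simp: less_Suc_eq)
    moreover have "count A n = 0" using False by (simp add: not_in_iff)
    ultimately have "?P (Suc n) A \<longleftrightarrow> ?P n A"
      using False by (auto simp: less_Suc_eq)
    moreover have "coeff (\<Prod>i<Suc n. 1 + var i * var m) A = coeff ?F A" using False by (simp only: eq) simp
    ultimately show ?thesis by (simp only: IH)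
  next
    case True
    then obtain B where B: "A = add_mset n B" by (metis mset_add)
    have "\<not> ?P n A" using True nm by auto
    then have 1: "coeff ?F A = 0" by (simp only: IH if_False)
    show ?thesis
    proof (cases "m \<in># B")
      case False
      then have "count A m = 0" using nm by (simp add: B not_in_iff)
      moreover have "size {#i \<in># A. i < Suc n#} \<noteq> 0" by (simp add: B)
      ultimately have "\<not> ?P (Suc n) A" by metis
      moreover have "coeff (\<Prod>i<Suc n. 1 + var i * var m) A = 0"
        using False by (simp only: eq 1) (simp add: B)
      ultimately show ?thesis by (simp only: if_False)
    next
      case True
      then obtain C where C: "B = add_mset m C" by (metis mset_add)
      have "?P (Suc n) A \<longleftrightarrow> ?P n C"
      proof
        assume P: "?P (Suc n) A"
        have "count C n = 0" using P nm by (auto simp: B C)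
        then have nC: "n \<notin># C" by (simp add: not_in_iff)
        then have "{#i \<in># C. i < Suc n#} = {#i \<in># C. i < n#}"
          by (intro filter_mset_cong refl) (auto simp: less_Suc_eq)
        with P nC nm show "?P n C" by (auto simp: B C less_Suc_eq split: if_splits)
      next
        assume P: "?P n C"
        then have nC: "n \<notin># C" using nm by auto
        then have "{#i \<in># C. i < Suc n#} = {#i \<in># C. i < n#}"
          by (intro filter_mset_cong refl) (auto simp: less_Suc_eq)
        moreover have "count C n = 0" using nC by (simp add: not_in_iff)
        ultimately show "?P (Suc n) A" using P nC nm by (auto simp: B C less_Suc_eq)
      qed
      moreover have "coeff (\<Prod>i<Suc n. 1 + var i * var m) A = coeff ?F C"
        by (simp only: eq 1) (simp add: B C)
      ultimately show ?thesis by (simp only: IH)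
    qed
  qed
qed

section \<open>Semistandard tableaux and the branching rule\<close>

definition shape_cells :: "(nat \<Rightarrow> nat) \<Rightarrow> (nat \<times> nat) set" where
  "shape_cells \<mu> = {(i, j). j < \<mu> i}"

text \<open>The tableaux counted by \<open>schur\<close>, with a bound on the entries so that the
  largest letter can be split off.\<close>

definition bounded_tableaux :: "nat \<Rightarrow> (nat \<Rightarrow> nat) \<Rightarrow> nat multiset \<Rightarrow> (nat \<times> nat \<Rightarrow> nat) set" where
  "bounded_tableaux n \<mu> M = {T \<in> extensional (shape_cells \<mu>).
     (\<forall>i j. Suc j < \<mu> i \<longrightarrow> T (i, j) \<le> T (i, Suc j)) \<and>
     (\<forall>i j. j < \<mu> (Suc i) \<longrightarrow> T (i, j) < T (Suc i, j)) \<and>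
     (\<forall>i j. j < \<mu> i \<longrightarrow> T (i, j) < n) \<and>
     image_mset T (mset_set (shape_cells \<mu>)) = M}"

lemma shape_cells_eq_Sigma: "\<mu> \<in> shapes L \<Longrightarrow> shape_cells \<mu> = Sigma {..<L} (\<lambda>i. {..<\<mu> i})"
  unfolding shape_cells_def shapes_def by (auto simp: not_less) (metis not_less less_zeroE)

lemma finite_shape_cells: "\<mu> \<in> shapes L \<Longrightarrow> finite (shape_cells \<mu>)"
  by (simp add: shape_cells_eq_Sigma)

lemma finite_bounded_tableaux:
  assumes "\<mu> \<in> shapes L"
  shows "finite (bounded_tableaux n \<mu> M)"
proof (rule finite_subset)
  show "bounded_tableaux n \<mu> M \<subseteq> PiE (shape_cells \<mu>) (\<lambda>_. {..<n})"
    by (auto simp: bounded_tableaux_def shape_cells_def PiE_def)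
  show "finite (PiE (shape_cells \<mu>) (\<lambda>_. {..<n}))"
    using finite_shape_cells[OF assms] by (intro finite_PiE) auto
qed

lemma image_mset_shape_cells_hstrip:
  assumes \<mu>: "\<mu> \<in> shapes L" and \<nu>: "\<nu> \<in> shapes L" and le: "\<And>i. \<nu> i \<le> \<mu> i"
    and T: "\<And>i j. \<nu> i \<le> j \<Longrightarrow> j < \<mu> i \<Longrightarrow> T (i, j) = n"
  shows "image_mset T (mset_set (shape_cells \<mu>))
    = image_mset T (mset_set (shape_cells \<nu>)) + replicate_mset (\<Sum>i<L. \<mu> i - \<nu> i) n"
proof -
  let ?D = "Sigma {..<L} (\<lambda>i. {\<nu> i..<\<mu> i})"
  have "shape_cells \<mu> = shape_cells \<nu> \<union> ?D" and disj: "shape_cells \<nu> \<inter> ?D = {}"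
    using le unfolding shape_cells_eq_Sigma[OF \<mu>] shape_cells_eq_Sigma[OF \<nu>]
    by (auto simp: not_le intro: less_le_trans)
  then have "mset_set (shape_cells \<mu>) = mset_set (shape_cells \<nu>) + mset_set ?D"
    using finite_shape_cells[OF \<nu>] by (simp add: mset_set_Union)
  moreover have "image_mset T (mset_set ?D) = image_mset (\<lambda>_. n) (mset_set ?D)"
    by (rule image_mset_cong) (auto simp: T)
  then have "image_mset T (mset_set ?D) = replicate_mset (\<Sum>i<L. \<mu> i - \<nu> i) n"
    by (simp add: image_mset_const_eq)
  ultimately show ?thesis by simp
qed

text \<open>The entries below \<open>n\<close> of a tableau of shape \<open>\<mu>\<close> occupy a shape \<open>\<nu>\<close>, and the remaining
  cells, all filled with \<open>n\<close>, form a horizontal strip.\<close>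

lemma card_tableaux_below:
  assumes \<mu>: "\<mu> \<in> shapes L" and \<nu>: "\<nu> \<in> shapes L" and h: "hstrip \<nu> \<mu>"
  defines "d \<equiv> \<Sum>i<L. \<mu> i - \<nu> i"
  shows "card {T \<in> bounded_tableaux (Suc n) \<mu> M. \<forall>i j. j < \<mu> i \<longrightarrow> (T (i, j) < n \<longleftrightarrow> j < \<nu> i)}
    = (if d \<le> count M n then card (bounded_tableaux n \<nu> (M - replicate_mset d n)) else 0)"
    (is "card ?A = _")
proof -
  have le: "\<nu> i \<le> \<mu> i" "\<mu> (Suc i) \<le> \<nu> i" for i using h by (auto simp: hstrip_def)
  have content: "image_mset T (mset_set (shape_cells \<nu>)) + replicate_mset d n = M" if "T \<in> ?A" for T
  proof -
    have "T (i, j) = n" if "\<nu> i \<le> j" "j < \<mu> i" for i j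
    proof -
      have "T (i, j) < Suc n" "T (i, j) < n \<longleftrightarrow> j < \<nu> i"
        using \<open>T \<in> ?A\<close> that by (simp_all add: bounded_tableaux_def)
      with that show ?thesis by simp
    qed
    from image_mset_shape_cells_hstrip[where T = T, OF \<mu> \<nu> le(1) this] that
    show ?thesis by (simp add: d_def bounded_tableaux_def)
  qed
  show ?thesis
  proof (cases "d \<le> count M n")
    case False
    have "?A = {}"
    proof (rule equals0I)
      fix T assume "T \<in> ?A"
      from arg_cong[OF content[OF this], of "\<lambda>M. count M n"] False show False by simp
    qed
    then show ?thesis using False by (simp only: card.empty if_False)
  next
    case True
    then have sub: "replicate_mset d n \<subseteq># M" by (simp add: count_le_replicate_mset_subset_eq)
    let ?B = "bounded_tableaux n \<nu> (M - replicate_mset d n)"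
    let ?r = "\<lambda>T. restrict T (shape_cells \<nu>)"
    \<comment> \<open>Inverse of restriction: the strip is refilled with n, and cells outside \<mu>
      receive \<open>undefined\<close> so that the result is extensional.\<close>
    let ?e = "\<lambda>T c. if c \<in> shape_cells \<nu> then T c else if c \<in> shape_cells \<mu> then n else undefined"
    have sub_cells: "shape_cells \<nu> \<subseteq> shape_cells \<mu>"
      using le(1) by (auto simp: shape_cells_def intro: less_le_trans)
    have "bij_betw ?r ?A ?B"
    proof (rule bij_betw_byWitness[where f' = ?e])
      show "\<forall>T\<in>?A. ?e (?r T) = T"
      proof (intro ballI ext)
        fix T and c :: "nat \<times> nat" assume T: "T \<in> ?A"
        obtain i j where c: "c = (i, j)" by (cases c)
        have "T (i, j) < Suc n \<and> (T (i, j) < n \<longleftrightarrow> j < \<nu> i)" if "j < \<mu> i"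
          using T that by (simp add: bounded_tableaux_def)
        moreover have "T (i, j) = undefined" if "\<not> j < \<mu> i"
          using T that by (simp add: bounded_tableaux_def shape_cells_def extensional_def)
        moreover have "j < \<nu> i \<Longrightarrow> j < \<mu> i" using le(1)[of i] by simp
        ultimately show "?e (?r T) c = T c"
          by (cases "j < \<nu> i"; cases "j < \<mu> i") (simp_all add: c shape_cells_def)
      qed
      show "\<forall>T\<in>?B. ?r (?e T) = T"
        by (auto simp: bounded_tableaux_def extensional_def fun_eq_iff)
      show "?r ` ?A \<subseteq> ?B"
      proof (intro image_subsetI)
        fix T assume T: "T \<in> ?A"
        have "image_mset (?r T) (mset_set (shape_cells \<nu>)) = image_mset T (mset_set (shape_cells \<nu>))"
          by (rule image_mset_cong) (use finite_shape_cells[OF \<nu>] in auto)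
        then have c: "image_mset (?r T) (mset_set (shape_cells \<nu>)) = M - replicate_mset d n"
          using content[OF T] by (metis add_diff_cancel_right')
        have in\<mu>: "j < \<mu> i" if "j < \<nu> i" for i j using le(1) that by (rule less_le_trans[rotated])
        have "?r T (i, j) \<le> ?r T (i, Suc j)" if "Suc j < \<nu> i" for i j
          using T that in\<mu>[OF that] by (simp add: bounded_tableaux_def shape_cells_def)
        moreover have "?r T (i, j) < ?r T (Suc i, j)" if "j < \<nu> (Suc i)" for i j
        proof -
          have "j < \<nu> i" using that \<nu> by (auto simp: shapes_def intro: less_le_trans)
          then show ?thesis using T that in\<mu>[OF that] by (simp add: bounded_tableaux_def shape_cells_def)
        qed
        moreover have "?r T (i, j) < n" if "j < \<nu> i" for i j
          using T that in\<mu>[OF that] by (simp add: shape_cells_def)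
        ultimately show "?r T \<in> ?B" using c by (simp add: bounded_tableaux_def)
      qed
      show "?e ` ?B \<subseteq> ?A"
      proof (intro image_subsetI)
        fix T assume T: "T \<in> ?B"
        have e_in: "?e T (i, j) = T (i, j)" if "j < \<nu> i" for i j using that by (simp add: shape_cells_def)
        have e_out: "?e T (i, j) = n" if "\<nu> i \<le> j" "j < \<mu> i" for i j using that by (simp add: shape_cells_def)
        have Tn: "T (i, j) < n" if "j < \<nu> i" for i j using T that by (simp add: bounded_tableaux_def)
        have "image_mset (?e T) (mset_set (shape_cells \<mu>))
            = image_mset (?e T) (mset_set (shape_cells \<nu>)) + replicate_mset d n"
          unfolding d_def by (rule image_mset_shape_cells_hstrip[where T = "?e T", OF \<mu> \<nu> le(1) e_out])
        also have "image_mset (?e T) (mset_set (shape_cells \<nu>)) = image_mset T (mset_set (shape_cells \<nu>))"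
          by (rule image_mset_cong) (use finite_shape_cells[OF \<nu>] in auto)
        also have "\<dots> = M - replicate_mset d n" using T by (simp add: bounded_tableaux_def)
        finally have c: "image_mset (?e T) (mset_set (shape_cells \<mu>)) = M" using sub by simp
        have row: "?e T (i, j) \<le> ?e T (i, Suc j)" if "Suc j < \<mu> i" for i j
        proof (cases "Suc j < \<nu> i")
          case True
          then have "T (i, j) \<le> T (i, Suc j)" using T by (simp add: bounded_tableaux_def)
          then show ?thesis using True e_in[of j i] e_in[of "Suc j" i] by simp
        next
          case False
          then show ?thesis using e_out[of i "Suc j"] e_in[of j i] e_out[of i j] Tn[of j i] that
            by (cases "j < \<nu> i") auto
        qed
        have col: "?e T (i, j) < ?e T (Suc i, j)" if "j < \<mu> (Suc i)" for i j
        proof -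
          \<comment> \<open>Interlacing places the cell above any cell of \<mu> inside \<nu>, where
            entries are below n; this yields strict columns at the strip.\<close>
          have j: "j < \<nu> i" using that le(2)[of i] by simp
          show ?thesis
          proof (cases "j < \<nu> (Suc i)")
            case True
            then have "T (i, j) < T (Suc i, j)" using T by (simp add: bounded_tableaux_def)
            then show ?thesis using True j e_in[of j i] e_in[of j "Suc i"] by simp
          next
            case False
            then show ?thesis using e_out[of "Suc i" j] e_in[of j i] Tn[of j i] j that by simp
          qed
        qed
        have below: "?e T (i, j) < n \<longleftrightarrow> j < \<nu> i" if "j < \<mu> i" for i j
          using that e_in[of j i] e_out[of i j] Tn[of j i] by (cases "j < \<nu> i") auto
        have lt: "?e T (i, j) < Suc n" if "j < \<mu> i" for i j
          using that e_in[of j i] e_out[of i j] Tn[of j i] by (cases "j < \<nu> i") auto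
        have "?e T \<in> extensional (shape_cells \<mu>)"
          using sub_cells by (auto simp: extensional_def)
        with c row col below lt show "?e T \<in> ?A" by (simp only: bounded_tableaux_def mem_Collect_eq) blast
      qed
    qed
    then show ?thesis using True by (simp add: bij_betw_same_card)
  qed
qed

text \<open>Sorting the tableaux by the shape occupied by entries below the largest letter
  reproduces the recursion of \<open>branching_sum\<close>; the power of \<open>var n\<close>
  records how often that letter occurs.\<close>

lemma coeff_branching_sum_var:
  assumes "\<mu> \<in> shapes L"
  shows "coeff (branching_sum var L n \<mu>) M = of_nat (card (bounded_tableaux n \<mu> M))"
  using assms
proof (induction n arbitrary: \<mu> M)
  case 0
  show ?case
  proof (cases "\<mu> = (\<lambda>_. 0)")
    case True
    have "shape_cells \<mu> = {}" by (simp add: True shape_cells_def)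
    then have "bounded_tableaux 0 \<mu> M = (if M = {#} then {\<lambda>_. undefined} else {})"
      by (auto simp: bounded_tableaux_def True)
    then show ?thesis by (simp add: True coeff_1)
  next
    case False
    then obtain i where "0 < \<mu> i" by auto
    then have "bounded_tableaux 0 \<mu> M = {}" by (auto simp: bounded_tableaux_def)
    then show ?thesis using False by simp
  qed
next
  case (Suc n)
  let ?H = "{\<nu>. \<nu> \<in> shapes L \<and> hstrip \<nu> \<mu>}"
  let ?A = "\<lambda>\<nu>. {T \<in> bounded_tableaux (Suc n) \<mu> M. \<forall>i j. j < \<mu> i \<longrightarrow> (T (i, j) < n \<longleftrightarrow> j < \<nu> i)}"
  have finH: "finite ?H"
    by (rule finite_subset[OF _ finite_shapes_bounded[of L "\<mu> 0"]])
      (use shapes_antimono[OF Suc.prems] in \<open>auto simp: hstrip_def intro: le_trans\<close>)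
  have cover: "bounded_tableaux (Suc n) \<mu> M = (\<Union>\<nu>\<in>?H. ?A \<nu>)"
  proof
    show "bounded_tableaux (Suc n) \<mu> M \<subseteq> (\<Union>\<nu>\<in>?H. ?A \<nu>)"
    proof
      fix T assume T: "T \<in> bounded_tableaux (Suc n) \<mu> M"
      then have row: "Suc j < \<mu> i \<Longrightarrow> T (i, j) \<le> T (i, Suc j)"
        and col: "j < \<mu> (Suc i) \<Longrightarrow> T (i, j) < T (Suc i, j)"
        and lt: "j < \<mu> i \<Longrightarrow> T (i, j) < Suc n" for i j by (auto simp: bounded_tableaux_def)
      \<comment> \<open>Rows increase weakly, so the entries below n form an initial segment, ending
        at the first column that holds n or lies outside the row.\<close>
      define \<nu> where "\<nu> i = (LEAST j. \<mu> i \<le> j \<or> n \<le> T (i, j))" for i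
      have \<nu>le: "\<nu> i \<le> \<mu> i" for i unfolding \<nu>_def by (rule Least_le) simp
      have \<nu>T: "\<mu> i \<le> \<nu> i \<or> n \<le> T (i, \<nu> i)" for i
        unfolding \<nu>_def by (rule LeastI_ex) blast
      have 1: "T (i, j) < n" if "j < \<nu> i" for i j
        using not_less_Least[OF that[unfolded \<nu>_def]] by simp
      have 2: "n \<le> T (i, j)" if "\<nu> i \<le> j" "j < \<mu> i" for i j
        using that
      proof (induction rule: dec_induct)
        case base
        then show ?case using \<nu>T[of i] by simp
      next
        case (step j)
        then show ?case using row[of j i] by simp
      qed
      \<comment> \<open>Otherwise two entries n would lie in adjacent cells of one column.\<close>
      have 3: "\<mu> (Suc i) \<le> \<nu> i" for i
      proof (rule ccontr)
        assume c: "\<not> ?thesis"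
        then have "T (i, \<nu> i) < T (Suc i, \<nu> i)" "T (Suc i, \<nu> i) < Suc n" using col lt by auto
        moreover have "\<mu> (Suc i) \<le> \<mu> i" using Suc.prems by (simp add: shapes_def)
        then have "n \<le> T (i, \<nu> i)" using c \<nu>T[of i] by simp
        ultimately show False by simp
      qed
      have "hstrip \<nu> \<mu>" using \<nu>le 3 by (simp add: hstrip_def)
      moreover have "\<nu> i = 0" if "L \<le> i" for i
        using \<nu>le[of i] that Suc.prems by (simp add: shapes_def)
      then have "\<nu> \<in> shapes L" using \<nu>le 3 by (auto simp: shapes_def intro: le_trans)
      moreover have "\<forall>i j. j < \<mu> i \<longrightarrow> (T (i, j) < n \<longleftrightarrow> j < \<nu> i)"
        using 1 2 by (metis not_less)
      ultimately show "T \<in> (\<Union>\<nu>\<in>?H. ?A \<nu>)" using T by blast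
    qed
  qed blast
  have disj: "?A \<nu> \<inter> ?A \<nu>' = {}" if "\<nu> \<in> ?H" "\<nu>' \<in> ?H" "\<nu> \<noteq> \<nu>'" for \<nu> \<nu>'
  proof (rule ccontr)
    assume "?A \<nu> \<inter> ?A \<nu>' \<noteq> {}"
    then obtain T where T: "T \<in> ?A \<nu>" "T \<in> ?A \<nu>'" by blast
    have same: "j < \<nu> i \<longleftrightarrow> j < \<nu>' i" if "j < \<mu> i" for i j using T that by blast
    have "\<nu> i \<le> \<mu> i" "\<nu>' i \<le> \<mu> i" for i using that by (auto simp: hstrip_def)
    then have "\<nu> i = \<nu>' i" for i using same[of "\<nu> i" i] same[of "\<nu>' i" i]
      by (metis le_neq_implies_less less_irrefl linorder_neqE_nat order_less_le_trans)
    with that(3) show False by auto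
  qed
  note arg_cong[OF cover, of card]
  also have "card (\<Union>\<nu>\<in>?H. ?A \<nu>) = (\<Sum>\<nu>\<in>?H. card (?A \<nu>))"
  proof (rule card_UN_disjoint[OF finH])
    show "\<forall>\<nu>\<in>?H. finite (?A \<nu>)" using finite_bounded_tableaux[OF Suc.prems] by simp
    show "\<forall>\<nu>\<in>?H. \<forall>\<nu>'\<in>?H. \<nu> \<noteq> \<nu>' \<longrightarrow> ?A \<nu> \<inter> ?A \<nu>' = {}" using disj by blast
  qed
  also have "\<dots> = (\<Sum>\<nu>\<in>?H. if (\<Sum>i<L. \<mu> i - \<nu> i) \<le> count M n
      then card (bounded_tableaux n \<nu> (M - replicate_mset (\<Sum>i<L. \<mu> i - \<nu> i) n)) else 0)"
    by (intro sum.cong refl card_tableaux_below[OF Suc.prems]) auto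
  finally have card: "card (bounded_tableaux (Suc n) \<mu> M) = (\<Sum>\<nu>\<in>?H.
      if (\<Sum>i<L. \<mu> i - \<nu> i) \<le> count M n
      then card (bounded_tableaux n \<nu> (M - replicate_mset (\<Sum>i<L. \<mu> i - \<nu> i) n)) else 0)" .
  have "coeff (branching_sum var L (Suc n) \<mu>) M = (\<Sum>\<nu>\<in>?H.
      if (\<Sum>i<L. \<mu> i - \<nu> i) \<le> count M n
      then coeff (branching_sum var L n \<nu>) (M - replicate_mset (\<Sum>i<L. \<mu> i - \<nu> i) n) else 0)"
    by (simp add: coeff_var_power_mult power_sum[symmetric])
  also have "\<dots> = of_nat (card (bounded_tableaux (Suc n) \<mu> M))"
    unfolding card of_nat_sum by (rule sum.cong) (auto simp: Suc.IH)
  finally show ?case .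
qed

section \<open>Partitions as lists and as row functions\<close>

definition row :: "nat list \<Rightarrow> nat \<Rightarrow> nat" where
  "row \<mu> i = (if i < length \<mu> then \<mu> ! i else 0)"

lemma row_Nil [simp]: "row [] = (\<lambda>_. 0)"
  by (simp add: row_def fun_eq_iff)

lemma row_Cons_0 [simp]: "row (k # \<mu>) 0 = k" and row_Cons_Suc [simp]: "row (k # \<mu>) (Suc i) = row \<mu> i"
  by (simp_all add: row_def)

lemma partitions_Cons: "k # \<mu> \<in> partitions \<longleftrightarrow> 0 < k \<and> (\<forall>x\<in>set \<mu>. x \<le> k) \<and> \<mu> \<in> partitions"
  by (auto simp: partitions_def)

lemma row_antimono: "\<mu> \<in> partitions \<Longrightarrow> row \<mu> (Suc i) \<le> row \<mu> i"
  by (auto simp: row_def partitions_def sorted_wrt_iff_nth_less)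

lemma row_in_shapes: "\<mu> \<in> partitions \<Longrightarrow> length \<mu> \<le> L \<Longrightarrow> row \<mu> \<in> shapes L"
  using row_antimono by (auto simp: shapes_def) (simp add: row_def)

lemma inj_on_row: "inj_on row partitions"
proof (rule inj_onI)
  fix \<mu> \<kappa> assume "\<mu> \<in> partitions" "\<kappa> \<in> partitions" "row \<mu> = row \<kappa>"
  then show "\<mu> = \<kappa>"
  proof (induction \<mu> arbitrary: \<kappa>)
    case Nil
    have "row \<kappa> 0 = 0" by (simp flip: Nil.prems(3))
    then show ?case using Nil.prems(2) by (cases \<kappa>) (auto simp: partitions_Cons)
  next
    case (Cons k \<mu>)
    show ?case
    proof (cases \<kappa>)
      case Nil
      then show ?thesis using fun_cong[OF Cons.prems(3), of 0] Cons.prems(1) by (simp add: partitions_Cons)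
    next
      case (Cons k' \<kappa>')
      have "row \<mu> = row \<kappa>'"
      proof
        fix i show "row \<mu> i = row \<kappa>' i"
          using fun_cong[OF Cons.prems(3), of "Suc i"] by (simp add: Cons)
      qed
      moreover have "k = k'" using fun_cong[OF Cons.prems(3), of 0] by (simp add: Cons)
      ultimately show ?thesis using Cons.IH Cons.prems by (simp add: Cons partitions_Cons)
    qed
  qed
qed

lemma shapes_eq_row: "f \<in> shapes L \<Longrightarrow> \<exists>\<mu>\<in>partitions. row \<mu> = f"
proof (induction L arbitrary: f)
  case 0
  then have "row [] = f" by (auto simp: shapes_def fun_eq_iff)
  moreover have "[] \<in> partitions" by (simp add: partitions_def)
  ultimately show ?case by blast
next
  case (Suc L)
  have "(\<lambda>i. f (Suc i)) \<in> shapes L" using Suc.prems by (auto simp: shapes_def)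
  from Suc.IH[OF this] obtain \<mu> where \<mu>: "\<mu> \<in> partitions" "row \<mu> = (\<lambda>i. f (Suc i))" by blast
  show ?case
  proof (cases "f 0 = 0")
    case True
    then have "row [] = f" using shapes_antimono[OF Suc.prems, of 0] by (auto simp: fun_eq_iff)
    moreover have "[] \<in> partitions" by (simp add: partitions_def)
    ultimately show ?thesis by blast
  next
    case False
    have "x \<le> f 0" if "x \<in> set \<mu>" for x
    proof -
      from that obtain i where "i < length \<mu>" "x = \<mu> ! i" by (auto simp: in_set_conv_nth)
      then have "x = f (Suc i)" using fun_cong[OF \<mu>(2), of i] by (simp add: row_def)
      then show ?thesis using shapes_antimono[OF Suc.prems, of 0 "Suc i"] by simp
    qed
    then have "f 0 # \<mu> \<in> partitions" using False \<mu> by (simp add: partitions_Cons)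
    moreover have "row (f 0 # \<mu>) = f"
    proof
      fix i show "row (f 0 # \<mu>) i = f i" using fun_cong[OF \<mu>(2)] by (cases i) auto
    qed
    ultimately show ?thesis by blast
  qed
qed

lemma sum_row: "length \<mu> \<le> L \<Longrightarrow> (\<Sum>i<L. row \<mu> i) = sum_list \<mu>"
proof (induction \<mu> arbitrary: L)
  case Nil
  then show ?case by simp
next
  case (Cons k \<mu>)
  then obtain L' where "L = Suc L'" by (cases L) auto
  with Cons show ?case by (simp add: sum.lessThan_Suc_shift del: sum.lessThan_Suc)
qed

section \<open>From Schur polynomials to Schur functions\<close>

lemma cells_eq_shape_cells: "cells \<mu> = shape_cells (row \<mu>)"
  by (auto simp: cells_def shape_cells_def row_def split: if_splits)

text \<open>A tableau with content M has no entry outside M, so a coefficient at a monomial in the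
  first n variables only sees tableaux bounded by n.\<close>

lemma coeff_schur:
  assumes \<mu>: "\<mu> \<in> partitions" "length \<mu> \<le> L" and M: "set_mset M \<subseteq> {..<n}"
  shows "coeff (schur \<mu>) M = coeff (branching_sum var L n (row \<mu>)) M"
proof -
  note sh = row_in_shapes[OF \<mu>]
  have mem: "(i, j) \<in> cells \<mu> \<longleftrightarrow> j < row \<mu> i" for i j by (simp add: cells_eq_shape_cells shape_cells_def)
  have "T (i, j) < n" if "image_mset T (mset_set (cells \<mu>)) = M" "j < row \<mu> i" for T i j
  proof -
    have "T (i, j) \<in># image_mset T (mset_set (cells \<mu>))"
      using that(2) finite_shape_cells[OF sh] mem by (simp add: cells_eq_shape_cells)
    then show ?thesis using that(1) M by auto
  qed
  then have "{T \<in> semistandard_tableaux \<mu>. image_mset T (mset_set (cells \<mu>)) = M} = bounded_tableaux n (row \<mu>) M"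
    unfolding semistandard_tableaux_def bounded_tableaux_def mem
    by (auto simp: cells_eq_shape_cells)
  then show ?thesis by (simp add: schur_def coeff_branching_sum_var[OF sh])
qed

lemma coeff_branching_sum_var_nonzero:
  assumes "\<mu> \<in> shapes L" "coeff (branching_sum var L n \<mu>) M \<noteq> 0"
  shows "set_mset M \<subseteq> {..<n}"
proof -
  have "bounded_tableaux n \<mu> M \<noteq> {}"
    using assms by (auto simp: coeff_branching_sum_var)
  then obtain T where "T \<in> bounded_tableaux n \<mu> M" by blast
  then have T: "image_mset T (mset_set (shape_cells \<mu>)) = M" "\<And>i j. j < \<mu> i \<Longrightarrow> T (i, j) < n"
    by (auto simp: bounded_tableaux_def)
  show ?thesis
    using finite_shape_cells[OF assms(1)] T(2) by (auto simp: T(1)[symmetric] shape_cells_def)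
qed

lemma length_le_sum_list_partition: "\<mu> \<in> partitions \<Longrightarrow> length \<mu> \<le> sum_list \<mu>"
  by (induction \<mu>) (auto simp: partitions_Cons)

text \<open>A fresh variable \<open>var n\<close> records the number of added cells: extracting from
  \<open>branching_sum_pieri\<close> the part of degree \<open>k\<close> in \<open>y = var n\<close> gives multiplication by \<open>e\<^sub>k\<close>.\<close>

theorem pieri:
  assumes \<mu>: "\<mu> \<in> partitions"
  shows "elementary k * schur \<mu> = (\<Sum>\<kappa> | \<kappa> \<in> partitions_of (sum_list \<mu> + k) \<and> vstrip (row \<mu>) (row \<kappa>). schur \<kappa>)"
proof (rule mseries_eqI)
  fix M :: "nat multiset"
  \<comment> \<open>One more than every index in M, so \<open>var n\<close> is fresh; the inserted 0
    covers the empty monomial.\<close>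
  define n where "n = Suc (Max (insert 0 (set_mset M)))"
  have M: "set_mset M \<subseteq> {..<n}" by (auto simp: n_def less_Suc_eq_le)
  then have nM: "count M n = 0" by (auto simp: count_eq_zero_iff)
  \<comment> \<open>Large enough for the condition n \<le> L of the polynomial identity and for
    every partition of size |\<mu>| + k, whose length is at most its size.\<close>
  define L where "L = sum_list \<mu> + k + n"
  have L: "n \<le> L" "length \<mu> \<le> L"
    using length_le_sum_list_partition[OF \<mu>] by (auto simp: L_def)
  note sh = row_in_shapes[OF \<mu> L(2)]
  \<comment> \<open>Reading the identity at M times the k-th power of the fresh variable selects
    degree k in y.\<close>
  define N where "N = M + replicate_mset k n"
  have cN: "count N n = k" by (simp add: N_def nM)
  let ?F = "\<Prod>i<n. 1 + var i * var n" and ?S = "\<lambda>f. branching_sum var L n f"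
  define w where "w \<kappa> = (\<Sum>i<L. \<kappa> i - row \<mu> i)" for \<kappa>
  let ?V = "{\<kappa>. \<kappa> \<in> shapes L \<and> vstrip (row \<mu>) \<kappa>}"
  have Sn: "count B n = 0" if "coeff (?S f) B \<noteq> 0" "f \<in> shapes L" for B f
    using coeff_branching_sum_var_nonzero[OF that(2,1)] by (auto simp: count_eq_zero_iff)

  have "coeff (?F * ?S (row \<mu>)) N = (\<Sum>(A, B) | A + B = N. coeff ?F A * coeff (?S (row \<mu>)) B)"
    by (rule coeff_mult)
  \<comment> \<open>The Schur polynomial does not contain \<open>var n\<close>, so all k copies of n
    must come from the first factor.\<close>
  also have "\<dots> = (\<Sum>(A, B)\<in>(\<lambda>(A, B). (A + replicate_mset k n, B)) ` {(A, B). A + B = M}.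
      coeff ?F A * coeff (?S (row \<mu>)) B)"
  proof (rule sum.mono_neutral_right[OF finite_mset_splits])
    show "(\<lambda>(A, B). (A + replicate_mset k n, B)) ` {(A, B). A + B = M} \<subseteq> {(A, B). A + B = N}"
      by (auto simp: N_def)
    show "\<forall>p\<in>{(A, B). A + B = N} - (\<lambda>(A, B). (A + replicate_mset k n, B)) ` {(A, B). A + B = M}.
        (case p of (A, B) \<Rightarrow> coeff ?F A * coeff (?S (row \<mu>)) B) = 0"
    proof (intro ballI, rule ccontr)
      fix p
      assume p: "p \<in> {(A, B). A + B = N} - (\<lambda>(A, B). (A + replicate_mset k n, B)) ` {(A, B). A + B = M}"
        "(case p of (A, B) \<Rightarrow> coeff ?F A * coeff (?S (row \<mu>)) B) \<noteq> 0"
      obtain A B where "p = (A, B)" by (cases p)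
      with p have AB: "A + B = N" "(A, B) \<notin> (\<lambda>(A, B). (A + replicate_mset k n, B)) ` {(A, B). A + B = M}"
        and "coeff ?F A * coeff (?S (row \<mu>)) B \<noteq> 0" by auto
      then have "count B n = 0" using Sn sh by auto
      then have "count A n = k" using cN AB(1) by auto
      then have sub: "replicate_mset k n \<subseteq># A" by (simp add: count_le_replicate_mset_subset_eq[symmetric])
      then have "(A - replicate_mset k n) + B = M"
        using AB(1) by (simp add: N_def subset_mset.diff_add_assoc2 multiset_diff_union_assoc)
      then have "(A, B) \<in> (\<lambda>(A, B). (A + replicate_mset k n, B)) ` {(A, B). A + B = M}"
        using sub by (intro image_eqI[of _ _ "(A - replicate_mset k n, B)"]) auto
      with AB(2) show False by simp
    qed
  qed
  also have "\<dots> = (\<Sum>(A, B) | A + B = M. coeff ?F (A + replicate_mset k n) * coeff (?S (row \<mu>)) B)"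
    by (subst sum.reindex) (auto simp: inj_on_def case_prod_unfold)
  also have "\<dots> = (\<Sum>(A, B) | A + B = M. coeff (elementary k) A * coeff (schur \<mu>) B)"
  proof (rule sum.cong[OF refl], clarify)
    fix A B assume AB: "M = A + B"
    have A: "set_mset A \<subseteq> {..<n}" and B: "set_mset B \<subseteq> {..<n}" using M AB by auto
    have "count A n = 0" using A by (auto simp: count_eq_zero_iff)
    have 1: "{#i \<in># A + replicate_mset k n. i < n#} = A"
    proof -
      have "{#i \<in># A. i < n#} = A" using A by (auto simp: filter_mset_eq_conv)
      moreover have "{#i \<in># replicate_mset k n. i < n#} = {#}" by (auto simp: filter_mset_eq_conv)
      ultimately show ?thesis by simp
    qed
    have 2: "(\<forall>i<n. count (A + replicate_mset k n) i \<le> 1) \<longleftrightarrow> (\<forall>i. count A i \<le> 1)"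
    proof
      assume *: "\<forall>i<n. count (A + replicate_mset k n) i \<le> 1"
      show "\<forall>i. count A i \<le> 1"
      proof
        fix i show "count A i \<le> 1"
        proof (cases "i < n")
          case True
          then show ?thesis using *[rule_format, of i] by simp
        next
          case False
          then have "count A i = 0" using A by (auto simp: count_eq_zero_iff)
          then show ?thesis by simp
        qed
      qed
    qed auto
    have 3: "set_mset (A + replicate_mset k n) \<subseteq> insert n {..<n}" using A by auto
    \<comment> \<open>The exponent k of \<open>var n\<close> must equal the number of selected
      factors, which is the size of A: the very condition that A be a monomial of e_k.\<close>
    have "coeff ?F (A + replicate_mset k n) = coeff (elementary k) A"
      unfolding coeff_prod_one_plus_var[OF order.refl] 1 2 coeff_elementary
      using 3 \<open>count A n = 0\<close> by auto
    then show "coeff ?F (A + replicate_mset k n) * coeff (?S (row \<mu>)) B = coeff (elementary k) A * coeff (schur \<mu>) B"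
      by (simp add: coeff_schur[OF \<mu> L(2) B])
  qed
  also have "\<dots> = coeff (elementary k * schur \<mu>) M" by (simp add: coeff_mult)
  finally have lhs: "coeff (?F * ?S (row \<mu>)) N = coeff (elementary k * schur \<mu>) M" .

  have finV: "finite ?V"
    by (rule finite_subset[OF _ finite_shapes_bounded[of L "Suc (row \<mu> 0)"]])
      (use shapes_antimono[of _ L 0] in \<open>auto simp: vstrip_def intro: le_trans\<close>)
  have "coeff (?F * ?S (row \<mu>)) N = (\<Sum>\<kappa>\<in>?V. coeff (var n ^ w \<kappa> * ?S \<kappa>) N)"
    unfolding branching_sum_pieri[OF L(1) sh] by (simp add: w_def power_sum)
  \<comment> \<open>If w \<kappa> exceeds k, the power of \<open>var n\<close> does not divide N; if
    it is smaller, copies of n are left over that the Schur polynomial cannot absorb.\<close>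
  also have "\<dots> = (\<Sum>\<kappa>\<in>?V. if w \<kappa> = k then coeff (?S \<kappa>) M else 0)"
  proof (rule sum.cong[OF refl])
    fix \<kappa> assume \<kappa>: "\<kappa> \<in> ?V"
    consider "w \<kappa> = k" | "k < w \<kappa>" | "w \<kappa> < k" by linarith
    then show "coeff (var n ^ w \<kappa> * ?S \<kappa>) N = (if w \<kappa> = k then coeff (?S \<kappa>) M else 0)"
    proof cases
      case 1
      then show ?thesis by (simp add: coeff_var_power_mult cN) (simp add: N_def)
    next
      case 2
      then show ?thesis by (simp add: coeff_var_power_mult cN)
    next
      case 3
      then have "count (N - replicate_mset (w \<kappa>) n) n \<noteq> 0" by (simp add: cN)
      then have "coeff (?S \<kappa>) (N - replicate_mset (w \<kappa>) n) = 0"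
        using Sn[of \<kappa> "N - replicate_mset (w \<kappa>) n"] \<kappa> by auto
      with 3 show ?thesis by (simp add: coeff_var_power_mult)
    qed
  qed
  also have "\<dots> = (\<Sum>\<kappa>\<in>{\<kappa> \<in> ?V. w \<kappa> = k}. coeff (?S \<kappa>) M)"
    by (rule sum.inter_filter[OF finV, symmetric])
  also have "{\<kappa> \<in> ?V. w \<kappa> = k} = row ` {\<kappa>. \<kappa> \<in> partitions_of (sum_list \<mu> + k) \<and> vstrip (row \<mu>) (row \<kappa>)}"
    (is "_ = row ` ?P")
  proof -
    have w_row: "w (row \<kappa>) = sum_list \<kappa> - sum_list \<mu>" and le: "sum_list \<mu> \<le> sum_list \<kappa>"
      if "length \<kappa> \<le> L" "vstrip (row \<mu>) (row \<kappa>)" for \<kappa>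
    proof -
      have le: "row \<mu> i \<le> row \<kappa> i" for i using that(2) by (simp add: vstrip_def)
      show "w (row \<kappa>) = sum_list \<kappa> - sum_list \<mu>"
        unfolding w_def using that(1) L(2) le by (subst sum_subtractf_nat) (simp_all add: sum_row)
      show "sum_list \<mu> \<le> sum_list \<kappa>"
        using sum_mono[of "{..<L}" "row \<mu>" "row \<kappa>", OF le] that(1) L(2) by (simp add: sum_row)
    qed
    show ?thesis
    proof (intro set_eqI iffI)
      fix f assume f: "f \<in> {\<kappa> \<in> ?V. w \<kappa> = k}"
      then obtain \<kappa> where \<kappa>: "\<kappa> \<in> partitions" "row \<kappa> = f" using shapes_eq_row by blast
      have "length \<kappa> \<le> L"
      proof (rule ccontr)
        assume "\<not> ?thesis"
        then have "row \<kappa> L = \<kappa> ! L" "\<kappa> ! L \<in> set \<kappa>" by (auto simp: row_def)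
        then show False using \<kappa> f by (auto simp: shapes_def partitions_def)
      qed
      from w_row[OF this] le[OF this] \<kappa> f have "sum_list \<kappa> = sum_list \<mu> + k" by auto
      then show "f \<in> row ` ?P" using \<kappa> f by (auto simp: partitions_of_def)
    next
      fix f assume "f \<in> row ` ?P"
      then obtain \<kappa> where \<kappa>: "f = row \<kappa>" "\<kappa> \<in> partitions" "sum_list \<kappa> = sum_list \<mu> + k" "vstrip (row \<mu>) (row \<kappa>)"
        by (auto simp: partitions_of_def)
      have "length \<kappa> \<le> L" using length_le_sum_list_partition[OF \<kappa>(2)] \<kappa>(3) by (simp add: L_def)
      then show "f \<in> {\<kappa> \<in> ?V. w \<kappa> = k}" using \<kappa> w_row row_in_shapes by simp
    qed
  qed
  also have "(\<Sum>\<kappa>\<in>row ` ?P. coeff (?S \<kappa>) M) = (\<Sum>\<kappa>\<in>?P. coeff (schur \<kappa>) M)"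
  proof (subst sum.reindex)
    show "inj_on row ?P" using inj_on_row by (rule inj_on_subset) (auto simp: partitions_of_def)
    show "sum ((\<lambda>\<kappa>. coeff (?S \<kappa>) M) \<circ> row) ?P = (\<Sum>\<kappa>\<in>?P. coeff (schur \<kappa>) M)"
    proof (rule sum.cong[OF refl])
      fix \<kappa> assume "\<kappa> \<in> ?P"
      then have \<kappa>: "\<kappa> \<in> partitions" "sum_list \<kappa> = sum_list \<mu> + k" by (auto simp: partitions_of_def)
      have "length \<kappa> \<le> L" using length_le_sum_list_partition[OF \<kappa>(1)] \<kappa>(2) by (simp add: L_def)
      then show "((\<lambda>\<kappa>. coeff (?S \<kappa>) M) \<circ> row) \<kappa> = coeff (schur \<kappa>) M"
        by (simp add: coeff_schur[OF \<kappa>(1) _ M])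
    qed
  qed
  finally show "coeff (elementary k * schur \<mu>) M = coeff (\<Sum>\<kappa>\<in>?P. schur \<kappa>) M"
    by (simp add: lhs)
qed

lemma schur_Nil: "schur [] = 1"
proof (rule mseries_eqI)
  fix M
  have "{T \<in> semistandard_tableaux []. image_mset T (mset_set (cells [])) = M} = (if M = {#} then {\<lambda>_. undefined} else {})"
    by (auto simp: semistandard_tableaux_def cells_def)
  then show "coeff (schur []) M = coeff 1 M" by (simp add: schur_def coeff_1)
qed

text \<open>Starting from the Schur function 1 of the empty partition, each factor e_k preserves the
  cone by the Pieri rule.\<close>

lemma schur_positive_monom_elementary: "monom elementary M \<in> cone (schur ` partitions)"
proof (induction M)
  case empty
  have "[] \<in> partitions" by (simp add: partitions_def)
  then have "schur [] \<in> cone (schur ` partitions)" by (intro cone_base imageI)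
  then show ?case by (simp add: schur_Nil)
next
  case (add k M)
  have "elementary k * monom elementary M \<in> cone (schur ` partitions)"
  proof (rule cone_mult[OF cone_base add.IH])
    show "elementary k \<in> {elementary k}" by simp
    fix s t assume "s \<in> {elementary k}" "t \<in> schur ` partitions"
    then obtain \<mu> where "\<mu> \<in> partitions" "s * t = elementary k * schur \<mu>" by auto
    then show "s * t \<in> cone (schur ` partitions)"
      by (simp only: pieri) (intro cone_sum cone_base imageI, simp add: partitions_of_def)
  qed
  then show ?case by simp
qed

lemma e_positive_imp_schur_positive: "e_positive f \<Longrightarrow> schur_positive f"
proof -
  have "cone (monom elementary ` pos_msets) \<subseteq> cone (schur ` partitions)"
    by (rule cone_minimal) (auto intro: schur_positive_monom_elementary)
  then show "e_positive f \<Longrightarrow> schur_positive f"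
    unfolding e_positive_iff schur_positive_def positive_wrt_iff_cone by blast
qed

section \<open>Generating functions of colourings\<close>

text \<open>An arbitrary predicate replaces the edge condition, so that colourings in which two
  given vertices agree can be counted too.\<close>

definition colourings_with :: "'a set \<Rightarrow> (('a \<Rightarrow> nat) \<Rightarrow> bool) \<Rightarrow> nat multiset \<Rightarrow> ('a \<Rightarrow> nat) set" where
  "colourings_with V P M = {\<kappa> \<in> extensional V. P \<kappa> \<and> image_mset \<kappa> (mset_set V) = M}"

definition colouring_sf :: "'a set \<Rightarrow> (('a \<Rightarrow> nat) \<Rightarrow> bool) \<Rightarrow> mseries" where
  "colouring_sf V P = MSeries (\<lambda>M. of_nat (card (colourings_with V P M)))"

lemma coeff_colouring_sf: "coeff (colouring_sf V P) M = of_nat (card (colourings_with V P M))"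
  by (simp add: colouring_sf_def)

lemma finite_colourings_with:
  assumes "finite V"
  shows "finite (colourings_with V P M)"
proof (rule finite_subset)
  show "colourings_with V P M \<subseteq> PiE V (\<lambda>_. set_mset M)"
    using assms by (auto simp: colourings_with_def PiE_def)
  show "finite (PiE V (\<lambda>_. set_mset M))" using assms by (intro finite_PiE) auto
qed

lemma colouring_sf_cong:
  "(\<And>\<kappa>. \<kappa> \<in> extensional V \<Longrightarrow> P \<kappa> \<longleftrightarrow> Q \<kappa>) \<Longrightarrow> colouring_sf V P = colouring_sf V Q"
  by (simp add: colouring_sf_def colourings_with_def cong: conj_cong)

lemma coeff_colouring_sf_nonzero_iff:
  assumes "finite V"
  shows "coeff (colouring_sf V P) M \<noteq> 0 \<longleftrightarrow> colourings_with V P M \<noteq> {}"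
  using finite_colourings_with[OF assms, of P M] by (simp add: coeff_colouring_sf)

lemma homogeneous_colouring_sf: "finite V \<Longrightarrow> homogeneous (card V) (colouring_sf V P)"
  by (auto simp: homogeneous_def coeff_colouring_sf_nonzero_iff colourings_with_def)

lemma colouring_sf_split:
  assumes "finite V"
  shows "colouring_sf V P = colouring_sf V (\<lambda>\<kappa>. P \<kappa> \<and> Q \<kappa>) + colouring_sf V (\<lambda>\<kappa>. P \<kappa> \<and> \<not> Q \<kappa>)"
proof (rule mseries_eqI)
  fix M
  have "colourings_with V P M = colourings_with V (\<lambda>\<kappa>. P \<kappa> \<and> Q \<kappa>) M \<union> colourings_with V (\<lambda>\<kappa>. P \<kappa> \<and> \<not> Q \<kappa>) M"
    by (auto simp: colourings_with_def)
  moreover have "colourings_with V (\<lambda>\<kappa>. P \<kappa> \<and> Q \<kappa>) M \<inter> colourings_with V (\<lambda>\<kappa>. P \<kappa> \<and> \<not> Q \<kappa>) M = {}"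
    by (auto simp: colourings_with_def)
  ultimately show "coeff (colouring_sf V P) M
      = coeff (colouring_sf V (\<lambda>\<kappa>. P \<kappa> \<and> Q \<kappa>) + colouring_sf V (\<lambda>\<kappa>. P \<kappa> \<and> \<not> Q \<kappa>)) M"
    by (simp add: coeff_colouring_sf card_Un_disjoint finite_colourings_with[OF assms])
qed

text \<open>Renaming vertices leaves the multiset of colours unchanged. This serves both the shift
  of a path and the symmetry of a clique.\<close>

lemma colouring_sf_reindex:
  assumes \<pi>: "bij_betw \<pi> V W"
    and PQ: "\<And>\<kappa>. \<kappa> \<in> extensional W \<Longrightarrow> Q \<kappa> \<longleftrightarrow> P (restrict (\<lambda>v. \<kappa> (\<pi> v)) V)"
  shows "colouring_sf W Q = colouring_sf V P"
proof (rule mseries_eqI)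
  fix M
  let ?r = "\<lambda>\<kappa>. restrict (\<lambda>v. \<kappa> (\<pi> v)) V" and ?e = "\<lambda>\<kappa>. restrict (\<lambda>w. \<kappa> (inv_into V \<pi> w)) W"
  have inj: "inj_on \<pi> V" and img: "\<pi> ` V = W" using \<pi> by (auto simp: bij_betw_def)
  have content: "image_mset (?r \<kappa>) (mset_set V) = image_mset \<kappa> (mset_set W)" for \<kappa>
  proof -
    have "image_mset (?r \<kappa>) (mset_set V) = image_mset (\<lambda>v. \<kappa> (\<pi> v)) (mset_set V)"
      by (cases "finite V") (auto intro!: image_mset_cong)
    also have "\<dots> = image_mset \<kappa> (image_mset \<pi> (mset_set V))"
      by (simp add: multiset.map_comp comp_def)
    also have "image_mset \<pi> (mset_set V) = mset_set W"
      using image_mset_mset_set[OF inj] img by simp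
    finally show ?thesis .
  qed
  have re: "?r (?e \<kappa>) = \<kappa>" if "\<kappa> \<in> extensional V" for \<kappa> :: "'a \<Rightarrow> nat"
    using that inj img by (auto simp: fun_eq_iff extensional_def)
  have er: "?e (?r \<kappa>) = \<kappa>" if "\<kappa> \<in> extensional W" for \<kappa> :: "'b \<Rightarrow> nat"
    using that img by (auto simp: fun_eq_iff extensional_def inv_into_into f_inv_into_f)
  have "bij_betw ?r (colourings_with W Q M) (colourings_with V P M)"
  proof (rule bij_betw_byWitness[where f' = ?e])
    show "\<forall>\<kappa>\<in>colourings_with W Q M. ?e (?r \<kappa>) = \<kappa>"
      unfolding colourings_with_def by (blast intro: er)
    show "\<forall>\<kappa>\<in>colourings_with V P M. ?r (?e \<kappa>) = \<kappa>"
      unfolding colourings_with_def by (blast intro: re)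
    show "?r ` colourings_with W Q M \<subseteq> colourings_with V P M"
      using PQ content by (auto simp: colourings_with_def)
    show "?e ` colourings_with V P M \<subseteq> colourings_with W Q M"
    proof (intro image_subsetI)
      fix \<kappa> assume \<kappa>: "\<kappa> \<in> colourings_with V P M"
      then have "?r (?e \<kappa>) = \<kappa>" by (intro re) (simp add: colourings_with_def)
      then show "?e \<kappa> \<in> colourings_with W Q M"
        using \<kappa> PQ[of "?e \<kappa>"] content[of "?e \<kappa>"] by (simp add: colourings_with_def)
    qed
  qed
  then show "coeff (colouring_sf W Q) M = coeff (colouring_sf V P) M"
    by (simp add: coeff_colouring_sf bij_betw_same_card)
qed

text \<open>A colouring of the union is a pair of colourings whose contents add; grouping the pairs
  by their two contents is the convolution defining the product of series.\<close>

lemma colouring_sf_disjoint_union: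
  assumes fin: "finite V" "finite W" and disj: "V \<inter> W = {}"
    and R: "\<And>\<kappa>. R \<kappa> \<longleftrightarrow> P (restrict \<kappa> V) \<and> Q (restrict \<kappa> W)"
  shows "colouring_sf (V \<union> W) R = colouring_sf V P * colouring_sf W Q"
proof (rule mseries_eqI)
  fix M
  let ?S = "{p :: nat multiset \<times> nat multiset. fst p + snd p = M}"
  let ?C = "\<lambda>p. colourings_with V P (fst p) \<times> colourings_with W Q (snd p)"
  let ?c = "\<lambda>U \<kappa>. image_mset \<kappa> (mset_set U)"
  let ?r = "\<lambda>\<kappa>. ((?c V \<kappa>, ?c W \<kappa>), (restrict \<kappa> V, restrict \<kappa> W))"
  let ?e = "\<lambda>(p :: nat multiset \<times> nat multiset, \<kappa>1, \<kappa>2) v.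
    if v \<in> V then \<kappa>1 v else if v \<in> W then \<kappa>2 v else undefined"
  have S: "?S = {(A, B). A + B = M}" by auto
  have finS: "finite ?S" unfolding S by (rule finite_mset_splits)
  have cong: "?c U \<kappa> = ?c U \<kappa>'" if "finite U" "\<And>v. v \<in> U \<Longrightarrow> \<kappa> v = \<kappa>' v" for U and \<kappa> \<kappa>' :: "'a \<Rightarrow> nat"
    by (rule image_mset_cong) (use that in auto)
  have union: "?c (V \<union> W) \<kappa> = ?c V \<kappa> + ?c W \<kappa>" for \<kappa> :: "'a \<Rightarrow> nat"
    using fin disj by (simp add: mset_set_Union)
  have "bij_betw ?r (colourings_with (V \<union> W) R M) (Sigma ?S ?C)"
  proof (rule bij_betw_byWitness[where f' = ?e])
    show "\<forall>\<kappa>\<in>colourings_with (V \<union> W) R M. ?e (?r \<kappa>) = \<kappa>"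
      by (auto simp: colourings_with_def extensional_def fun_eq_iff)
    show "\<forall>q\<in>Sigma ?S ?C. ?r (?e q) = q"
    proof
      fix q assume "q \<in> Sigma ?S ?C"
      then obtain A B \<kappa>1 \<kappa>2 where q: "q = ((A, B), \<kappa>1, \<kappa>2)" "A + B = M"
        "\<kappa>1 \<in> extensional V" "?c V \<kappa>1 = A" "\<kappa>2 \<in> extensional W" "?c W \<kappa>2 = B"
        by (auto simp: colourings_with_def)
      have "?c V (?e q) = A" using q(4) fin(1) by (subst cong[of V _ \<kappa>1]) (auto simp: q(1))
      moreover have "?c W (?e q) = B"
        using q(6) fin(2) disj by (subst cong[of W _ \<kappa>2]) (auto simp: q(1))
      moreover have "restrict (?e q) V = \<kappa>1" using q(3) by (auto simp: q(1) fun_eq_iff extensional_def)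
      moreover have "restrict (?e q) W = \<kappa>2" using q(5) disj by (auto simp: q(1) fun_eq_iff extensional_def)
      ultimately show "?r (?e q) = q" by (simp only: q(1))
    qed
    show "?r ` colourings_with (V \<union> W) R M \<subseteq> Sigma ?S ?C"
    proof (intro image_subsetI)
      fix \<kappa> assume "\<kappa> \<in> colourings_with (V \<union> W) R M"
      then have "R \<kappa>" "?c V \<kappa> + ?c W \<kappa> = M" by (auto simp: colourings_with_def union)
      moreover have "?c V (restrict \<kappa> V) = ?c V \<kappa>" "?c W (restrict \<kappa> W) = ?c W \<kappa>"
        using fin by (auto intro!: cong)
      ultimately show "?r \<kappa> \<in> Sigma ?S ?C" using R by (simp add: colourings_with_def)
    qed
    show "?e ` Sigma ?S ?C \<subseteq> colourings_with (V \<union> W) R M"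
    proof (intro image_subsetI)
      fix q assume "q \<in> Sigma ?S ?C"
      then obtain A B \<kappa>1 \<kappa>2 where q: "q = ((A, B), \<kappa>1, \<kappa>2)" "A + B = M"
        "\<kappa>1 \<in> extensional V" "P \<kappa>1" "?c V \<kappa>1 = A" "\<kappa>2 \<in> extensional W" "Q \<kappa>2" "?c W \<kappa>2 = B"
        by (auto simp: colourings_with_def)
      have "?c V (?e q) = A" using q(5) fin(1) by (subst cong[of V _ \<kappa>1]) (auto simp: q(1))
      moreover have "?c W (?e q) = B"
        using q(8) fin(2) disj by (subst cong[of W _ \<kappa>2]) (auto simp: q(1))
      moreover have "restrict (?e q) V = \<kappa>1" using q(3) by (auto simp: q(1) fun_eq_iff extensional_def)
      moreover have "restrict (?e q) W = \<kappa>2" using q(6) disj by (auto simp: q(1) fun_eq_iff extensional_def)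
      moreover have "?e q \<in> extensional (V \<union> W)" by (auto simp: q(1) extensional_def)
      ultimately show "?e q \<in> colourings_with (V \<union> W) R M"
        using R[of "?e q"] q(2,4,7) union[of "?e q"] by (simp only: colourings_with_def mem_Collect_eq simp_thms)
    qed
  qed
  then have "card (colourings_with (V \<union> W) R M) = (\<Sum>p\<in>?S. card (?C p))"
    using finS by (subst card_SigmaI[symmetric]) (auto simp: bij_betw_same_card finite_colourings_with fin)
  then show "coeff (colouring_sf (V \<union> W) R) M = coeff (colouring_sf V P * colouring_sf W Q) M"
    by (simp add: coeff_mult S[symmetric] case_prod_unfold coeff_colouring_sf card_cartesian_product)
qed

lemma chromatic_sf_eq:
  "chromatic_sf G = colouring_sf (verts G) (\<lambda>\<kappa>. \<forall>u v. u \<noteq> v \<and> {u, v} \<in> edges G \<longrightarrow> \<kappa> u \<noteq> \<kappa> v)"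
  unfolding chromatic_sf_def colouring_sf_def colourings_with_def proper_colourings_def
  by (intro arg_cong[of _ _ MSeries] ext arg_cong[of _ _ of_nat] arg_cong[of _ _ card]) auto

section \<open>Lollipop graphs\<close>

text \<open>Properness with the joining edge left out, because the recurrence varies exactly the
  edges between clique and path; N is the total number of vertices.\<close>

definition clique_path_proper :: "nat \<Rightarrow> nat \<Rightarrow> (nat \<Rightarrow> nat) \<Rightarrow> bool" where
  "clique_path_proper m N \<kappa> \<longleftrightarrow>
    (\<forall>i j. i < j \<and> j < m \<longrightarrow> \<kappa> i \<noteq> \<kappa> j) \<and> (\<forall>i. m \<le> i \<and> Suc i < N \<longrightarrow> \<kappa> i \<noteq> \<kappa> (Suc i))"

lemma chromatic_sf_lollipop:
  "chromatic_sf (lollipop m n) = colouring_sf {0..<m + n}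
    (\<lambda>\<kappa>. clique_path_proper m (m + n) \<kappa> \<and> (0 < m \<and> 0 < n \<longrightarrow> \<kappa> (m - 1) \<noteq> \<kappa> m))"
proof -
  have "(\<forall>u v. u \<noteq> v \<and> {u, v} \<in> edges (lollipop m n) \<longrightarrow> \<kappa> u \<noteq> \<kappa> v)
      \<longleftrightarrow> clique_path_proper m (m + n) \<kappa> \<and> (0 < m \<and> 0 < n \<longrightarrow> \<kappa> (m - 1) \<noteq> \<kappa> m)" (is "?L \<longleftrightarrow> ?R") for \<kappa>
  proof
    assume L: ?L
    have 1: "\<kappa> i \<noteq> \<kappa> j" if "i < j" "j < m" for i j
      using that by (intro L[rule_format]) (auto simp: lollipop_def)
    have 2: "\<kappa> i \<noteq> \<kappa> (Suc i)" if "m \<le> i" "Suc i < m + n" for i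
      using that by (intro L[rule_format]) (auto simp: lollipop_def)
    have 3: "\<kappa> (m - 1) \<noteq> \<kappa> m" if "0 < m" "0 < n"
      using that by (intro L[rule_format]) (auto simp: lollipop_def)
    show ?R using 1 2 3 unfolding clique_path_proper_def by blast
  next
    assume R: ?R
    show ?L
    proof (intro allI impI, elim conjE)
      fix u v assume "u \<noteq> v" "{u, v} \<in> edges (lollipop m n)"
      then consider i j where "{u, v} = {i, j}" "i < j" "j < m"
        | i where "{u, v} = {i, Suc i}" "m \<le> i" "Suc i < m + n"
        | "{u, v} = {m - 1, m}" "0 < m" "0 < n"
        by (auto simp: lollipop_def split: if_splits)
      then show "\<kappa> u \<noteq> \<kappa> v"
      proof cases
        case (1 i j)
        then have "\<kappa> i \<noteq> \<kappa> j" using R unfolding clique_path_proper_def by blast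
        with 1(1) show ?thesis by (auto simp: doubleton_eq_iff)
      next
        case (2 i)
        then have "\<kappa> i \<noteq> \<kappa> (Suc i)" using R unfolding clique_path_proper_def by blast
        with 2(1) show ?thesis by (auto simp: doubleton_eq_iff)
      next
        case 3
        then have "\<kappa> (m - 1) \<noteq> \<kappa> m" using R by blast
        with 3(1) show ?thesis by (auto simp: doubleton_eq_iff)
      qed
    qed
  qed
  then show ?thesis by (simp add: chromatic_sf_eq lollipop_def[of m n])
qed

lemma distinct_below_iff_inj_on:
  "(\<forall>i j. i < j \<and> j < m \<longrightarrow> \<kappa> i \<noteq> \<kappa> j) \<longleftrightarrow> inj_on \<kappa> {0..<m :: nat}" (is "?L \<longleftrightarrow> ?R")
proof
  assume ?L
  then show ?R by (auto simp: inj_on_def) (metis linorder_neqE_nat)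
next
  assume ?R
  then show ?L using inj_onD[of \<kappa> "{0..<m}"] by fastforce
qed

lemma chromatic_sf_lollipop_0: "chromatic_sf (lollipop m 0) = colouring_sf {0..<m} (\<lambda>\<kappa>. inj_on \<kappa> {0..<m})"
proof -
  have "clique_path_proper m m \<kappa> \<longleftrightarrow> inj_on \<kappa> {0..<m}" for \<kappa>
    unfolding clique_path_proper_def distinct_below_iff_inj_on by auto
  then show ?thesis by (simp add: chromatic_sf_lollipop)
qed

text \<open>Colourings of a clique are injections, so a content consists of N distinct colours and
  is attained by each of their N! arrangements.\<close>

lemma chromatic_sf_complete: "chromatic_sf (lollipop N 0) = fact N *\<^sub>Q elementary N"
proof (rule mseries_eqI)
  fix M
  let ?C = "colourings_with {0..<N} (\<lambda>\<kappa>. inj_on \<kappa> {0..<N}) M"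
  show "coeff (chromatic_sf (lollipop N 0)) M = coeff (fact N *\<^sub>Q elementary N) M"
  proof (cases "size M = N \<and> (\<forall>i. count M i \<le> 1)")
    case False
    have "?C = {}"
    proof (rule equals0I)
      fix \<kappa> assume "\<kappa> \<in> ?C"
      then have "inj_on \<kappa> {0..<N}" "M = image_mset \<kappa> (mset_set {0..<N})" by (auto simp: colourings_with_def)
      then have "M = mset_set (\<kappa> ` {0..<N})" "card (\<kappa> ` {0..<N}) = N"
        by (simp_all add: image_mset_mset_set card_image)
      then show False using False by (auto simp: count_mset_set' split: if_splits)
    qed
    then show ?thesis using False by (auto simp: chromatic_sf_lollipop_0 coeff_colouring_sf coeff_elementary)
  next
    case True
    have M: "mset_set (set_mset M) = M"
    proof (rule multiset_eqI)
      fix i show "count (mset_set (set_mset M)) i = count M i"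
        using True[THEN conjunct2, rule_format, of i] by (auto simp: count_mset_set' le_Suc_eq count_eq_zero_iff)
    qed
    then have card: "card (set_mset M) = N" using True by (metis size_mset_set)
    have "?C = {f \<in> {0..<N} \<rightarrow>\<^sub>E set_mset M. inj_on f {0..<N}}"
    proof (intro set_eqI iffI)
      fix f assume "f \<in> ?C"
      then show "f \<in> {f \<in> {0..<N} \<rightarrow>\<^sub>E set_mset M. inj_on f {0..<N}}"
        by (auto simp: colourings_with_def PiE_def)
    next
      fix f assume "f \<in> {f \<in> {0..<N} \<rightarrow>\<^sub>E set_mset M. inj_on f {0..<N}}"
      then have f: "f \<in> {0..<N} \<rightarrow>\<^sub>E set_mset M" "inj_on f {0..<N}" by auto
      then have "f ` {0..<N} = set_mset M"
        using card by (intro card_subset_eq) (auto simp: card_image PiE_def)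
      then have "image_mset f (mset_set {0..<N}) = M" using M f(2) by (simp add: image_mset_mset_set)
      then show "f \<in> ?C" using f by (auto simp: colourings_with_def PiE_def)
    qed
    then have "card ?C = card (set_mset M) ^ (card {0..<N} - card {0..<N})
        * prod ((-) (card (set_mset M))) {0..<card {0..<N}}"
      using card_inj_on_subset_funcset[of "{0..<N}" "set_mset M" "{0..<N}"] by simp
    also have "\<dots> = fact N" by (simp add: card fact_prod_rev)
    finally show ?thesis
      using True by (simp add: chromatic_sf_lollipop_0 coeff_colouring_sf coeff_elementary)
  qed
qed

text \<open>Cliques on at most two vertices are paths. With the chosen labelling this gives equality
  of graphs depending on m + n alone.\<close>

lemma lollipop_le_2:
  assumes "m \<le> 2"
  shows "lollipop m n = \<lparr>verts = {0..<m + n}, edges = {{i, Suc i} | i. Suc i < m + n}\<rparr>"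
proof -
  have "edges (lollipop m n) = {{i, Suc i} | i. Suc i < m + n}"
  proof (intro set_eqI iffI)
    fix e assume "e \<in> edges (lollipop m n)"
    then consider i j where "e = {i, j}" "i < j" "j < m"
      | i where "e = {i, Suc i}" "Suc i < m + n"
      | "e = {m - 1, m}" "0 < m" "0 < n"
      by (auto simp: lollipop_def split: if_splits)
    then show "e \<in> {{i, Suc i} | i. Suc i < m + n}"
    proof cases
      case 1
      then have "e = {i, Suc i}" "Suc i < m + n" using assms by auto
      then show ?thesis by blast
    next
      case 2
      then show ?thesis by blast
    next
      case 3
      then have "e = {m - 1, Suc (m - 1)}" "Suc (m - 1) < m + n" by auto
      then show ?thesis by blast
    qed
  next
    fix e assume "e \<in> {{i, Suc i} | i. Suc i < m + n}"
    then obtain i where i: "e = {i, Suc i}" "Suc i < m + n" by blast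
    consider "m \<le> i" | "Suc i < m" | "Suc i = m" by linarith
    then show "e \<in> edges (lollipop m n)"
      by cases (use i in \<open>auto simp: lollipop_def\<close>)
  qed
  then show ?thesis by (simp add: lollipop_def)
qed

text \<open>The three graphs \<open>L\<^bsub>m,n\<^esub>\<close>, \<open>L\<^bsub>m+1,n-1\<^esub>\<close> and \<open>K\<^sub>m + P\<^sub>n\<close> differ only in how many vertices of the
  clique are joined to the first vertex \<open>m\<close> of the path, namely 1, \<open>m\<close> and 0. In a proper colouring
  of \<open>K\<^sub>m + P\<^sub>n\<close>, vertex \<open>m\<close> shares its colour with at most one clique vertex \<open>j\<close>; the colourings
  where it does have a generating function \<open>Z\<close> independent of \<open>j\<close>, by symmetry.\<close>

lemma lollipop_recurrence:
  assumes m: "1 \<le> m" and n: "1 \<le> n"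
  shows "of_nat m *\<^sub>Q chromatic_sf (lollipop m n) = chromatic_sf (lollipop (Suc m) (n - 1))
    + of_nat (m - 1) *\<^sub>Q (chromatic_sf (lollipop m 0) * chromatic_sf (lollipop 0 n))"
proof -
  define V where "V = {0..<m + n}"
  define B where "B = clique_path_proper m (m + n)"
  define Z where "Z j = colouring_sf V (\<lambda>\<kappa>. B \<kappa> \<and> \<kappa> j = \<kappa> m)" for j
  let ?T = "colouring_sf V B"
  have fin: "finite V" by (simp add: V_def)
  have Z_eq: "Z j = Z (m - 1)" if j: "j < m" for j
    unfolding Z_def
  proof (rule colouring_sf_reindex)
    \<comment> \<open>The transposition of the clique vertices j and m - 1, which leaves the path
      fixed and permutes the clique.\<close>
    let ?t = "\<lambda>v. if v = j then m - 1 else if v = m - 1 then j else v"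
    show "bij_betw ?t V V"
      using j by (intro bij_betw_byWitness[where f' = ?t]) (auto simp: V_def)
    fix \<kappa> :: "nat \<Rightarrow> nat" assume "\<kappa> \<in> extensional V"
    let ?\<kappa> = "restrict (\<lambda>v. \<kappa> (?t v)) V"
    have eq: "?\<kappa> v = \<kappa> (?t v)" if "v < m + n" for v using that by (simp add: V_def)
    have fixed: "?t v = v" if "m \<le> v" for v using that j by auto
    have "inj_on ?\<kappa> {0..<m} \<longleftrightarrow> inj_on \<kappa> {0..<m}"
    proof -
      have "inj_on ?\<kappa> {0..<m} \<longleftrightarrow> inj_on (\<kappa> \<circ> ?t) {0..<m}"
        using eq by (intro inj_on_cong) auto
      also have "\<dots> \<longleftrightarrow> inj_on \<kappa> (?t ` {0..<m})"
        by (rule comp_inj_on_iff[symmetric]) (auto simp: inj_on_def split: if_splits)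
      also have "?t ` {0..<m} = {0..<m}"
        by (rule bij_betw_imp_surj_on, rule bij_betw_byWitness[where f' = ?t]) (use j in auto)
      finally show ?thesis .
    qed
    moreover have "(\<forall>i. m \<le> i \<and> Suc i < m + n \<longrightarrow> ?\<kappa> i \<noteq> ?\<kappa> (Suc i))
        \<longleftrightarrow> (\<forall>i. m \<le> i \<and> Suc i < m + n \<longrightarrow> \<kappa> i \<noteq> \<kappa> (Suc i))"
      using eq fixed by auto
    ultimately have "B \<kappa> \<longleftrightarrow> B ?\<kappa>" by (simp only: B_def clique_path_proper_def distinct_below_iff_inj_on)
    moreover have "\<kappa> j = \<kappa> m \<longleftrightarrow> ?\<kappa> (m - 1) = ?\<kappa> m"
      using eq[of m] eq[of "m - 1"] fixed[of m] j n by simp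
    ultimately show "(B \<kappa> \<and> \<kappa> j = \<kappa> m) \<longleftrightarrow> (B ?\<kappa> \<and> ?\<kappa> (m - 1) = ?\<kappa> m)" by simp
  qed
  have one: "?T = Z (m - 1) + chromatic_sf (lollipop m n)"
  proof -
    have "chromatic_sf (lollipop m n) = colouring_sf V (\<lambda>\<kappa>. B \<kappa> \<and> \<not> \<kappa> (m - 1) = \<kappa> m)"
      using m n by (simp add: chromatic_sf_lollipop V_def B_def)
    then show ?thesis using colouring_sf_split[OF fin, of B "\<lambda>\<kappa>. \<kappa> (m - 1) = \<kappa> m"] by (simp add: Z_def)
  qed
  have "?T = (\<Sum>j<k. Z j) + colouring_sf V (\<lambda>\<kappa>. B \<kappa> \<and> (\<forall>j<k. \<kappa> j \<noteq> \<kappa> m))" if "k \<le> m" for k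
    using that
  proof (induction k)
    case 0
    then show ?case by simp
  next
    case (Suc k)
    let ?Q = "\<lambda>\<kappa>. B \<kappa> \<and> (\<forall>j<k. \<kappa> j \<noteq> \<kappa> m)"
    have "colouring_sf V (\<lambda>\<kappa>. ?Q \<kappa> \<and> \<kappa> k = \<kappa> m) = Z k"
      unfolding Z_def
    proof (rule colouring_sf_cong)
      fix \<kappa> :: "nat \<Rightarrow> nat"
      \<comment> \<open>Clique colours are distinct, so agreement of m with k already excludes
        agreement with earlier vertices, and the classes are disjoint.\<close>
      have "\<kappa> j \<noteq> \<kappa> k" if "B \<kappa>" "j < k" for j
        using that Suc.prems by (simp add: B_def clique_path_proper_def)
      then show "?Q \<kappa> \<and> \<kappa> k = \<kappa> m \<longleftrightarrow> B \<kappa> \<and> \<kappa> k = \<kappa> m" by metis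
    qed
    moreover have "(\<lambda>\<kappa>. ?Q \<kappa> \<and> \<not> \<kappa> k = \<kappa> m) = (\<lambda>\<kappa>. B \<kappa> \<and> (\<forall>j<Suc k. \<kappa> j \<noteq> \<kappa> m))"
      by (auto simp: less_Suc_eq)
    ultimately show ?case
      using Suc colouring_sf_split[OF fin, of ?Q "\<lambda>\<kappa>. \<kappa> k = \<kappa> m"] by (simp add: add.assoc)
  qed
  from this[of m] have "?T = (\<Sum>j<m. Z j) + colouring_sf V (\<lambda>\<kappa>. B \<kappa> \<and> (\<forall>j<m. \<kappa> j \<noteq> \<kappa> m))"
    by simp
  also have "(\<Sum>j<m. Z j) = (\<Sum>j<m. Z (m - 1))" by (intro sum.cong refl Z_eq) simp
  also have "colouring_sf V (\<lambda>\<kappa>. B \<kappa> \<and> (\<forall>j<m. \<kappa> j \<noteq> \<kappa> m)) = chromatic_sf (lollipop (Suc m) (n - 1))"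
  proof -
    have V: "{0..<Suc m + (n - 1)} = V" using n by (simp add: V_def)
    show ?thesis
      unfolding chromatic_sf_lollipop V
    proof (rule colouring_sf_cong)
      fix \<kappa> :: "nat \<Rightarrow> nat"
      have "B \<kappa> \<and> (\<forall>j<m. \<kappa> j \<noteq> \<kappa> m) \<longleftrightarrow> (\<forall>i j. i < j \<and> j < Suc m \<longrightarrow> \<kappa> i \<noteq> \<kappa> j) \<and>
          (\<forall>i. m \<le> i \<and> Suc i < m + n \<longrightarrow> \<kappa> i \<noteq> \<kappa> (Suc i))"
        unfolding B_def clique_path_proper_def less_Suc_eq by blast
      \<comment> \<open>Once vertex m joins the clique, the first edge of the old path becomes the
        new joining edge, present only for n > 1.\<close>
      also have "(\<forall>i. m \<le> i \<and> Suc i < m + n \<longrightarrow> \<kappa> i \<noteq> \<kappa> (Suc i)) \<longleftrightarrow>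
          (\<forall>i. Suc m \<le> i \<and> Suc i < m + n \<longrightarrow> \<kappa> i \<noteq> \<kappa> (Suc i)) \<and> (1 < n \<longrightarrow> \<kappa> m \<noteq> \<kappa> (Suc m))"
        (is "?L \<longleftrightarrow> ?R")
      proof
        assume ?L
        then show ?R by simp
      next
        assume R: ?R
        show ?L
        proof (intro allI impI)
          fix i assume "m \<le> i \<and> Suc i < m + n"
          then show "\<kappa> i \<noteq> \<kappa> (Suc i)" using R by (cases "i = m") auto
        qed
      qed
      finally show "B \<kappa> \<and> (\<forall>j<m. \<kappa> j \<noteq> \<kappa> m) \<longleftrightarrow> clique_path_proper (Suc m) (Suc m + (n - 1)) \<kappa> \<and>
          (0 < Suc m \<and> 0 < n - 1 \<longrightarrow> \<kappa> (Suc m - 1) \<noteq> \<kappa> (Suc m))"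
        using n by (simp add: clique_path_proper_def)
    qed
  qed
  finally have two: "?T = of_nat m *\<^sub>Q Z (m - 1) + chromatic_sf (lollipop (Suc m) (n - 1))"
    by (simp add: mseries.sum_constant_scale del: sum_constant)
  have T: "?T = chromatic_sf (lollipop m 0) * chromatic_sf (lollipop 0 n)"
  proof -
    let ?P = "clique_path_proper m m" and ?Q = "\<lambda>\<kappa>. \<forall>i. m \<le> i \<and> Suc i < m + n \<longrightarrow> \<kappa> i \<noteq> \<kappa> (Suc i)"
    have "colouring_sf ({0..<m} \<union> {m..<m + n}) B = colouring_sf {0..<m} ?P * colouring_sf {m..<m + n} ?Q"
      by (rule colouring_sf_disjoint_union) (auto simp: B_def clique_path_proper_def)
    moreover have "{0..<m} \<union> {m..<m + n} = V" by (auto simp: V_def)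
    moreover have "colouring_sf {m..<m + n} ?Q = colouring_sf {0..<n} (clique_path_proper 0 n)"
    proof (rule colouring_sf_reindex[where \<pi> = "\<lambda>i. i + m"])
      show "bij_betw (\<lambda>i. i + m) {0..<n} {m..<m + n}"
        by (rule bij_betw_byWitness[where f' = "\<lambda>i. i - m"]) auto
      fix \<kappa> :: "nat \<Rightarrow> nat"
      show "?Q \<kappa> \<longleftrightarrow> clique_path_proper 0 n (restrict (\<lambda>v. \<kappa> (v + m)) {0..<n})"
      proof
        assume "?Q \<kappa>"
        then show "clique_path_proper 0 n (restrict (\<lambda>v. \<kappa> (v + m)) {0..<n})"
          by (auto simp: clique_path_proper_def)
      next
        assume R: "clique_path_proper 0 n (restrict (\<lambda>v. \<kappa> (v + m)) {0..<n})"
        show "?Q \<kappa>"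
        proof (intro allI impI)
          fix i assume "m \<le> i \<and> Suc i < m + n"
          moreover from this have "Suc (i - m) < n" by linarith
          ultimately show "\<kappa> i \<noteq> \<kappa> (Suc i)"
            using R[unfolded clique_path_proper_def, THEN conjunct2, rule_format, of "i - m"]
            by (auto simp: Suc_diff_le)
        qed
      qed
    qed
    ultimately show ?thesis by (simp add: chromatic_sf_lollipop)
  qed
  \<comment> \<open>Elimination of Z from \<open>one\<close> and \<open>two\<close>, which express
    the same total with Z taken once and m times.\<close>
  have "of_nat m *\<^sub>Q chromatic_sf (lollipop m n) = of_nat m *\<^sub>Q ?T - of_nat m *\<^sub>Q Z (m - 1)"
    by (simp add: one mseries.scale_right_distrib)
  also have "\<dots> = chromatic_sf (lollipop (Suc m) (n - 1)) + (of_nat m - 1) *\<^sub>Q ?T"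
    by (simp add: mseries.scale_left_diff_distrib) (simp add: two)
  finally show ?thesis using m by (simp add: T of_nat_diff)
qed

section \<open>Positivity of lollipop graphs\<close>

definition lower_monoms :: "nat \<Rightarrow> mseries set" where
  "lower_monoms N = monom elementary ` {M \<in> pos_msets_of N. \<forall>k\<in>#M. k < N}"

text \<open>Plain e-positivity would allow the coefficient of e_N to vanish; its strict positivity
  is what makes the family triangular.\<close>

definition e_positive_lead :: "nat \<Rightarrow> mseries \<Rightarrow> bool" where
  "e_positive_lead N f \<longleftrightarrow> (\<exists>c g. 0 < c \<and> g \<in> cone (lower_monoms N) \<and> f = c *\<^sub>Q elementary N + g)"

lemma e_positive_lead_in_cone:
  assumes "1 \<le> N" "e_positive_lead N f"
  shows "f \<in> cone (monom elementary ` pos_msets_of N)"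
proof -
  from assms(2) obtain c g where f: "0 < c" "g \<in> cone (lower_monoms N)" "f = c *\<^sub>Q elementary N + g"
    unfolding e_positive_lead_def by blast
  have "monom elementary {#N#} \<in> cone (monom elementary ` pos_msets_of N)"
    by (intro cone_base imageI pos_msets_of_single assms(1))
  moreover have "cone (lower_monoms N) \<subseteq> cone (monom elementary ` pos_msets_of N)"
    unfolding lower_monoms_def by (intro cone_mono) auto
  ultimately show ?thesis using f by (auto intro!: cone_add cone_scale)
qed

text \<open>Parts of a product come from one of the factors, and both factors have positive degree,
  so no part reaches a + b.\<close>

lemma mult_in_cone_lower_monoms:
  assumes "f \<in> cone (monom elementary ` pos_msets_of a)" "g \<in> cone (monom elementary ` pos_msets_of b)"
    and "1 \<le> a" "1 \<le> b"
  shows "f * g \<in> cone (lower_monoms (a + b))"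
  using assms(1,2)
proof (rule cone_mult)
  fix s t assume "s \<in> monom elementary ` pos_msets_of a" "t \<in> monom elementary ` pos_msets_of b"
  then obtain A B where AB: "A \<in> pos_msets_of a" "B \<in> pos_msets_of b" "s * t = monom elementary (A + B)"
    by (auto simp: monom_union)
  have "k < a + b" if "k \<in># A + B" for k
  proof -
    have "k \<le> a \<or> k \<le> b"
      using that AB mem_le_sum_mset[of k A] mem_le_sum_mset[of k B] by (auto simp: pos_msets_of_def)
    then show ?thesis using assms(3,4) by auto
  qed
  with AB have "s * t \<in> lower_monoms (a + b)"
    unfolding lower_monoms_def by (auto intro!: imageI pos_msets_of_add)
  then show "s * t \<in> cone (lower_monoms (a + b))" by (rule cone_base)
qed

text \<open>For fixed N the recurrence trades path vertices for clique vertices until K_N is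
  reached; the outer induction supplies positivity of the smaller clique and path in the product
  term. That term has no e_N, so the leading coefficient is merely divided by m.\<close>

lemma e_positive_lead_lollipop:
  "m + n = N \<Longrightarrow> 1 \<le> N \<Longrightarrow> e_positive_lead N (chromatic_sf (lollipop m n))"
proof (induction N arbitrary: m n rule: less_induct)
  case (less N)
  have pos: "e_positive_lead N (chromatic_sf (lollipop m n))" if "1 \<le> m" "m + n = N" for m n
    using that
  proof (induction n arbitrary: m)
    case 0
    have "(0 :: mseries) \<in> cone (lower_monoms N)" by (rule cone.zero)
    moreover have "chromatic_sf (lollipop m 0) = fact N *\<^sub>Q elementary N + 0"
      using 0 by (simp add: chromatic_sf_complete)
    moreover have "(0 :: rat) < fact N" by simp
    ultimately show ?case unfolding e_positive_lead_def by blast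
  next
    case (Suc n)
    have "e_positive_lead N (chromatic_sf (lollipop (Suc m) n))" using Suc by simp
    then obtain c g where cg: "0 < c" "g \<in> cone (lower_monoms N)"
      "chromatic_sf (lollipop (Suc m) n) = c *\<^sub>Q elementary N + g"
      unfolding e_positive_lead_def by blast
    let ?h = "chromatic_sf (lollipop m 0) * chromatic_sf (lollipop 0 (Suc n))"
    have h: "?h \<in> cone (lower_monoms N)"
      using mult_in_cone_lower_monoms[OF
          e_positive_lead_in_cone[OF _ less.IH[of m m 0]]
          e_positive_lead_in_cone[OF _ less.IH[of "Suc n" 0 "Suc n"]]] Suc.prems by simp
    have m: "(of_nat m :: rat) > 0" using Suc.prems by simp
    have "chromatic_sf (lollipop m (Suc n)) = (1 / of_nat m) *\<^sub>Q (of_nat m *\<^sub>Q chromatic_sf (lollipop m (Suc n)))"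
      using m by simp
    also have "of_nat m *\<^sub>Q chromatic_sf (lollipop m (Suc n)) = c *\<^sub>Q elementary N + g + of_nat (m - 1) *\<^sub>Q ?h"
      using lollipop_recurrence[of m "Suc n"] Suc.prems cg(3) by simp
    also have "(1 / of_nat m) *\<^sub>Q \<dots> = (c / of_nat m) *\<^sub>Q elementary N
        + ((1 / of_nat m) *\<^sub>Q (g + of_nat (m - 1) *\<^sub>Q ?h))"
      by (simp add: mseries.scale_right_distrib add.assoc)
    finally have eq: "chromatic_sf (lollipop m (Suc n)) = (c / of_nat m) *\<^sub>Q elementary N
        + ((1 / of_nat m) *\<^sub>Q (g + of_nat (m - 1) *\<^sub>Q ?h))" .
    have "(1 / of_nat m) *\<^sub>Q (g + of_nat (m - 1) *\<^sub>Q ?h) \<in> cone (lower_monoms N)"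
      using cg(2) h m by (intro cone_scale cone_add) simp_all
    moreover have "0 < c / of_nat m" using cg(1) m by simp
    ultimately show ?case using eq unfolding e_positive_lead_def by blast
  qed
  show ?case
  proof (cases m)
    \<comment> \<open>The recurrence requires a nonempty clique, so the path is read as a lollipop
      with a one-vertex clique.\<close>
    case 0
    with less.prems obtain n' where n: "n = Suc n'" by (cases n) auto
    have "lollipop m n = lollipop 1 n'" by (simp add: 0 n lollipop_le_2)
    then show ?thesis using pos[of 1 n'] less.prems by (simp add: 0 n)
  next
    case (Suc m')
    then show ?thesis using pos less.prems by simp
  qed
qed

section \<open>Telling lollipop graphs apart\<close>

lemma simple_graph_lollipop: "simple_graph (lollipop m n)"
  by (auto simp: simple_graph_def lollipop_def)

text \<open>Consecutive labels are always adjacent, be it in the clique, in the path or at the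
  joining edge, so every vertex is reachable from 0.\<close>

lemma connected_graph_lollipop:
  assumes "1 \<le> m + n"
  shows "connected_graph (lollipop m n)"
proof -
  let ?R = "{(a, b). {a, b} \<in> edges (lollipop m n)}"
  have edge: "{i, Suc i} \<in> edges (lollipop m n)" if "Suc i < m + n" for i
  proof -
    consider "m \<le> i" | "Suc i < m" | "Suc i = m" by linarith
    then show ?thesis by cases (use that in \<open>auto simp: lollipop_def\<close>)
  qed
  have from_0: "(0, v) \<in> ?R\<^sup>*" if "v < m + n" for v
    using that
  proof (induction v)
    case (Suc v)
    then have "(0, v) \<in> ?R\<^sup>*" "(v, Suc v) \<in> ?R" using edge by auto
    then show ?case by (rule rtrancl_into_rtrancl)
  qed simp
  have "sym ?R" by (auto simp: sym_def insert_commute)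
  then have to_0: "(v, 0) \<in> ?R\<^sup>*" if "v < m + n" for v
    using from_0[OF that] by (meson sym_rtrancl symD)
  have "(u, v) \<in> ?R\<^sup>*" if "u < m + n" "v < m + n" for u v
    using to_0[OF that(1)] from_0[OF that(2)] by (rule rtrancl_trans)
  then show ?thesis
    using assms unfolding connected_graph_def by (auto simp: lollipop_def[of m n])
qed

text \<open>Using each vertex as its own colour is proper and produces a monomial of full
  degree.\<close>

lemma chromatic_sf_lollipop_nonzero:
  "\<exists>M. size M = m + n \<and> coeff (chromatic_sf (lollipop m n)) M \<noteq> 0"
proof -
  let ?\<kappa> = "restrict (\<lambda>v. v) {0..<m + n}" and ?M = "mset_set {0..<m + n}"
  have "image_mset ?\<kappa> ?M = image_mset (\<lambda>v. v) ?M" by (rule image_mset_cong) simp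
  then have "?\<kappa> \<in> colourings_with {0..<m + n} (\<lambda>\<kappa>. clique_path_proper m (m + n) \<kappa> \<and>
      (0 < m \<and> 0 < n \<longrightarrow> \<kappa> (m - 1) \<noteq> \<kappa> m)) ?M"
    by (simp add: colourings_with_def clique_path_proper_def) linarith
  then have "coeff (chromatic_sf (lollipop m n)) ?M \<noteq> 0"
    unfolding chromatic_sf_lollipop by (subst coeff_colouring_sf_nonzero_iff) auto
  moreover have "size ?M = m + n" by simp
  ultimately show ?thesis by blast
qed

lemma homogeneous_chromatic_sf_lollipop: "homogeneous (m + n) (chromatic_sf (lollipop m n))"
  using homogeneous_colouring_sf[of "{0..<m + n}"] by (simp add: chromatic_sf_lollipop)

lemma chromatic_sf_lollipop_eq_imp_size_eq:
  assumes "chromatic_sf (lollipop m n) = chromatic_sf (lollipop m' n')"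
  shows "m + n = m' + n'"
proof -
  from chromatic_sf_lollipop_nonzero obtain M
    where "size M = m + n" "coeff (chromatic_sf (lollipop m n)) M \<noteq> 0" by blast
  then show ?thesis using homogeneous_chromatic_sf_lollipop[of m' n'] assms by (simp add: homogeneous_def)
qed

text \<open>\<open>L\<^bsub>m,n\<^esub>\<close> with \<open>m \<ge> 2\<close> can be coloured with \<open>m\<close> colours, but a larger clique cannot.\<close>

lemma chromatic_sf_lollipop_neq:
  assumes m: "2 \<le> m" "m < m'" and N: "m + n = m' + n'"
  shows "chromatic_sf (lollipop m n) \<noteq> chromatic_sf (lollipop m' n')"
proof -
  let ?V = "{0..<m + n}"
  \<comment> \<open>The path alternates between 0 and 1, starting with 0 next to clique vertex m -
    1. That vertex has colour m - 1, which differs from 0 since m \<ge> 2.\<close>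
  define \<kappa> where "\<kappa> = restrict (\<lambda>v. if v < m then v else if even (v - m) then 0 else 1) ?V"
  define M where "M = image_mset \<kappa> (mset_set ?V)"
  have \<kappa>: "\<kappa> v = (if v < m then v else if even (v - m) then 0 else 1)" if "v < m + n" for v
    using that by (simp add: \<kappa>_def)
  have "\<kappa> i \<noteq> \<kappa> j" if "i < j" "j < m" for i j using that by (simp add: \<kappa>)
  moreover have "\<kappa> i \<noteq> \<kappa> (Suc i)" if "m \<le> i" "Suc i < m + n" for i
    using that by (simp add: \<kappa> Suc_diff_le)
  moreover have "\<kappa> (m - 1) \<noteq> \<kappa> m" if "0 < m \<and> 0 < n"
    using that m by (simp add: \<kappa>)
  ultimately have "\<kappa> \<in> colourings_with ?V (\<lambda>\<kappa>. clique_path_proper m (m + n) \<kappa> \<and>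
      (0 < m \<and> 0 < n \<longrightarrow> \<kappa> (m - 1) \<noteq> \<kappa> m)) M"
    unfolding colourings_with_def clique_path_proper_def M_def \<kappa>_def by auto
  then have nz: "coeff (chromatic_sf (lollipop m n)) M \<noteq> 0"
    unfolding chromatic_sf_lollipop by (subst coeff_colouring_sf_nonzero_iff) auto
  have "\<kappa> v < m" if "v < m + n" for v using that m by (simp add: \<kappa>)
  then have M: "set_mset M \<subseteq> {0..<m}" by (auto simp: M_def)
  have "\<not> clique_path_proper m' (m' + n') \<kappa>'" if "\<kappa>' \<in> extensional ?V" "image_mset \<kappa>' (mset_set ?V) = M" for \<kappa>'
  proof
    assume "clique_path_proper m' (m' + n') \<kappa>'"
    then have inj: "inj_on \<kappa>' {0..<m'}"
      by (simp add: clique_path_proper_def distinct_below_iff_inj_on)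
    have "\<kappa>' ` {0..<m'} \<subseteq> set_mset (image_mset \<kappa>' (mset_set ?V))" using N by auto
    then have "\<kappa>' ` {0..<m'} \<subseteq> {0..<m}" using M that(2) by simp
    then have "card (\<kappa>' ` {0..<m'}) \<le> m" using card_mono[of "{0..<m}"] by fastforce
    then show False using m by (simp add: card_image[OF inj])
  qed
  then have "colourings_with {0..<m' + n'} (\<lambda>\<kappa>. clique_path_proper m' (m' + n') \<kappa> \<and>
      (0 < m' \<and> 0 < n' \<longrightarrow> \<kappa> (m' - 1) \<noteq> \<kappa> m')) M = {}"
    unfolding colourings_with_def N by blast
  then have "coeff (chromatic_sf (lollipop m' n')) M = 0"
    by (simp add: chromatic_sf_lollipop coeff_colouring_sf)
  with nz show ?thesis by auto
qed

lemma lollipop_eq_if_chromatic_sf_eq: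
  assumes eq: "chromatic_sf (lollipop m n) = chromatic_sf (lollipop m' n')"
  shows "lollipop m n = lollipop m' n'"
proof -
  have N: "m + n = m' + n'" using chromatic_sf_lollipop_eq_imp_size_eq[OF eq] .
  show ?thesis
  proof (cases "m + n < 2")
    case True
    then show ?thesis using N by (simp add: lollipop_le_2)
  next
    case False
    \<comment> \<open>Clique sizes 0, 1 and 2 give the same path, so they are normalised to 2; after
      that, different sizes are separated by the chromatic number.\<close>
    define k where "k m = max m 2" for m :: nat
    have norm: "lollipop m n = lollipop (k m) (m + n - k m)" if "2 \<le> m + n" for m n
      using that by (auto simp: k_def max_def lollipop_le_2)
    have "\<not> k m < k m'" "\<not> k m' < k m"
      using chromatic_sf_lollipop_neq[of "k m" "k m'" "m + n - k m" "m' + n' - k m'"]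
        chromatic_sf_lollipop_neq[of "k m'" "k m" "m' + n' - k m'" "m + n - k m"]
        eq norm[of m n] norm[of m' n'] N False by (auto simp: k_def)
    then have "k m = k m'" by simp
    then show ?thesis using norm[of m n] norm[of m' n'] N False by simp
  qed
qed

section \<open>Families of lollipop generators\<close>

locale lollipop_choice =
  fixes m n :: "nat \<Rightarrow> nat"
  assumes size: "\<And>i. 1 \<le> i \<Longrightarrow> m i + n i = i"
begin

definition X :: "nat \<Rightarrow> mseries" where
  "X i = chromatic_sf (lollipop (m i) (n i))"

lemma X_e_positive_lead: "1 \<le> i \<Longrightarrow> e_positive_lead i (X i)"
  using e_positive_lead_lollipop[of "m i" "n i" i] size by (simp add: X_def)

sublocale triangular_generators X
proof
  fix i :: nat assume "1 \<le> i"
  from X_e_positive_lead[OF this] obtain c g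
    where "0 < c" "g \<in> cone (lower_monoms i)" "X i = c *\<^sub>Q elementary i + g"
    unfolding e_positive_lead_def by blast
  moreover from this have "c \<noteq> 0" "g \<in> mseries.span (lower_monoms i)"
    using cone_subset_span by auto
  ultimately show "\<exists>c g. c \<noteq> 0 \<and> g \<in> mseries.span (monom elementary ` {M \<in> pos_msets_of i. \<forall>k\<in>#M. k < i}) \<and>
      X i = c *\<^sub>Q elementary i + g"
    unfolding lower_monoms_def by blast
qed

lemma monom_X_in_cone: "M \<in> pos_msets \<Longrightarrow> monom X M \<in> cone (monom elementary ` pos_msets)"
proof (induction M)
  case empty
  have "monom elementary {#} \<in> cone (monom elementary ` pos_msets)"
    by (intro cone_base imageI) (simp add: pos_msets_def)
  then show ?case by simp
next
  case (add i M)
  then have i: "1 \<le> i" and M: "monom X M \<in> cone (monom elementary ` pos_msets)"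
    by (auto simp: pos_msets_def)
  have "X i \<in> cone (monom elementary ` pos_msets_of i)"
    using e_positive_lead_in_cone[OF i X_e_positive_lead[OF i]] .
  from this M have "X i * monom X M \<in> cone (monom elementary ` pos_msets)"
  proof (rule cone_mult)
    fix s t assume "s \<in> monom elementary ` pos_msets_of i" "t \<in> monom elementary ` pos_msets"
    then obtain A B where "A \<in> pos_msets" "B \<in> pos_msets" "s * t = monom elementary (A + B)"
      by (auto simp: monom_union pos_msets_of_def)
    then show "s * t \<in> cone (monom elementary ` pos_msets)"
      by (intro cone_base) (auto simp: pos_msets_def)
  qed
  then show ?case by simp
qed

lemma positive:
  assumes "f \<in> prod_of_parts X ` partitions"
  shows "e_positive f \<and> schur_positive f"
proof -
  have "e_positive f"
    using assms monom_X_in_cone by (auto simp: e_positive_iff prod_of_parts_image_partitions)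
  then show ?thesis using e_positive_imp_schur_positive by blast
qed

lemma homogeneous_monom_X: "M \<in> pos_msets \<Longrightarrow> homogeneous (sum_mset M) (monom X M)"
proof (induction M)
  case empty
  show ?case by (auto simp: homogeneous_def coeff_1)
next
  case (add i M)
  then have "homogeneous (sum_mset M) (monom X M)" by (auto simp: pos_msets_def)
  moreover have "homogeneous i (X i)"
    using add.prems homogeneous_chromatic_sf_lollipop[of "m i" "n i"] size[of i]
    by (simp add: pos_msets_def X_def)
  ultimately show ?case by (simp add: homogeneous_mult)
qed

end

text \<open>Taking all paths but replacing \<open>P\<^sub>k\<close> by \<open>K\<^sub>k\<close> for \<open>k \<in> S\<close> gives a basis from which \<open>S \<inter> {3..}\<close> can
  be read off: if the basis of \<open>S\<close> contained \<open>X\<^bsub>K\<^sub>k\<^esub>\<close> with \<open>k \<notin> S\<close>, that would be a relation between two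
  distinct monomials in the generators of \<open>insert k S\<close>.\<close>

definition special_graph :: "nat set \<Rightarrow> nat \<Rightarrow> nat sgraph" where
  "special_graph S i = (if i \<in> S then lollipop i 0 else lollipop 0 i)"

definition special_basis :: "nat set \<Rightarrow> mseries set" where
  "special_basis S = prod_of_parts (\<lambda>i. chromatic_sf (special_graph S i)) ` partitions"

lemma lollipop_choice_special: "lollipop_choice (\<lambda>i. if i \<in> S then i else 0) (\<lambda>i. if i \<in> S then 0 else i)"
  by unfold_locales simp

lemma special_X: "lollipop_choice.X (\<lambda>i. if i \<in> S then i else 0) (\<lambda>i. if i \<in> S then 0 else i)
    = (\<lambda>i. chromatic_sf (special_graph S i))"
  by (auto simp: lollipop_choice.X_def[OF lollipop_choice_special] special_graph_def)

text \<open>From k = 3 on, K_k is no longer a path and its chromatic symmetric function differs from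
  that of P_k.\<close>

lemma complete_in_special_basis_imp:
  assumes k: "3 \<le> k" and mem: "chromatic_sf (lollipop k 0) \<in> special_basis S"
  shows "k \<in> S"
proof (rule ccontr)
  assume kS: "k \<notin> S"
  let ?Y = "\<lambda>S i. chromatic_sf (special_graph S i)"
  interpret A: lollipop_choice "\<lambda>i. if i \<in> S then i else 0" "\<lambda>i. if i \<in> S then 0 else i"
    by (rule lollipop_choice_special)
  interpret B: lollipop_choice "\<lambda>i. if i \<in> insert k S then i else 0" "\<lambda>i. if i \<in> insert k S then 0 else i"
    by (rule lollipop_choice_special)
  have A: "A.X = ?Y S" and B: "B.X = ?Y (insert k S)" by (rule special_X)+
  from mem obtain M where M: "M \<in> pos_msets" "chromatic_sf (lollipop k 0) = monom (?Y S) M"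
    by (auto simp: special_basis_def prod_of_parts_image_partitions)
  have Bk: "monom (?Y (insert k S)) {#k#} = chromatic_sf (lollipop k 0)"
    by (simp add: special_graph_def)
  have kp: "{#k#} \<in> pos_msets" using k by (simp add: pos_msets_def)
  show False
  proof (cases "k \<in># M")
    \<comment> \<open>On monomials avoiding k the two families of generators agree, so X(K_k) would
      be two different monomials in the generators for \<open>insert k S\<close>.\<close>
    case False
    then have "monom (?Y (insert k S)) M = monom (?Y S) M"
      by (intro monom_cong) (auto simp: special_graph_def)
    then have "monom (?Y (insert k S)) M = monom (?Y (insert k S)) {#k#}" using M(2) Bk by simp
    then have "M = {#k#}" using B.inj_on_monom_X M(1) kp unfolding B inj_on_def by blast
    then show False using False by simp
  next
    case True
    then obtain R where R: "M = add_mset k R" by (metis mset_add)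
    obtain K where K: "size K = k" "coeff (chromatic_sf (lollipop k 0)) K \<noteq> 0"
      using chromatic_sf_lollipop_nonzero[of k 0] by auto
    have "homogeneous (sum_mset M) (monom (?Y S) M)" using A.homogeneous_monom_X[OF M(1)] by (simp add: A)
    \<comment> \<open>Comparing degrees leaves room for no part besides k, so X(K_k) would equal
      X(P_k).\<close>
    then have "sum_mset M = k" using K M(2) by (simp add: homogeneous_def)
    then have "sum_mset R = 0" unfolding R sum_mset.add_mset by linarith
    moreover have "R \<in> pos_msets" using M(1) by (simp add: R pos_msets_def)
    ultimately have "size R = 0" using size_le_sum_mset[of R] by linarith
    then have "R = {#}" by simp
    then have "chromatic_sf (lollipop k 0) = chromatic_sf (lollipop 0 k)"
      using M(2) kS by (simp add: R special_graph_def)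
    moreover have "lollipop 0 k = lollipop 2 (k - 2)"
      using k lollipop_le_2[of 0 k] lollipop_le_2[of 2 "k - 2"] by (simp del: add_2_eq_Suc)
    ultimately show False using chromatic_sf_lollipop_neq[of 2 k "k - 2" 0] k by (simp del: add_2_eq_Suc)
  qed
qed

text \<open>The clique K_k serves as a witness: its function lies in the basis of {k}, and in the
  basis of {j} only for j = k.\<close>

lemma inj_on_special_basis: "inj_on (\<lambda>k. special_basis {k}) {3..}"
proof (rule inj_onI)
  fix j k :: nat assume jk: "j \<in> {3..}" "k \<in> {3..}" "special_basis {j} = special_basis {k}"
  have "{#k#} \<in> pos_msets" using jk by (simp add: pos_msets_def)
  then have "monom (\<lambda>i. chromatic_sf (special_graph {k} i)) {#k#} \<in> special_basis {k}"
    unfolding special_basis_def prod_of_parts_image_partitions by (rule imageI)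
  then have "chromatic_sf (lollipop k 0) \<in> special_basis {j}"
    using jk(3) by (simp add: special_graph_def)
  then show "j = k" using complete_in_special_basis_imp[of k "{j}"] jk by simp
qed

lemma infinitely_many_bases:
  "\<exists>\<B> :: mseries set set. infinite \<B> \<and> countable \<B> \<and>
     (\<forall>B\<in>\<B>. is_basis Sym B \<and>
        (\<forall>f\<in>B. e_positive f \<and> schur_positive f) \<and>
        (\<exists>G :: nat \<Rightarrow> nat sgraph.
           (\<forall>i\<ge>1. simple_graph (G i) \<and> connected_graph (G i)) \<and>
           is_polynomial_ring Sym {1..} (\<lambda>i. chromatic_sf (G i)) \<and>
           B = prod_of_parts (\<lambda>i. chromatic_sf (G i)) ` partitions))"
proof (intro exI[of _ "(\<lambda>k. special_basis {k}) ` {3..}"] conjI ballI)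
  show "infinite ((\<lambda>k. special_basis {k}) ` {3..})"
    using finite_imageD[OF _ inj_on_special_basis] infinite_Ici by blast
  show "countable ((\<lambda>k. special_basis {k}) ` {3..})" by simp
  fix B assume "B \<in> (\<lambda>k. special_basis {k}) ` {3..}"
  then obtain k where B: "B = special_basis {k}" by blast
  interpret lollipop_choice "\<lambda>i. if i \<in> {k} then i else 0" "\<lambda>i. if i \<in> {k} then 0 else i"
    by (rule lollipop_choice_special)
  have X: "X = (\<lambda>i. chromatic_sf (special_graph {k} i))" by (rule special_X)
  have B': "B = prod_of_parts X ` partitions" unfolding B X special_basis_def ..
  show "is_basis Sym B" unfolding B' by (rule is_basis_Sym)
  show "e_positive f" "schur_positive f" if "f \<in> B" for f
    using positive that unfolding B' by blast+
  have "simple_graph (special_graph {k} i) \<and> connected_graph (special_graph {k} i)" if "1 \<le> i" for i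
    using that by (simp add: special_graph_def simple_graph_lollipop connected_graph_lollipop)
  then show "\<exists>G :: nat \<Rightarrow> nat sgraph. (\<forall>i\<ge>1. simple_graph (G i) \<and> connected_graph (G i)) \<and>
      is_polynomial_ring Sym {1..} (\<lambda>i. chromatic_sf (G i)) \<and>
      B = prod_of_parts (\<lambda>i. chromatic_sf (G i)) ` partitions"
    using is_polynomial_ring_X B' unfolding X by blast
qed

text \<open>The claim is proved by contraposition. Degrees force equal generators to have the same
  index, so equality of the two sets becomes equality index by index.\<close>

lemma distinct_lollipops_distinct_generators:
  assumes "\<forall>i\<ge>1. m i + n i = i" "\<forall>i\<ge>1. m' i + n' i = i"
    and eq: "(\<lambda>i. chromatic_sf (lollipop (m i) (n i))) ` {1..} = (\<lambda>i. chromatic_sf (lollipop (m' i) (n' i))) ` {1..}"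
  shows "(\<lambda>i. lollipop (m i) (n i)) ` {1..} = (\<lambda>i. lollipop (m' i) (n' i)) ` {1..}"
proof (rule image_cong[OF refl])
  fix i :: nat assume i: "i \<in> {1..}"
  then have "chromatic_sf (lollipop (m i) (n i)) \<in> (\<lambda>i. chromatic_sf (lollipop (m' i) (n' i))) ` {1..}"
    using eq by blast
  then obtain j where j: "1 \<le> j" "chromatic_sf (lollipop (m i) (n i)) = chromatic_sf (lollipop (m' j) (n' j))"
    by auto
  have "i = j"
    using chromatic_sf_lollipop_eq_imp_size_eq[OF j(2)] assms(1,2) i j(1) by simp
  then show "lollipop (m i) (n i) = lollipop (m' i) (n' i)"
    using lollipop_eq_if_chromatic_sf_eq[OF j(2)] by simp
qed

theorem theorem3p8:
  shows
    "(\<exists>\<B> :: mseries set set. infinite \<B> \<and> countable \<B> \<and>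
       (\<forall>B\<in>\<B>. is_basis Sym B \<and>
          (\<forall>f\<in>B. e_positive f \<and> schur_positive f) \<and>
          (\<exists>G :: nat \<Rightarrow> nat sgraph.
             (\<forall>i\<ge>1. simple_graph (G i) \<and> connected_graph (G i)) \<and>
             is_polynomial_ring Sym {1..} (\<lambda>i. chromatic_sf (G i)) \<and>
             B = prod_of_parts (\<lambda>i. chromatic_sf (G i)) ` partitions)))
     \<and>
     (\<forall>m n :: nat \<Rightarrow> nat. (\<forall>i\<ge>1. m i + n i = i) \<longrightarrow>
        (let X = (\<lambda>i. chromatic_sf (lollipop (m i) (n i))) in
          is_polynomial_ring Sym {1..} X \<and>
          (\<forall>N. is_basis (Sym_degree N) (prod_of_parts X ` partitions_of N) \<and>
               (\<forall>f\<in>prod_of_parts X ` partitions_of N. e_positive f \<and> schur_positive f))))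
     \<and>
     (\<forall>m n m' n' :: nat \<Rightarrow> nat.
        (\<forall>i\<ge>1. m i + n i = i) \<and> (\<forall>i\<ge>1. m' i + n' i = i) \<and>
        (\<lambda>i. lollipop (m i) (n i)) ` {1..} \<noteq> (\<lambda>i. lollipop (m' i) (n' i)) ` {1..} \<longrightarrow>
        (\<lambda>i. chromatic_sf (lollipop (m i) (n i))) ` {1..}
          \<noteq> (\<lambda>i. chromatic_sf (lollipop (m' i) (n' i))) ` {1..})"
proof (intro conjI allI impI)
  fix m n :: "nat \<Rightarrow> nat" assume "\<forall>i\<ge>1. m i + n i = i"
  then interpret lollipop_choice m n by unfold_locales simp
  have X: "X = (\<lambda>i. chromatic_sf (lollipop (m i) (n i)))" by (simp add: X_def fun_eq_iff)
  have "prod_of_parts X ` partitions_of N \<subseteq> prod_of_parts X ` partitions" for N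
    by (auto simp: partitions_of_def)
  then have "is_polynomial_ring Sym {1..} X \<and> (\<forall>N. is_basis (Sym_degree N) (prod_of_parts X ` partitions_of N) \<and>
      (\<forall>f\<in>prod_of_parts X ` partitions_of N. e_positive f \<and> schur_positive f))"
    using is_polynomial_ring_X is_basis_Sym_degree positive by blast
  then show "let X = (\<lambda>i. chromatic_sf (lollipop (m i) (n i))) in
      is_polynomial_ring Sym {1..} X \<and>
      (\<forall>N. is_basis (Sym_degree N) (prod_of_parts X ` partitions_of N) \<and>
           (\<forall>f\<in>prod_of_parts X ` partitions_of N. e_positive f \<and> schur_positive f))"
    unfolding X Let_def .
next
  fix m n m' n' :: "nat \<Rightarrow> nat"
  assume *: "(\<forall>i\<ge>1. m i + n i = i) \<and> (\<forall>i\<ge>1. m' i + n' i = i) \<and>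
      (\<lambda>i. lollipop (m i) (n i)) ` {1..} \<noteq> (\<lambda>i. lollipop (m' i) (n' i)) ` {1..}"
  then show "(\<lambda>i. chromatic_sf (lollipop (m i) (n i))) ` {1..}
      \<noteq> (\<lambda>i. chromatic_sf (lollipop (m' i) (n' i))) ` {1..}"
    using distinct_lollipops_distinct_generators by blast
qed (rule infinitely_many_bases)

end
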